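(* Let $A$ be a closed symmetric operator in a Hilbert space $H$ with dense domain, $\overline{D(A)}=H$. Fix an arbitrary point $\lambda_0\in\mathbb{R}_e$. An arbitrary generalized resolvent $\mathbf{R}_{s;\lambda}$ of $A$ has the form $$\mathbf{R}_{s;\lambda}=\begin{cases}\left(A_{F(\lambda),\lambda_0}-\lambda E_H\right)^{-1}, & \lambda\in\Pi_{\lambda_0},\\ \left(A_{F^*(\overline\lambda),\overline{\lambda_0}}-\lambda E_H\right)^{-1}, & \overline\lambda\in\Pi_{\lambda_0},\end{cases}\qquad( * )$$ where $F(\lambda)$ is a function from $\mathcal{S}(\Pi_{\lambda_0};\mathcal{N}_{\lambda_0}(A),\mathcal{N}_{\overline{\lambda_0}}(A))$. Conversely, an arbitrary function $F(\lambda)\in\mathcal{S}(\Pi_{\lambda_0};\mathcal{N}_{\lambda_0}(A),\mathcal{N}_{\overline{\lambda_0}}(A))$ defines by relation $( * )$ a generalized resolvent $\mathbf{R}_{s;\lambda}$ of $A$. To different functions from $\mathcal{S}(\Pi_{\lambda_0};\mathcal{N}_{\lambda_0}(A),\mathcal{N}_{\overline{\lambda_0}}(A))$ there correspond different generalized resolvents of $A$.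
   Context: Hilbert spaces are complex and separable; operators are linear. $\mathbb{R}_e=\mathbb{C}\setminus\mathbb{R}$; $\Pi_{\lambda_0}$ is the open half-plane ($\mathbb{C}_+$ or $\mathbb{C}_-$) containing $\lambda_0$. $E_H$ is the identity; $P^{\widetilde H}_H$ is the orthogonal projection of $\widetilde H$ onto $H$. For a closed symmetric operator $A$ and $z\in\mathbb{C}$: $\mathcal{M}_z(A)=(A-zE_H)D(A)$, $\mathcal{N}_z(A)=H\ominus\mathcal{M}_z(A)$. Generalized resolvent of $A$: a function $\mathbf{R}_{s;\lambda}=P^{\widetilde H}_H(\widetilde A-\lambda E_{\widetilde H})^{-1}|_H$, $\lambda\in\mathbb{R}_e$, where $\widetilde A\supseteq A$ is a self-adjoint operator in some Hilbert space $\widetilde H\supseteq H$. For $z\in\mathbb{R}_e$, $U_z=U_z(A)=(A-\overline zE_H)(A-zE_H)^{-1}$ is the Cayley transformation, a closed isometric operator from $\mathcal{M}_z(A)$ onto $\mathcal{M}_{\overline z}(A)$; $U_{\overline z}=U_z^{-1}$. For a bounded linear operator $F$ with $D(F)=\mathcal{N}_z(A)$ and $R(F)\subseteq\mathcal{N}_{\overline z}(A)$, the operator $U_z\oplus F$ on $H=\mathcal{M}_z(A)\oplus\mathcal{N}_z(A)$ has no non-zero fixed elements (when $\overline{D(A)}=H$), and the quasi-self-adjoint extension of $A$ defined by $F$ is $$A_{F,z}=zE_H+(z-\overline z)(U_z\oplus F-E_H)^{-1}.$$ For $F(\lambda)$ with $D(F(\lambda))=\mathcal{N}_{\lambda_0}(A)$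 the extension is formed with $z=\lambda_0$; for the adjoint $F^*(\overline\lambda)=(F(\overline\lambda))^*:\mathcal{N}_{\overline{\lambda_0}}(A)\to\mathcal{N}_{\lambda_0}(A)$ it is formed with $z=\overline{\lambda_0}$. $\mathcal{S}(D;N,N')$ is the class of all operator-valued functions analytic in the domain $D$ whose values are linear non-expanding operators (norm $\le1$) mapping the whole Hilbert space $N$ into the Hilbert space $N'$. *)

theory Defs
  imports "HOL-Analysis.Analysis"
begin

section \<open>Separable complex Hilbert spaces\<close>

text \<open>
  The real inner product, the norm and the topology are the ones inherited from
  \<^class>\<open>real_inner\<close>; \<open>Re_cinner\<close> and \<open>scaleR_scaleC\<close> tie them to the complex structure.
  The inner product is linear in its first argument.
\<close>

class chilbert_space = real_inner + complete_space +
  fixes scaleC :: "complex \<Rightarrow> 'a \<Rightarrow> 'a" (infixr "*\<^sub>C" 75)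
    and cinner :: "'a \<Rightarrow> 'a \<Rightarrow> complex"
  assumes scaleC_add_right: "a *\<^sub>C (x + y) = a *\<^sub>C x + a *\<^sub>C y"
    and scaleC_add_left: "(a + b) *\<^sub>C x = a *\<^sub>C x + b *\<^sub>C x"
    and scaleC_scaleC: "a *\<^sub>C (b *\<^sub>C x) = (a * b) *\<^sub>C x"
    and scaleR_scaleC: "r *\<^sub>R x = complex_of_real r *\<^sub>C x"
    and cinner_add_left: "cinner (x + y) z = cinner x z + cinner y z"
    and cinner_scaleC_left: "cinner (a *\<^sub>C x) y = a * cinner x y"
    and cinner_commute: "cinner x y = cnj (cinner y x)"
    and Re_cinner: "Re (cinner x y) = inner x y"
    and separable: "\<exists>D. countable D \<and> (\<forall>x. \<forall>e>0. \<exists>y\<in>D. dist y x < e)"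

definition csubspace :: "'a::chilbert_space set \<Rightarrow> bool" where
  "csubspace M \<longleftrightarrow> 0 \<in> M \<and> (\<forall>x\<in>M. \<forall>y\<in>M. x + y \<in> M) \<and> (\<forall>a. \<forall>x\<in>M. a *\<^sub>C x \<in> M)"

definition orth_compl :: "'a::chilbert_space set \<Rightarrow> 'a set" where
  "orth_compl M = {h. \<forall>m\<in>M. cinner h m = 0}"

definition orth_proj :: "'a::chilbert_space set \<Rightarrow> 'a \<Rightarrow> 'a" where
  "orth_proj M y = (THE p. p \<in> M \<and> y - p \<in> orth_compl M)"

definition linear_isometry :: "('a::chilbert_space \<Rightarrow> 'b::chilbert_space) \<Rightarrow> bool" where
  "linear_isometry V \<longleftrightarrow>
     (\<forall>x y. V (x + y) = V x + V y) \<and> (\<forall>a x. V (a *\<^sub>C x) = a *\<^sub>C V x) \<and>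
     (\<forall>x y. cinner (V x) (V y) = cinner x y)"


section \<open>Linear operators\<close>

text \<open>
  Operators, bounded or not and with arbitrary domain, are represented by their graphs.  Thus the
  domain, the range, the inverse, the product and the inclusion of operators are
  \<^const>\<open>Domain\<close>, \<^const>\<open>Range\<close>, \<^const>\<open>converse\<close>, \<^const>\<open>relcomp\<close> (where \<open>S O T\<close> applies \<open>S\<close> first)
  and \<open>\<subseteq>\<close>, and an operator is closed iff its graph is a closed set.
\<close>

type_synonym 'a operator = "('a \<times> 'a) set"

definition linear_operator :: "'a::chilbert_space operator \<Rightarrow> bool" where
  "linear_operator T \<longleftrightarrow> single_valued T \<and> (0, 0) \<in> T \<and>
     (\<forall>(x, y)\<in>T. \<forall>(x', y')\<in>T. (x + x', y + y') \<in> T) \<and>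
     (\<forall>a. \<forall>(x, y)\<in>T. (a *\<^sub>C x, a *\<^sub>C y) \<in> T)"

text \<open>\<open>affine_op z c T\<close> is the operator \<open>z E + c T\<close>, with the domain of \<open>T\<close>.\<close>

definition affine_op :: "complex \<Rightarrow> complex \<Rightarrow> 'a::chilbert_space operator \<Rightarrow> 'a operator" where
  "affine_op z c T = {(x, z *\<^sub>C x + c *\<^sub>C y) | x y. (x, y) \<in> T}"

abbreviation minus_scalar :: "'a::chilbert_space operator \<Rightarrow> complex \<Rightarrow> 'a operator" where
  "minus_scalar T z \<equiv> affine_op (- z) 1 T"

definition op_resolvent :: "'a::chilbert_space operator \<Rightarrow> complex \<Rightarrow> 'a operator" where
  "op_resolvent T z = (minus_scalar T z)\<inverse>"

definition direct_sum_op ::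
  "'a::chilbert_space operator \<Rightarrow> 'a operator \<Rightarrow> 'a operator" where
  "direct_sum_op S T = {(x + x', y + y') | x y x' y'. (x, y) \<in> S \<and> (x', y') \<in> T}"

text \<open>The adjoint of an operator \<open>T\<close> acting from the Hilbert space \<open>M\<close> to the Hilbert space \<open>N\<close>.\<close>

definition adjoint_op ::
  "'a::chilbert_space set \<Rightarrow> 'a set \<Rightarrow> 'a operator \<Rightarrow> 'a operator" where
  "adjoint_op M N T = {(y, z). y \<in> N \<and> z \<in> M \<and> (\<forall>(x, w)\<in>T. cinner w y = cinner x z)}"

definition closed_symmetric :: "'a::chilbert_space operator \<Rightarrow> bool" where
  "closed_symmetric A \<longleftrightarrow> linear_operator A \<and> closed A \<and>
     (\<forall>(x, y)\<in>A. \<forall>(x', y')\<in>A. cinner y x' = cinner x y')"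

definition self_adjoint_on :: "'a::chilbert_space set \<Rightarrow> 'a operator \<Rightarrow> bool" where
  "self_adjoint_on M T \<longleftrightarrow> linear_operator T \<and> T \<subseteq> M \<times> M \<and> closure (Domain T) = M \<and>
     adjoint_op M M T = T"

definition bounded_operator_between ::
  "'a::chilbert_space set \<Rightarrow> 'a set \<Rightarrow> 'a operator \<Rightarrow> bool" where
  "bounded_operator_between M N T \<longleftrightarrow> linear_operator T \<and> Domain T = M \<and> Range T \<subseteq> N \<and>
     (\<exists>C. \<forall>(x, y)\<in>T. norm y \<le> C * norm x)"

definition nonexpanding_between ::
  "'a::chilbert_space set \<Rightarrow> 'a set \<Rightarrow> 'a operator \<Rightarrow> bool" where
  "nonexpanding_between M N T \<longleftrightarrow> linear_operator T \<and> Domain T = M \<and> Range T \<subseteq> N \<and>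
     (\<forall>(x, y)\<in>T. norm y \<le> norm x)"


section \<open>Analytic operator-valued functions\<close>

text \<open>
  Complex differentiability in the operator norm at each point of the open set \<open>D\<close>:
  the last inequality says that the difference quotient of \<open>F\<close> at \<open>\<zeta>\<close> differs from \<open>G\<close> by at most
  \<open>e\<close> in the norm of bounded operators from \<open>M\<close> to \<open>N\<close>.
\<close>

definition op_analytic_on ::
  "complex set \<Rightarrow> 'a::chilbert_space set \<Rightarrow> 'a set \<Rightarrow> (complex \<Rightarrow> 'a operator) \<Rightarrow> bool" where
  "op_analytic_on D M N F \<longleftrightarrow>
     (\<forall>\<zeta>\<in>D. bounded_operator_between M N (F \<zeta>)) \<and>
     (\<forall>\<zeta>\<in>D. \<exists>G. bounded_operator_between M N G \<and>
        (\<forall>e>0. \<forall>\<^sub>F \<mu> in at \<zeta> within D. \<forall>x y y' w.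
           (x, y) \<in> F \<mu> \<longrightarrow> (x, y') \<in> F \<zeta> \<longrightarrow> (x, w) \<in> G \<longrightarrow>
           norm ((1 / (\<mu> - \<zeta>)) *\<^sub>C (y - y') - w) \<le> e * norm x))"

definition schur_class ::
  "complex set \<Rightarrow> 'a::chilbert_space set \<Rightarrow> 'a set \<Rightarrow> (complex \<Rightarrow> 'a operator) set" where
  "schur_class D M N =
     {F. op_analytic_on D M N F \<and> (\<forall>\<zeta>\<in>D. nonexpanding_between M N (F \<zeta>))}"


section \<open>Cayley transformation and quasi-self-adjoint extensions\<close>

definition half_plane :: "complex \<Rightarrow> complex set" where
  "half_plane \<zeta>\<^sub>0 = {\<zeta>. sgn (Im \<zeta>) = sgn (Im \<zeta>\<^sub>0)}"

definition range_space :: "'a::chilbert_space operator \<Rightarrow> complex \<Rightarrow> 'a set" where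
  "range_space A z = Range (minus_scalar A z)"

definition defect_space :: "'a::chilbert_space operator \<Rightarrow> complex \<Rightarrow> 'a set" where
  "defect_space A z = orth_compl (range_space A z)"

definition cayley :: "'a::chilbert_space operator \<Rightarrow> complex \<Rightarrow> 'a operator" where
  "cayley A z = op_resolvent A z O minus_scalar A (cnj z)"

definition quasi_sa_ext ::
  "'a::chilbert_space operator \<Rightarrow> 'a operator \<Rightarrow> complex \<Rightarrow> 'a operator" where
  "quasi_sa_ext A F z =
     affine_op z (z - cnj z) ((minus_scalar (direct_sum_op (cayley A z) F) 1)\<inverse>)"


section \<open>Generalized resolvents\<close>

text \<open>
  The larger Hilbert space is a closed subspace \<open>K\<close> of the space \<^typ>\<open>'b\<close>.
  The given space \<^typ>\<open>'a\<close> is regarded as a subspace of \<open>K\<close> by means of an isometry \<open>V\<close>, so that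
  \<open>V ` UNIV\<close> plays the role of \<open>H\<close> inside \<open>K\<close>.  Only the values of \<open>R\<close> at
  non-real points matter.
\<close>

definition generalized_resolvent ::
  "'b::chilbert_space itself \<Rightarrow> 'a::chilbert_space operator \<Rightarrow> (complex \<Rightarrow> 'a operator) \<Rightarrow> bool"
  where
  "generalized_resolvent TYPE('b) A R \<longleftrightarrow>
     (\<exists>(K :: 'b set) (V :: 'a \<Rightarrow> 'b) (T :: 'b operator).
        closed K \<and> csubspace K \<and>
        linear_isometry V \<and> range V \<subseteq> K \<and>
        self_adjoint_on K T \<and> map_prod V V ` A \<subseteq> T \<and>
        (\<forall>\<zeta>. \<zeta> \<notin> \<real> \<longrightarrow>
           R \<zeta> = {(x, x'). \<exists>y. (V x, y) \<in> op_resolvent T \<zeta> \<and> V x' = orth_proj (range V) y}))"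

text \<open>
  The right-hand side of the resolvent formula, meaningful at non-real points only; there the
  second case is the one where \<open>cnj \<zeta>\<close> lies in the half-plane of \<open>\<zeta>\<^sub>0\<close>.
\<close>

definition resolvent_family ::
  "'a::chilbert_space operator \<Rightarrow> complex \<Rightarrow> (complex \<Rightarrow> 'a operator) \<Rightarrow> complex \<Rightarrow> 'a operator" where
  "resolvent_family A \<zeta>\<^sub>0 F \<zeta> =
     (if \<zeta> \<in> half_plane \<zeta>\<^sub>0 then op_resolvent (quasi_sa_ext A (F \<zeta>) \<zeta>\<^sub>0) \<zeta>
      else op_resolvent
        (quasi_sa_ext A
          (adjoint_op (defect_space A \<zeta>\<^sub>0) (defect_space A (cnj \<zeta>\<^sub>0)) (F (cnj \<zeta>))) (cnj \<zeta>\<^sub>0)) \<zeta>)"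


section \<open>The sequence space\<close>

text \<open>
  Every separable complex Hilbert space is isometrically isomorphic to a closed subspace of the
  space of square-summable sequences, so this type is large enough to contain, up to isomorphism,
  all Hilbert spaces in which self-adjoint extensions are sought.
\<close>

typedef ell2 = "{f :: nat \<Rightarrow> complex. summable (\<lambda>n. (cmod (f n))\<^sup>2)}"
  by (rule exI[of _ "\<lambda>_. 0"]) simp

setup_lifting type_definition_ell2

lemma square_summable_add:
  fixes f g :: "nat \<Rightarrow> complex"
  assumes "summable (\<lambda>n. (cmod (f n))\<^sup>2)" "summable (\<lambda>n. (cmod (g n))\<^sup>2)"
  shows "summable (\<lambda>n. (cmod (f n + g n))\<^sup>2)"
proof (rule summable_comparison_test')
  show "summable (\<lambda>n. 2 * (cmod (f n))\<^sup>2 + 2 * (cmod (g n))\<^sup>2)"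
    using assms by (intro summable_add summable_mult)
  fix n :: nat
  have "(cmod (f n + g n))\<^sup>2 \<le> (cmod (f n) + cmod (g n))\<^sup>2"
    by (intro power_mono norm_triangle_ineq) auto
  also have "\<dots> \<le> 2 * (cmod (f n))\<^sup>2 + 2 * (cmod (g n))\<^sup>2"
    using sum_squares_bound[of "cmod (f n)" "cmod (g n)"] by (simp add: power2_sum)
  finally show "norm ((cmod (f n + g n))\<^sup>2) \<le> 2 * (cmod (f n))\<^sup>2 + 2 * (cmod (g n))\<^sup>2"
    by simp
qed

lemma square_summable_scale:
  fixes f :: "nat \<Rightarrow> complex"
  assumes "summable (\<lambda>n. (cmod (f n))\<^sup>2)"
  shows "summable (\<lambda>n. (cmod (c * f n))\<^sup>2)"
  using summable_mult[OF assms, of "(cmod c)\<^sup>2"] by (simp add: norm_mult power_mult_distrib)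

lemma square_summable_prod:
  fixes f g :: "nat \<Rightarrow> complex"
  assumes "summable (\<lambda>n. (cmod (f n))\<^sup>2)" "summable (\<lambda>n. (cmod (g n))\<^sup>2)"
  shows "summable (\<lambda>n. f n * cnj (g n))"
proof (rule summable_comparison_test')
  show "summable (\<lambda>n. (cmod (f n))\<^sup>2 + (cmod (g n))\<^sup>2)"
    using assms by (intro summable_add)
  fix n :: nat
  have "0 \<le> cmod (f n) * cmod (g n)"
    by simp
  then show "norm (f n * cnj (g n)) \<le> (cmod (f n))\<^sup>2 + (cmod (g n))\<^sup>2"
    using sum_squares_bound[of "cmod (f n)" "cmod (g n)"] unfolding norm_mult complex_mod_cnj
    by linarith
qed

instantiation ell2 :: real_inner
begin

lift_definition zero_ell2 :: ell2 is "\<lambda>_. 0" by simp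
lift_definition plus_ell2 :: "ell2 \<Rightarrow> ell2 \<Rightarrow> ell2" is "\<lambda>f g n. f n + g n"
  by (rule square_summable_add)
lift_definition uminus_ell2 :: "ell2 \<Rightarrow> ell2" is "\<lambda>f n. - f n" by simp
lift_definition minus_ell2 :: "ell2 \<Rightarrow> ell2 \<Rightarrow> ell2" is "\<lambda>f g n. f n - g n"
proof -
  fix f g :: "nat \<Rightarrow> complex"
  assume "summable (\<lambda>n. (cmod (f n))\<^sup>2)" "summable (\<lambda>n. (cmod (g n))\<^sup>2)"
  then show "summable (\<lambda>n. (cmod (f n - g n))\<^sup>2)"
    using square_summable_add[of f "\<lambda>n. - g n"] by simp
qed
lift_definition scaleR_ell2 :: "real \<Rightarrow> ell2 \<Rightarrow> ell2" is "\<lambda>r f n. complex_of_real r * f n"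
  by (rule square_summable_scale)
lift_definition inner_ell2 :: "ell2 \<Rightarrow> ell2 \<Rightarrow> real" is "\<lambda>f g. \<Sum>n. Re (f n * cnj (g n))" .
definition norm_ell2 :: "ell2 \<Rightarrow> real" where "norm_ell2 x = sqrt (inner x x)"
definition sgn_ell2 :: "ell2 \<Rightarrow> ell2" where "sgn_ell2 x = scaleR (inverse (norm x)) x"
definition dist_ell2 :: "ell2 \<Rightarrow> ell2 \<Rightarrow> real" where "dist_ell2 x y = norm (x - y)"
definition uniformity_ell2 :: "(ell2 \<times> ell2) filter" where
  "uniformity_ell2 = (INF e\<in>{0 <..}. principal {(x, y). dist x y < e})"
definition open_ell2 :: "ell2 set \<Rightarrow> bool" where
  "open_ell2 U \<longleftrightarrow> (\<forall>x\<in>U. \<forall>\<^sub>F (x', y) in uniformity. x' = x \<longrightarrow> y \<in> U)"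

instance
proof
  fix x y z :: ell2 and a b r :: real
  show "x + y + z = x + (y + z)" by transfer (simp add: add.assoc)
  show "x + y = y + x" by transfer (simp add: add.commute)
  show "0 + x = x" by transfer simp
  show "- x + x = 0" by transfer simp
  show "x - y = x + - y" by transfer simp
  show "a *\<^sub>R (x + y) = a *\<^sub>R x + a *\<^sub>R y" by transfer (simp add: algebra_simps)
  show "(a + b) *\<^sub>R x = a *\<^sub>R x + b *\<^sub>R x" by transfer (simp add: algebra_simps)
  show "a *\<^sub>R b *\<^sub>R x = (a * b) *\<^sub>R x" by transfer (simp add: algebra_simps)
  show "1 *\<^sub>R x = x" by transfer simp
  show "sgn x = scaleR (inverse (norm x)) x" by (rule sgn_ell2_def)
  show "dist x y = norm (x - y)" by (rule dist_ell2_def)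
  show "uniformity = (INF e\<in>{0 <..}. principal {(x, y::ell2). dist x y < e})"
    by (rule uniformity_ell2_def)
  show "open U \<longleftrightarrow> (\<forall>x\<in>U. \<forall>\<^sub>F (x', y) in uniformity. x' = x \<longrightarrow> y \<in> U)" for U :: "ell2 set"
    by (rule open_ell2_def)
  show "inner x y = inner y x" by transfer (simp add: algebra_simps)
  show "inner (x + y) z = inner x z + inner y z"
  proof transfer
    fix f g h :: "nat \<Rightarrow> complex"
    assume "summable (\<lambda>n. (cmod (f n))\<^sup>2)" "summable (\<lambda>n. (cmod (g n))\<^sup>2)"
      "summable (\<lambda>n. (cmod (h n))\<^sup>2)"
    then have "summable (\<lambda>n. Re (f n * cnj (h n)))" "summable (\<lambda>n. Re (g n * cnj (h n)))"
      using summable_Re square_summable_prod by blast+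
    from suminf_add[OF this]
    show "(\<Sum>n. Re ((f n + g n) * cnj (h n))) =
        (\<Sum>n. Re (f n * cnj (h n))) + (\<Sum>n. Re (g n * cnj (h n)))"
      by (simp add: algebra_simps)
  qed
  show "inner (r *\<^sub>R x) y = r * inner x y"
  proof transfer
    fix r and f g :: "nat \<Rightarrow> complex"
    assume "summable (\<lambda>n. (cmod (f n))\<^sup>2)" "summable (\<lambda>n. (cmod (g n))\<^sup>2)"
    then have "summable (\<lambda>n. Re (f n * cnj (g n)))"
      by (intro summable_Re square_summable_prod)
    from suminf_mult[OF this, of r]
    show "(\<Sum>n. Re (complex_of_real r * f n * cnj (g n))) = r * (\<Sum>n. Re (f n * cnj (g n)))"
      by (simp add: algebra_simps)
  qed
  show "0 \<le> inner x x"
  proof transfer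
    fix f :: "nat \<Rightarrow> complex"
    assume "summable (\<lambda>n. (cmod (f n))\<^sup>2)"
    then show "0 \<le> (\<Sum>n. Re (f n * cnj (f n)))"
      by (intro suminf_nonneg summable_Re square_summable_prod) auto
  qed
  show "inner x x = 0 \<longleftrightarrow> x = 0"
  proof transfer
    fix f :: "nat \<Rightarrow> complex"
    assume f: "summable (\<lambda>n. (cmod (f n))\<^sup>2)"
    have "(\<Sum>n. Re (f n * cnj (f n))) = 0 \<longleftrightarrow> (\<forall>n. Re (f n * cnj (f n)) = 0)"
      by (intro suminf_eq_zero_iff summable_Re square_summable_prod f) auto
    also have "\<dots> \<longleftrightarrow> f = (\<lambda>_. 0)"
      by (auto simp: fun_eq_iff complex_eq_iff add_nonneg_eq_0_iff)
    finally show "(\<Sum>n. Re (f n * cnj (f n))) = 0 \<longleftrightarrow> f = (\<lambda>_. 0)" .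
  qed
  show "norm x = sqrt (inner x x)" by (rule norm_ell2_def)
qed

end

lemma norm_ell2_sq: "(norm x)\<^sup>2 = (\<Sum>n. (cmod (Rep_ell2 x n))\<^sup>2)"
  unfolding power2_norm_eq_inner[where 'a = ell2] inner_ell2.rep_eq
  by (simp add: cmod_power2 flip: power2_eq_square)

lemma summable_Rep_ell2: "summable (\<lambda>n. (cmod (Rep_ell2 x n))\<^sup>2)"
  using Rep_ell2 by auto

lemma Rep_ell2_minus: "Rep_ell2 (x - y) n = Rep_ell2 x n - Rep_ell2 y n"
  by (simp add: minus_ell2.rep_eq)

lemma ell2_partial_sum_le: "(\<Sum>n<N. (cmod (Rep_ell2 x n))\<^sup>2) \<le> (norm x)\<^sup>2"
  unfolding norm_ell2_sq by (intro sum_le_suminf summable_Rep_ell2) auto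

lemma ell2_norm_le:
  assumes "\<And>N. (\<Sum>n<N. (cmod (Rep_ell2 x n))\<^sup>2) \<le> c\<^sup>2" "0 \<le> c"
  shows "norm x \<le> c"
proof -
  have "(norm x)\<^sup>2 \<le> c\<^sup>2"
    unfolding norm_ell2_sq by (intro suminf_le_const summable_Rep_ell2 assms)
  then show ?thesis
    using assms(2) by (rule power2_le_imp_le)
qed

instance ell2 :: complete_space
proof
  fix X :: "nat \<Rightarrow> ell2"
  assume X: "Cauchy X"
  have coord: "cmod (Rep_ell2 x k) \<le> norm x" for x k
  proof -
    have "(cmod (Rep_ell2 x k))\<^sup>2 \<le> (\<Sum>n<Suc k. (cmod (Rep_ell2 x n))\<^sup>2)"
      by (rule member_le_sum) auto
    also have "\<dots> \<le> (norm x)\<^sup>2"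
      by (rule ell2_partial_sum_le)
    finally show ?thesis
      by (rule power2_le_imp_le) simp
  qed
  have "Cauchy (\<lambda>m. Rep_ell2 (X m) k)" for k
  proof (rule metric_CauchyI)
    fix e :: real
    assume "0 < e"
    then obtain M where M: "\<And>m n. m \<ge> M \<Longrightarrow> n \<ge> M \<Longrightarrow> dist (X m) (X n) < e"
      using metric_CauchyD[OF X] by blast
    have "dist (Rep_ell2 (X m) k) (Rep_ell2 (X n) k) < e" if "m \<ge> M" "n \<ge> M" for m n
      using M[OF that] coord[of "X m - X n" k] by (simp add: dist_norm Rep_ell2_minus)
    then show "\<exists>M. \<forall>m\<ge>M. \<forall>n\<ge>M. dist (Rep_ell2 (X m) k) (Rep_ell2 (X n) k) < e"
      by blast
  qed
  then have "\<forall>k. \<exists>l. (\<lambda>m. Rep_ell2 (X m) k) \<longlonglongrightarrow> l"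
    using Cauchy_convergent_iff convergent_def by metis
  then obtain f where f: "\<And>k. (\<lambda>m. Rep_ell2 (X m) k) \<longlonglongrightarrow> f k"
    by metis
  have tail: "(\<Sum>k<N. (cmod (Rep_ell2 (X m) k - f k))\<^sup>2) \<le> e\<^sup>2"
    if "\<And>n. n \<ge> M \<Longrightarrow> dist (X m) (X n) < e" for N m M e
  proof (rule LIMSEQ_le_const2)
    show "(\<lambda>n. \<Sum>k<N. (cmod (Rep_ell2 (X m) k - Rep_ell2 (X n) k))\<^sup>2)
        \<longlonglongrightarrow> (\<Sum>k<N. (cmod (Rep_ell2 (X m) k - f k))\<^sup>2)"
      by (intro tendsto_intros f)
    have "(\<Sum>k<N. (cmod (Rep_ell2 (X m) k - Rep_ell2 (X n) k))\<^sup>2) \<le> e\<^sup>2" if "n \<ge> M" for n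
    proof -
      have "(\<Sum>k<N. (cmod (Rep_ell2 (X m) k - Rep_ell2 (X n) k))\<^sup>2) \<le> (norm (X m - X n))\<^sup>2"
        using ell2_partial_sum_le[where x = "X m - X n" and N = N] by (simp add: Rep_ell2_minus)
      also have "\<dots> \<le> e\<^sup>2"
        using \<open>\<And>n. n \<ge> M \<Longrightarrow> dist (X m) (X n) < e\<close>[OF that]
        by (intro power_mono) (auto simp: dist_norm)
      finally show ?thesis .
    qed
    then show "\<exists>M. \<forall>n\<ge>M. (\<Sum>k<N. (cmod (Rep_ell2 (X m) k - Rep_ell2 (X n) k))\<^sup>2) \<le> e\<^sup>2"
      by blast
  qed
  obtain M1 where M1: "\<And>n. n \<ge> M1 \<Longrightarrow> dist (X M1) (X n) < 1"
    using metric_CauchyD[OF X, of 1] by auto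
  have "summable (\<lambda>k. (cmod (Rep_ell2 (X M1) k - f k))\<^sup>2)"
    using tail[OF M1] by (intro summableI_nonneg_bounded[where x = "1\<^sup>2"]) auto
  then have "summable (\<lambda>k. (cmod (Rep_ell2 (X M1) k + - 1 * (Rep_ell2 (X M1) k - f k)))\<^sup>2)"
    by (intro square_summable_add square_summable_scale summable_Rep_ell2)
  then have "summable (\<lambda>k. (cmod (f k))\<^sup>2)"
    by simp
  then have Rep: "Rep_ell2 (Abs_ell2 f) = f"
    by (simp add: Abs_ell2_inverse)
  have "X \<longlonglongrightarrow> Abs_ell2 f"
  proof (rule metric_LIMSEQ_I)
    fix e :: real
    assume "0 < e"
    then obtain M where M: "\<And>m n. m \<ge> M \<Longrightarrow> n \<ge> M \<Longrightarrow> dist (X m) (X n) < e / 2"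
      using metric_CauchyD[OF X, of "e / 2"] by auto
    have "dist (X m) (Abs_ell2 f) < e" if "m \<ge> M" for m
    proof -
      have "norm (X m - Abs_ell2 f) \<le> e / 2"
        using tail[OF M[OF that]] \<open>0 < e\<close>
        by (intro ell2_norm_le) (auto simp: Rep_ell2_minus Rep)
      then show ?thesis
        using \<open>0 < e\<close> by (simp add: dist_norm)
    qed
    then show "\<exists>M. \<forall>m\<ge>M. dist (X m) (Abs_ell2 f) < e"
      by blast
  qed
  then show "convergent X"
    by (rule convergentI)
qed

instantiation ell2 :: chilbert_space
begin

lift_definition scaleC_ell2 :: "complex \<Rightarrow> ell2 \<Rightarrow> ell2" is "\<lambda>c f n. c * f n"
  by (rule square_summable_scale)
lift_definition cinner_ell2 :: "ell2 \<Rightarrow> ell2 \<Rightarrow> complex" is "\<lambda>f g. \<Sum>n. f n * cnj (g n)" .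

instance
proof
  fix x y z :: ell2 and a b :: complex and r :: real
  show "a *\<^sub>C (x + y) = a *\<^sub>C x + a *\<^sub>C y" by transfer (simp add: algebra_simps)
  show "(a + b) *\<^sub>C x = a *\<^sub>C x + b *\<^sub>C x" by transfer (simp add: algebra_simps)
  show "a *\<^sub>C (b *\<^sub>C x) = (a * b) *\<^sub>C x" by transfer (simp add: algebra_simps)
  show "r *\<^sub>R x = complex_of_real r *\<^sub>C x" by transfer simp
  show "cinner (x + y) z = cinner x z + cinner y z"
  proof transfer
    fix f g h :: "nat \<Rightarrow> complex"
    assume "summable (\<lambda>n. (cmod (f n))\<^sup>2)" "summable (\<lambda>n. (cmod (g n))\<^sup>2)"
      "summable (\<lambda>n. (cmod (h n))\<^sup>2)"
    then have "summable (\<lambda>n. f n * cnj (h n))" "summable (\<lambda>n. g n * cnj (h n))"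
      by (auto intro!: square_summable_prod)
    from suminf_add[OF this]
    show "(\<Sum>n. (f n + g n) * cnj (h n)) = (\<Sum>n. f n * cnj (h n)) + (\<Sum>n. g n * cnj (h n))"
      by (simp add: algebra_simps)
  qed
  show "cinner (a *\<^sub>C x) y = a * cinner x y"
  proof transfer
    fix a and f g :: "nat \<Rightarrow> complex"
    assume "summable (\<lambda>n. (cmod (f n))\<^sup>2)" "summable (\<lambda>n. (cmod (g n))\<^sup>2)"
    from suminf_mult[OF square_summable_prod[OF this], of a]
    show "(\<Sum>n. a * f n * cnj (g n)) = a * (\<Sum>n. f n * cnj (g n))"
      by (simp add: algebra_simps)
  qed
  show "cinner x y = cnj (cinner y x)"
  proof transfer
    fix f g :: "nat \<Rightarrow> complex"
    assume "summable (\<lambda>n. (cmod (f n))\<^sup>2)" "summable (\<lambda>n. (cmod (g n))\<^sup>2)"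
    then have "(\<lambda>n. g n * cnj (f n)) sums (\<Sum>n. g n * cnj (f n))"
      by (intro summable_sums square_summable_prod)
    then have "(\<lambda>n. cnj (g n * cnj (f n))) sums cnj (\<Sum>n. g n * cnj (f n))"
      by (simp only: sums_cnj)
    then show "(\<Sum>n. f n * cnj (g n)) = cnj (\<Sum>n. g n * cnj (f n))"
      by (simp add: sums_iff mult.commute)
  qed
  show "Re (cinner x y) = inner x y"
  proof transfer
    fix f g :: "nat \<Rightarrow> complex"
    assume "summable (\<lambda>n. (cmod (f n))\<^sup>2)" "summable (\<lambda>n. (cmod (g n))\<^sup>2)"
    from Re_suminf[OF square_summable_prod[OF this]]
    show "Re (\<Sum>n. f n * cnj (g n)) = (\<Sum>n. Re (f n * cnj (g n)))" .
  qed
  define q :: "(rat \<times> rat) list \<Rightarrow> nat \<Rightarrow> complex" where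
    "q l n = (if n < length l then Complex (of_rat (fst (l ! n))) (of_rat (snd (l ! n))) else 0)"
    for l n
  have sq: "summable (\<lambda>n. (cmod (q l n))\<^sup>2)" for l
    by (rule summable_finite[of "{..<length l}"]) (auto simp: q_def)
  define D where "D = range (\<lambda>l. Abs_ell2 (q l))"
  have Rep: "Rep_ell2 (Abs_ell2 (q l)) = q l" for l
    using sq by (simp add: Abs_ell2_inverse)
  have "\<exists>y\<in>D. dist y x < e" if "0 < e" for x and e :: real
  proof -
    have "0 < e\<^sup>2 / 4"
      using that by simp
    from suminf_exist_split[OF this summable_Rep_ell2[of x]]
    obtain N where N: "norm (\<Sum>i. (cmod (Rep_ell2 x (i + N)))\<^sup>2) < e\<^sup>2 / 4"
      by auto
    define d where "d = e / (4 * (real N + 1))"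
    have "0 < d"
      using that by (simp add: d_def)
    have dense: "\<exists>s :: rat. \<bar>of_rat s - u\<bar> < d" for u :: real
    proof -
      obtain s where "u < of_rat s" "of_rat s < u + d"
        using of_rat_dense[of u "u + d"] \<open>0 < d\<close> by auto
      then show ?thesis
        by (intro exI[of _ s]) auto
    qed
    have "\<exists>p :: rat \<times> rat. cmod (Complex (of_rat (fst p)) (of_rat (snd p)) - c) \<le> 2 * d" for c
    proof -
      obtain s t :: rat where st: "\<bar>of_rat s - Re c\<bar> < d" "\<bar>of_rat t - Im c\<bar> < d"
        using dense by blast
      have "cmod (Complex (of_rat s) (of_rat t) - c) \<le> \<bar>of_rat s - Re c\<bar> + \<bar>of_rat t - Im c\<bar>"
        using cmod_le[of "Complex (of_rat s) (of_rat t) - c"] by simp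
      with st show ?thesis
        by (intro exI[of _ "(s, t)"]) auto
    qed
    then obtain p :: "complex \<Rightarrow> rat \<times> rat" where
      p: "\<And>c. cmod (Complex (of_rat (fst (p c))) (of_rat (snd (p c))) - c) \<le> 2 * d"
      by metis
    define l where "l = map (\<lambda>n. p (Rep_ell2 x n)) [0..<N]"
    define y where "y = Abs_ell2 (q l)"
    have len: "length l = N"
      by (simp add: l_def)
    have lo: "(cmod (Rep_ell2 (y - x) n))\<^sup>2 \<le> (2 * d)\<^sup>2" if "n < N" for n
      using that p[of "Rep_ell2 x n"]
      by (intro power_mono) (auto simp: Rep_ell2_minus y_def Rep q_def len l_def)
    have hi: "Rep_ell2 (y - x) (n + N) = - Rep_ell2 x (n + N)" for n
      by (simp add: Rep_ell2_minus y_def Rep q_def len)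
    have "(norm (y - x))\<^sup>2 =
        (\<Sum>n. (cmod (Rep_ell2 (y - x) (n + N)))\<^sup>2) + (\<Sum>n<N. (cmod (Rep_ell2 (y - x) n))\<^sup>2)"
      unfolding norm_ell2_sq by (rule suminf_split_initial_segment[OF summable_Rep_ell2])
    also have "\<dots> \<le> (\<Sum>n. (cmod (Rep_ell2 x (n + N)))\<^sup>2) + (\<Sum>n<N. (2 * d)\<^sup>2)"
      unfolding hi norm_minus_cancel by (intro add_left_mono sum_mono lo) auto
    also have "\<dots> < e\<^sup>2 / 4 + real N * (2 * d)\<^sup>2"
      using N by simp
    also have "real N * (2 * d)\<^sup>2 \<le> e\<^sup>2 / 4"
    proof -
      have "real N * (2 * d)\<^sup>2 \<le> (real N + 1)\<^sup>2 * (2 * d)\<^sup>2"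
        by (intro mult_right_mono) (auto simp: power2_eq_square algebra_simps)
      also have "\<dots> = (2 * d * (real N + 1))\<^sup>2"
        by (simp add: power_mult_distrib)
      also have "2 * d * (real N + 1) = e / 2"
      proof -
        have "real N + 1 \<noteq> 0"
          by linarith
        then show ?thesis
          by (simp add: d_def field_simps)
      qed
      also have "(e / 2)\<^sup>2 = e\<^sup>2 / 4"
        by (simp add: power_divide)
      finally show ?thesis .
    qed
    also have "e\<^sup>2 / 4 + e\<^sup>2 / 4 \<le> e\<^sup>2"
      by simp
    finally have "(norm (y - x))\<^sup>2 < e\<^sup>2"
      by simp
    then have "norm (y - x) < e"
      using that by (intro power2_less_imp_less[of _ e]) auto
    then show ?thesis
      unfolding D_def y_def dist_norm by blast
  qed
  moreover have "countable D"
    unfolding D_def by simp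
  ultimately show "\<exists>D :: ell2 set. countable D \<and> (\<forall>x. \<forall>e>0. \<exists>y\<in>D. dist y x < e)"
    by blast
qed

end

end

theory Submission
  imports Defs "HOL-Complex_Analysis.Complex_Analysis"
begin

text \<open>
  All operators are read through the Cayley transformation at \<open>z = \<zeta>\<^sub>0\<close>.  With the disk coordinate
  \<open>w = (\<zeta> - z) / (\<zeta> - cnj z)\<close>, the resolvent at \<open>\<zeta>\<close> of the operator with Cayley transform \<open>W\<close> is
  \<open>(\<zeta> - cnj z) (g - w W g) \<mapsto> W g - g\<close>.

  Given a self-adjoint extension with Cayley transform \<open>U\<close>, write \<open>P\<close> for the projection onto the
  given space and \<open>Q = 1 - P\<close>.  The compressed resolvent then has the above form with
  \<open>W(w) = P U (1 - w Q U)\<inverse>\<close>, a contractive analytic function extending the Cayley transform of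
  \<open>A\<close>; being contractive and isometric on one subspace, it maps the orthogonal complement of this
  subspace into the orthogonal complement of the image, which gives \<open>F\<close>.

  Conversely, \<open>F\<close> yields \<open>W(w)\<close>, and \<open>\<Phi>(w) = (1 - w W(w))\<inverse>\<close> satisfies \<open>Re \<Phi> \<ge> 1/2\<close>.  Integrating over
  circles of radius \<open>r\<close> and letting \<open>r\<close> tend to 1 shows that the Taylor coefficients of \<open>\<Phi>\<close> form a
  positive semidefinite Toeplitz kernel.  A Cholesky factorization realizes the kernel in \<open>ell2\<close>,
  where the shift is a unitary operator \<open>U\<close> with \<open>P (1 - w U)\<inverse> P = \<Phi>(w)\<close>.  It has no non-zero fixed
  vector because \<open>A\<close> is densely defined and the shifts of the given space span, so its inverse
  Cayley transform is self-adjoint.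

  The second half-plane follows by taking adjoints, and uniqueness holds because every step from
  \<open>F(\<zeta>)\<close> to the resolvent is invertible.
\<close>

section \<open>Complex Hilbert spaces\<close>

text \<open>The shape of \<open>W(w)\<close> comes from solving \<open>(1 - w U) g = V x\<close> in
  two stages, \<open>V\<close> being the embedding of the given space. If \<open>k\<close> denotes
  the inner component of \<open>g\<close>, the outer component of the equation gives
  \<open>g = (1 - w Q U)\<inverse> V k\<close>, and the inner one then reads
  \<open>k - w W(w) k = x\<close>. So the compression of \<open>(1 - w U)\<inverse>\<close> is
  \<open>(1 - w W(w))\<inverse>\<close>. It is this function, rather than \<open>W\<close>, that is
  dilated, because its Taylor coefficients are to be the compressed powers of \<open>U\<close>. The
  bound 1/2 says that \<open>2 \<Phi> - 1\<close> has non-negative real part; subtracting 1 is what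
  makes the Toeplitz kernel count its diagonal once. The function \<Phi> determines
  \<open>w W(w)\<close>, hence \<open>W(w)\<close> for \<open>w \<noteq> 0\<close>. At
  \<open>w = 0\<close> the compression of \<open>U\<close> is read off the linear Taylor coefficient
  of \<Phi>, which is \<open>W(0)\<close>; the same coefficient shows that \<open>U\<close> extends
  the Cayley transformation of \<open>A\<close>. The dilation has to live in the one type
  \<open>ell2\<close>. The kernel is therefore factorized over a countable index set, the integer
  shifts of a dense sequence, and formulas for all vectors follow by continuity.\<close>

lemma scaleC_one [simp]: "1 *\<^sub>C (x :: 'a::chilbert_space) = x"
  using scaleR_scaleC[of 1 x] by simp

lemma scaleC_zero_right [simp]: "a *\<^sub>C (0 :: 'a::chilbert_space) = 0"
  using scaleC_add_right[of a 0 0] by simp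

lemma scaleC_zero_left [simp]: "0 *\<^sub>C (x :: 'a::chilbert_space) = 0"
  using scaleC_add_left[of 0 0 x] by simp

lemma scaleC_minus_left [simp]: "(- a) *\<^sub>C (x :: 'a::chilbert_space) = - (a *\<^sub>C x)"
  using scaleC_add_left[of "- a" a x] by (simp add: add_eq_0_iff)

lemma scaleC_minus_right [simp]: "a *\<^sub>C (- x :: 'a::chilbert_space) = - (a *\<^sub>C x)"
  using scaleC_add_right[of a "- x" x] by (simp add: add_eq_0_iff)

lemma scaleC_diff_left: "(a - b) *\<^sub>C (x :: 'a::chilbert_space) = a *\<^sub>C x - b *\<^sub>C x"
  using scaleC_add_left[of a "- b" x] by simp

lemma scaleC_diff_right: "a *\<^sub>C (x - y :: 'a::chilbert_space) = a *\<^sub>C x - a *\<^sub>C y"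
  using scaleC_add_right[of a x "- y"] by simp

lemmas scaleC_simps = scaleC_add_left scaleC_add_right scaleC_diff_left scaleC_diff_right
  scaleC_scaleC

lemma scaleC_eq_0_iff [simp]: "a *\<^sub>C (x :: 'a::chilbert_space) = 0 \<longleftrightarrow> a = 0 \<or> x = 0"
proof -
  have "x = 0" if "a \<noteq> 0" "a *\<^sub>C x = 0"
  proof -
    have "x = inverse a *\<^sub>C (a *\<^sub>C x)"
      using that(1) by (simp only: scaleC_scaleC) simp
    with that(2) show ?thesis by simp
  qed
  then show ?thesis by auto
qed

lemma scaleC_cancel_left: "a \<noteq> 0 \<Longrightarrow> a *\<^sub>C (x :: 'a::chilbert_space) = a *\<^sub>C y \<longleftrightarrow> x = y"
  using scaleC_eq_0_iff[of a "x - y"] by (simp add: scaleC_diff_right)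

lemma cinner_add_right: "cinner x (y + z) = cinner x y + cinner x (z :: 'a::chilbert_space)"
  by (subst (1 2 3) cinner_commute) (simp add: cinner_add_left)

lemma cinner_scaleC_right: "cinner x (a *\<^sub>C y) = cnj a * cinner x (y :: 'a::chilbert_space)"
  by (subst (1 2) cinner_commute) (simp add: cinner_scaleC_left)

lemma cinner_zero_left [simp]: "cinner 0 (x :: 'a::chilbert_space) = 0"
  using cinner_add_left[of 0 0 x] by simp

lemma cinner_zero_right [simp]: "cinner (x :: 'a::chilbert_space) 0 = 0"
  using cinner_add_right[of x 0 0] by simp

lemma cinner_minus_left [simp]: "cinner (- x) (y :: 'a::chilbert_space) = - cinner x y"
  using cinner_add_left[of "- x" x y] by (simp add: add_eq_0_iff)

lemma cinner_minus_right [simp]: "cinner (x :: 'a::chilbert_space) (- y) = - cinner x y"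
  using cinner_add_right[of x "- y" y] by (simp add: add_eq_0_iff)

lemma cinner_diff_left: "cinner (x - y) (z :: 'a::chilbert_space) = cinner x z - cinner y z"
  using cinner_add_left[of x "- y" z] by simp

lemma cinner_diff_right: "cinner x (y - z :: 'a::chilbert_space) = cinner x y - cinner x z"
  using cinner_add_right[of x y "- z"] by simp

lemmas cinner_simps = cinner_add_left cinner_add_right cinner_diff_left cinner_diff_right
  cinner_scaleC_left cinner_scaleC_right

lemma cinner_sum_left:
  "cinner (\<Sum>i\<in>S. f i) (y :: 'a::chilbert_space) = (\<Sum>i\<in>S. cinner (f i) y)"
  by (induction S rule: infinite_finite_induct) (auto simp: cinner_add_left)

lemma cinner_sum_right:
  "cinner y (\<Sum>i\<in>S. f i :: 'a::chilbert_space) = (\<Sum>i\<in>S. cinner y (f i))"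
  by (induction S rule: infinite_finite_induct) (auto simp: cinner_add_right)

lemma cinner_self: "cinner x x = complex_of_real ((norm (x :: 'a::chilbert_space))\<^sup>2)"
proof (rule complex_eqI)
  show "Im (cinner x x) = Im (complex_of_real ((norm x)\<^sup>2))"
    using arg_cong[OF cinner_commute[of x x], of Im] by simp
qed (simp add: Re_cinner power2_norm_eq_inner)

lemma cinner_self_eq_0_iff [simp]: "cinner x (x :: 'a::chilbert_space) = 0 \<longleftrightarrow> x = 0"
  by (simp add: cinner_self)

lemma norm_sq_add: "(norm (x + y :: 'a::chilbert_space))\<^sup>2 =
    (norm x)\<^sup>2 + 2 * Re (cinner x y) + (norm y)\<^sup>2"
  by (simp add: Re_cinner power2_norm_eq_inner inner_simps inner_commute)

lemma norm_sq_diff: "(norm (x - y :: 'a::chilbert_space))\<^sup>2 =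
    (norm x)\<^sup>2 - 2 * Re (cinner x y) + (norm y)\<^sup>2"
  by (simp add: Re_cinner power2_norm_eq_inner inner_simps inner_commute)

lemma norm_scaleC [simp]: "norm (a *\<^sub>C (x :: 'a::chilbert_space)) = cmod a * norm x"
proof -
  have "complex_of_real ((norm (a *\<^sub>C x))\<^sup>2) = (a * cnj a) * complex_of_real ((norm x)\<^sup>2)"
    unfolding cinner_self[symmetric] cinner_scaleC_left cinner_scaleC_right by simp
  also have "\<dots> = complex_of_real ((cmod a * norm x)\<^sup>2)"
    unfolding complex_norm_square[symmetric] by (simp add: power_mult_distrib)
  finally have "(norm (a *\<^sub>C x))\<^sup>2 = (cmod a * norm x)\<^sup>2"
    by (simp only: of_real_eq_iff)
  then show ?thesis
    by (rule power2_eq_imp_eq) auto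
qed

lemma norm_cinner_le: "cmod (cinner x y) \<le> norm x * norm (y :: 'a::chilbert_space)"
proof (cases "cinner x y = 0")
  case False
  define a where "a = cnj (cinner x y) / cmod (cinner x y)"
  have "cmod a = 1"
    using False by (simp add: a_def norm_divide)
  have "a * cinner x y = cmod (cinner x y)"
    using False by (simp add: a_def mult.commute complex_norm_square[symmetric] power2_eq_square)
  then have "cmod (cinner x y) = Re (cinner (a *\<^sub>C x) y)"
    by (simp add: cinner_scaleC_left)
  also have "\<dots> \<le> norm (a *\<^sub>C x) * norm y"
    unfolding Re_cinner by (rule norm_cauchy_schwarz)
  finally show ?thesis
    by (simp add: \<open>cmod a = 1\<close>)
qed simp

instance chilbert_space \<subseteq> banach ..

lemma bounded_bilinear_cinner: "bounded_bilinear (cinner :: 'a::chilbert_space \<Rightarrow> 'a \<Rightarrow> complex)"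
proof
  show "\<exists>K. \<forall>a b :: 'a. norm (cinner a b) \<le> norm a * norm b * K"
    using norm_cinner_le by (intro exI[of _ 1]) auto
qed (auto simp: cinner_simps scaleR_scaleC scaleR_conv_of_real)

lemma bounded_bilinear_scaleC: "bounded_bilinear (scaleC :: complex \<Rightarrow> 'a::chilbert_space \<Rightarrow> 'a)"
proof
  show "\<exists>K. \<forall>a (b :: 'a). norm (a *\<^sub>C b) \<le> norm a * norm b * K"
    by (intro exI[of _ 1]) auto
qed (auto simp: scaleC_simps scaleR_scaleC scaleR_conv_of_real mult.commute)

lemmas tendsto_cinner [tendsto_intros] = bounded_bilinear.tendsto[OF bounded_bilinear_cinner]
lemmas tendsto_scaleC [tendsto_intros] = bounded_bilinear.tendsto[OF bounded_bilinear_scaleC]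
lemmas continuous_on_cinner [continuous_intros] =
  bounded_bilinear.continuous_on[OF bounded_bilinear_cinner]
lemmas continuous_on_scaleC [continuous_intros] =
  bounded_bilinear.continuous_on[OF bounded_bilinear_scaleC]

lemma cinner_eq_all_imp_eq: "(\<And>y. cinner x y = cinner x' y) \<Longrightarrow> x = (x' :: 'a::chilbert_space)"
proof -
  assume "\<And>y. cinner x y = cinner x' y"
  then have "cinner (x - x') (x - x') = 0"
    by (simp add: cinner_diff_left)
  then show ?thesis
    by simp
qed

section \<open>Orthogonal projections\<close>

lemma csubspaceD:
  assumes "csubspace M"
  shows csubspace_0: "0 \<in> M"
    and csubspace_add: "x \<in> M \<Longrightarrow> y \<in> M \<Longrightarrow> x + y \<in> M"
    and csubspace_scaleC: "x \<in> M \<Longrightarrow> a *\<^sub>C x \<in> M"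
  using assms by (auto simp: csubspace_def)

lemma csubspace_minus: "csubspace M \<Longrightarrow> x \<in> M \<Longrightarrow> - x \<in> M"
  using csubspace_scaleC[of M x "- 1"] by simp

lemma csubspace_diff: "csubspace M \<Longrightarrow> x \<in> M \<Longrightarrow> y \<in> M \<Longrightarrow> x - y \<in> M"
  using csubspace_add[of M x "- y"] csubspace_minus by auto

lemma csubspace_UNIV: "csubspace UNIV"
  by (simp add: csubspace_def)

lemma csubspace_orth_compl: "csubspace (orth_compl M)"
  by (auto simp: csubspace_def orth_compl_def cinner_simps)

lemma orth_complD: "x \<in> orth_compl M \<Longrightarrow> m \<in> M \<Longrightarrow> cinner x m = 0"
  by (simp add: orth_compl_def)

lemma orth_complD': "x \<in> orth_compl M \<Longrightarrow> m \<in> M \<Longrightarrow> cinner m x = 0"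
  by (subst cinner_commute) (simp add: orth_compl_def)

lemma csubspace_closure:
  assumes "csubspace M"
  shows "csubspace (closure M)"
  unfolding csubspace_def
proof (intro conjI ballI allI)
  show "0 \<in> closure M"
    using csubspace_0[OF assms] closure_subset by blast
  fix x assume "x \<in> closure M"
  then obtain f where f: "\<And>n. f n \<in> M" "f \<longlonglongrightarrow> x"
    by (auto simp: closure_sequential)
  show "a *\<^sub>C x \<in> closure M" for a
    unfolding closure_sequential
    by (rule exI[of _ "\<lambda>n. a *\<^sub>C f n"]) (auto intro!: tendsto_intros f csubspace_scaleC[OF assms])
  fix y assume "y \<in> closure M"
  then obtain g where g: "\<And>n. g n \<in> M" "g \<longlonglongrightarrow> y"
    by (auto simp: closure_sequential)
  show "x + y \<in> closure M"
    unfolding closure_sequential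
    by (rule exI[of _ "\<lambda>n. f n + g n"]) (auto intro!: tendsto_intros f g csubspace_add[OF assms])
qed

lemma orth_compl_closure:
  assumes "x \<in> orth_compl M"
  shows "x \<in> orth_compl (closure M)"
proof -
  have "closed {m. cinner x m = 0}"
    by (intro closed_Collect_eq continuous_intros)
  moreover have "M \<subseteq> {m. cinner x m = 0}"
    using assms by (auto simp: orth_compl_def)
  ultimately have "closure M \<subseteq> {m. cinner x m = 0}"
    by (rule closure_minimal[rotated])
  then show ?thesis
    by (auto simp: orth_compl_def)
qed

lemma orth_decomp_unique:
  assumes M: "csubspace M" and "p \<in> M" "x - p \<in> orth_compl M" "q \<in> M" "x - q \<in> orth_compl M"
  shows "p = q"
proof -
  have "p - q \<in> M"
    using assms csubspace_diff by blast
  moreover have "(x - q) - (x - p) \<in> orth_compl M"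
    using assms csubspace_diff[OF csubspace_orth_compl] by blast
  ultimately have "cinner (p - q) (p - q) = 0"
    using orth_complD[of "p - q" M "p - q"] by simp
  then show ?thesis by simp
qed

text \<open>A minimizing sequence for the distance to \<open>M\<close> is Cauchy, and minimality of
  its limit against perturbations inside \<open>M\<close> gives orthogonality.\<close>

lemma orth_decomp_exists:
  fixes M :: "'a::chilbert_space set"
  assumes M: "csubspace M" and cl: "closed M"
  shows "\<exists>p\<in>M. x - p \<in> orth_compl M"
proof -
  define d where "d = (INF m\<in>M. (norm (x - m))\<^sup>2)"
  have bdd: "bdd_below ((\<lambda>m. (norm (x - m))\<^sup>2) ` M)"
    by (rule bdd_belowI[of _ 0]) auto
  have d_le: "d \<le> (norm (x - m))\<^sup>2" if "m \<in> M" for m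
    unfolding d_def using that by (intro cINF_lower bdd)
  have "M \<noteq> {}"
    using csubspace_0[OF M] by auto
  have "\<exists>m\<in>M. (norm (x - m))\<^sup>2 < d + e" if "e > 0" for e
    using cINF_less_iff[OF \<open>M \<noteq> {}\<close> bdd, of "d + e"] that unfolding d_def by auto
  then have "\<forall>n. \<exists>m\<in>M. (norm (x - m))\<^sup>2 < d + inverse (real (Suc n))"
    by simp
  then obtain f where f: "\<And>n. f n \<in> M" "\<And>n. (norm (x - f n))\<^sup>2 < d + inverse (real (Suc n))"
    by metis
  \<comment> \<open>The midpoint of two almost-minimizers lies in \<open>M\<close>, so its distance
    is at least \<open>d\<close>; the parallelogram law then bounds \<open>p - q\<close>.\<close>
  have close: "(norm (p - q))\<^sup>2 \<le> 4 * e"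
    if "p \<in> M" "q \<in> M" "(norm (x - p))\<^sup>2 < d + e" "(norm (x - q))\<^sup>2 < d + e" for p q e
  proof -
    have "(1/2) *\<^sub>C (p + q) \<in> M"
      using that M by (intro csubspace_scaleC csubspace_add)
    from d_le[OF this] have "4 * d \<le> (norm (2 *\<^sub>C (x - (1/2) *\<^sub>C (p + q))))\<^sup>2"
      by (simp only: norm_scaleC power_mult_distrib) simp
    also have "2 *\<^sub>C (x - (1/2) *\<^sub>C (p + q)) = (x - p) + (x - q)"
    proof -
      have "2 *\<^sub>C x = x + x"
        using scaleC_add_left[of 1 1 x] by simp
      then show ?thesis
        by (simp add: scaleC_diff_right scaleC_scaleC)
    qed
    finally have "4 * d \<le> (norm ((x - p) + (x - q)))\<^sup>2" .
    moreover have "(norm ((x - p) + (x - q)))\<^sup>2 + (norm ((x - p) - (x - q)))\<^sup>2 =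
        2 * (norm (x - p))\<^sup>2 + 2 * (norm (x - q))\<^sup>2"
      by (simp only: norm_sq_add norm_sq_diff) simp
    moreover have "norm ((x - p) - (x - q)) = norm (p - q)"
      by (simp add: norm_minus_commute)
    ultimately show ?thesis
      using that by simp
  qed
  have "Cauchy f"
  proof (rule metric_CauchyI)
    fix e :: real
    assume "0 < e"
    then obtain N where N: "inverse (real (Suc N)) < e\<^sup>2 / 4"
      using reals_Archimedean[of "e\<^sup>2 / 4"] by auto
    have "dist (f m) (f n) < e" if "m \<ge> N" "n \<ge> N" for m n
    proof -
      have le: "inverse (real (Suc k)) \<le> inverse (real (Suc N))" if "k \<ge> N" for k
        using that by (intro le_imp_inverse_le) auto
      have "(norm (f m - f n))\<^sup>2 \<le> 4 * inverse (real (Suc N))"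
        using le[OF \<open>m \<ge> N\<close>] le[OF \<open>n \<ge> N\<close>] f(2)[of m] f(2)[of n] by (intro close f(1)) linarith+
      also have "\<dots> < e\<^sup>2"
        using N by simp
      finally show ?thesis
        using \<open>0 < e\<close> by (simp add: dist_norm power2_less_imp_less)
    qed
    then show "\<exists>M. \<forall>m\<ge>M. \<forall>n\<ge>M. dist (f m) (f n) < e"
      by blast
  qed
  then obtain p where p: "f \<longlonglongrightarrow> p"
    using Cauchy_convergent convergent_def by blast
  have "p \<in> M"
    using closed_sequentially[OF cl f(1) p] .
  have "(norm (x - p))\<^sup>2 \<le> d + 0"
  proof (rule LIMSEQ_le)
    show "(\<lambda>n. (norm (x - f n))\<^sup>2) \<longlonglongrightarrow> (norm (x - p))\<^sup>2"
      by (intro tendsto_intros p)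
    show "(\<lambda>n. d + inverse (real (Suc n))) \<longlonglongrightarrow> d + 0"
      by (intro tendsto_intros LIMSEQ_inverse_real_of_nat)
  qed (use f(2) less_imp_le in blast)
  then have min: "(norm (x - p))\<^sup>2 \<le> (norm (x - m))\<^sup>2" if "m \<in> M" for m
    using d_le[OF that] by linarith
  have "cinner (x - p) m = 0" if "m \<in> M" for m
  proof (cases "m = 0")
    case False
    define c where "c = cinner (x - p) m"
    \<comment> \<open>The coefficient of \<open>x - p\<close> along \<open>m\<close>; moving
      \<open>p\<close> by this multiple of \<open>m\<close> would lower the squared distance by
      \<open>(cmod c)\<^sup>2 / (norm m)\<^sup>2\<close>.\<close>
    define t where "t = c / (norm m)\<^sup>2"
    have "p + t *\<^sub>C m \<in> M"
      using \<open>p \<in> M\<close> that M by (intro csubspace_add csubspace_scaleC)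
    from min[OF this] have "(norm (x - p))\<^sup>2 \<le> (norm ((x - p) - t *\<^sub>C m))\<^sup>2"
      by (simp add: diff_diff_eq)
    also have "\<dots> = (norm (x - p))\<^sup>2 - 2 * Re (cnj t * c) + (cmod t * norm m)\<^sup>2"
      by (simp add: norm_sq_diff cinner_scaleC_right c_def)
    also have "cnj t * c = complex_of_real ((cmod c)\<^sup>2 / (norm m)\<^sup>2)"
      unfolding t_def of_real_divide complex_norm_square by simp
    also have "(cmod t * norm m)\<^sup>2 = (cmod c)\<^sup>2 / (norm m)\<^sup>2"
      using False by (simp add: t_def norm_divide norm_power power_mult_distrib power_divide field_simps)
    finally have "(cmod c)\<^sup>2 / (norm m)\<^sup>2 \<le> 0"
      by simp
    then show ?thesis
      using False by (simp add: c_def divide_le_0_iff)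
  qed simp
  with \<open>p \<in> M\<close> show ?thesis
    by (auto simp: orth_compl_def)
qed

lemma orth_proj_eqI:
  assumes "csubspace M" "p \<in> M" "x - p \<in> orth_compl M"
  shows "orth_proj M x = p"
  unfolding orth_proj_def using assms orth_decomp_unique[OF assms(1)] by (intro the_equality) blast+

lemma
  assumes "csubspace M" "closed M"
  shows orth_proj_in: "orth_proj M x \<in> M"
    and orth_proj_diff: "x - orth_proj M x \<in> orth_compl M"
proof -
  obtain p where "p \<in> M" "x - p \<in> orth_compl M"
    using orth_decomp_exists[OF assms] by blast
  moreover from this have "orth_proj M x = p"
    by (rule orth_proj_eqI[OF assms(1)])
  ultimately show "orth_proj M x \<in> M" "x - orth_proj M x \<in> orth_compl M"
    by simp_all
qed

lemma orth_proj_id: "csubspace M \<Longrightarrow> x \<in> M \<Longrightarrow> orth_proj M x = x"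
  by (rule orth_proj_eqI) (auto simp: csubspace_0[OF csubspace_orth_compl])

section \<open>Complex-linear maps, the Riesz representation and adjoints\<close>

definition clinear :: "('a::chilbert_space \<Rightarrow> 'b::chilbert_space) \<Rightarrow> bool" where
  "clinear f \<longleftrightarrow> (\<forall>x y. f (x + y) = f x + f y) \<and> (\<forall>a x. f (a *\<^sub>C x) = a *\<^sub>C f x)"

lemma clinearD:
  assumes "clinear f"
  shows clinear_add: "f (x + y) = f x + f y"
    and clinear_scaleC: "f (a *\<^sub>C x) = a *\<^sub>C f x"
    and clinear_0: "f 0 = 0"
    and clinear_minus: "f (- x) = - f x"
    and clinear_diff: "f (x - y) = f x - f y"
proof -
  show add: "f (x + y) = f x + f y" for x y
    using assms by (simp add: clinear_def)
  show sc: "f (a *\<^sub>C x) = a *\<^sub>C f x" for a x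
    using assms by (simp add: clinear_def)
  show "f 0 = 0"
    using sc[of 0 0] by simp
  show neg: "f (- x) = - f x" for x
    using sc[of "- 1" x] by simp
  show "f (x - y) = f x - f y"
    using add[of x "- y"] by (simp add: neg)
qed

lemma clinear_compose: "clinear f \<Longrightarrow> clinear g \<Longrightarrow> clinear (\<lambda>x. f (g x))"
  by (simp add: clinear_def)

lemma clinear_bounded_linear:
  assumes "clinear f" "\<And>x. norm (f x) \<le> C * norm x"
  shows "bounded_linear f"
proof (rule bounded_linear_intro)
  show "norm (f x) \<le> norm x * C" for x
    using assms(2)[of x] by (simp add: mult.commute)
qed (auto simp: clinearD[OF assms(1)] scaleR_scaleC)

lemma clinear_orth_proj:
  assumes "csubspace M" "closed M"
  shows "clinear (orth_proj M)"
  unfolding clinear_def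
proof (intro conjI allI)
  note in' = orth_proj_in[OF assms] and df = orth_proj_diff[OF assms]
  show "orth_proj M (x + y) = orth_proj M x + orth_proj M y" for x y
    using csubspace_add[OF csubspace_orth_compl df[of x] df[of y]]
    by (intro orth_proj_eqI csubspace_add in' assms) (simp add: algebra_simps)
  show "orth_proj M (a *\<^sub>C x) = a *\<^sub>C orth_proj M x" for a x
    using csubspace_scaleC[OF csubspace_orth_compl df[of x], of a]
    by (intro orth_proj_eqI csubspace_scaleC in' assms) (simp add: scaleC_diff_right)
qed

lemma orth_proj_pythagoras:
  assumes "csubspace M" "closed M"
  shows "(norm x)\<^sup>2 = (norm (orth_proj M x))\<^sup>2 + (norm (x - orth_proj M x))\<^sup>2"
  using norm_sq_add[of "orth_proj M x" "x - orth_proj M x"]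
    orth_complD'[OF orth_proj_diff[OF assms] orth_proj_in[OF assms]] by simp

lemma norm_orth_proj_le:
  assumes "csubspace M" "closed M"
  shows "norm (orth_proj M x) \<le> norm x"
  by (rule power2_le_imp_le) (simp_all add: orth_proj_pythagoras[OF assms, of x])

lemma closed_csubspace_eqI:
  assumes "csubspace M" "closed M" "csubspace N" "M \<subseteq> N" "\<And>x. x \<in> N \<Longrightarrow> x \<in> orth_compl M \<Longrightarrow> x = 0"
  shows "M = N"
proof -
  have "x \<in> M" if "x \<in> N" for x
  proof -
    have "x - orth_proj M x = 0"
      using that assms orth_proj_in[OF assms(1,2), of x] orth_proj_diff[OF assms(1,2), of x]
      by (intro assms(5)) (auto intro!: csubspace_diff)
    then show ?thesis
      using orth_proj_in[OF assms(1,2), of x] by simp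
  qed
  with assms show ?thesis by auto
qed

lemma riesz_functional:
  fixes f :: "'a::chilbert_space \<Rightarrow> complex"
  assumes add: "\<And>x y. f (x + y) = f x + f y" and scale: "\<And>a x. f (a *\<^sub>C x) = a * f x"
    and bound: "\<And>x. cmod (f x) \<le> C * norm x"
  shows "\<exists>u. \<forall>x. f x = cinner x u"
proof (cases "\<forall>x. f x = 0")
  case False
  have bl: "bounded_linear f"
    using bound by (intro bounded_linear_intro[of f C])
      (auto simp: add scale scaleR_scaleC mult.commute scaleR_conv_of_real)
  have f_diff: "f (x - y) = f x - f y" for x y
    using linear_diff[OF bounded_linear.linear[OF bl]] .
  define M where "M = {x. f x = 0}"
  have M: "csubspace M"
    using scale[of 0 0] by (auto simp: csubspace_def M_def add scale)
  have "closed M"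
    unfolding M_def
    by (intro closed_Collect_eq bounded_linear.continuous_on[OF bl] continuous_intros)
  have "M \<noteq> UNIV"
    using False by (auto simp: M_def)
  then obtain q where q: "q \<in> orth_compl M" "q \<noteq> 0"
    using closed_csubspace_eqI[OF M \<open>closed M\<close> csubspace_UNIV] by auto
  have "f q \<noteq> 0"
    using q orth_complD[of q M q] by (auto simp: M_def)
  \<comment> \<open>The normal vector of the kernel, scaled so that
    \<open>cinner q u = f q\<close>.\<close>
  define u where "u = cnj (f q / (norm q)\<^sup>2) *\<^sub>C q"
  have "f x = cinner x u" for x
  proof -
    have "f q *\<^sub>C x - f x *\<^sub>C q \<in> M"
      by (simp add: M_def f_diff scale)
    then have "cinner (f q *\<^sub>C x - f x *\<^sub>C q) q = 0"
      using orth_complD'[OF q(1)] by blast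
    then have "f q * cinner x q = f x * (norm q)\<^sup>2"
      by (simp add: cinner_simps cinner_self)
    then show ?thesis
      using q(2) by (simp add: u_def cinner_scaleC_right field_simps)
  qed
  then show ?thesis by blast
qed (auto intro!: exI[of _ 0])

lemma adjoint_exists:
  fixes L :: "'a::chilbert_space \<Rightarrow> 'b::chilbert_space"
  assumes "clinear L" "\<And>x. norm (L x) \<le> C * norm x"
  obtains L' where "clinear L'" "\<And>x y. cinner (L x) y = cinner x (L' y)"
proof -
  have "\<exists>u. \<forall>x. cinner (L x) y = cinner x u" for y
  proof (rule riesz_functional)
    fix x
    have "cmod (cinner (L x) y) \<le> norm (L x) * norm y"
      by (rule norm_cinner_le)
    also have "\<dots> \<le> C * norm x * norm y"
      by (intro mult_right_mono assms(2)) auto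
    finally show "cmod (cinner (L x) y) \<le> (C * norm y) * norm x"
      by (simp add: mult_ac)
  qed (auto simp: clinearD[OF assms(1)] cinner_simps)
  then obtain L' where L': "\<And>x y. cinner (L x) y = cinner x (L' y)"
    by metis
  have ext: "u = v" if "\<And>x. cinner x u = cinner x v" for u v :: 'a
    by (rule cinner_eq_all_imp_eq) (subst (1 2) cinner_commute, simp add: that)
  have "clinear L'"
    unfolding clinear_def
    by (intro conjI allI ext) (simp_all add: cinner_simps flip: L')
  with L' show ?thesis
    using that by blast
qed

section \<open>Neumann inverses of contractions\<close>

lemma neumann:
  fixes X :: "'a::chilbert_space \<Rightarrow> 'a"
  assumes X: "clinear X" "\<And>x. norm (X x) \<le> norm x" and w: "cmod w < 1"
  shows "\<exists>!y. y - w *\<^sub>C X y = v"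
proof -
  \<comment> \<open>The factor |w| alone makes \<open>y \<mapsto> v + w X y\<close> a strict
    contraction, even if \<open>X\<close> is isometric.\<close>
  have "dist (v + w *\<^sub>C X x) (v + w *\<^sub>C X y) = cmod w * norm (X (x - y))" for x y
    by (simp add: dist_norm clinear_diff[OF X(1)] flip: scaleC_diff_right norm_scaleC)
  then have "\<exists>!y. v + w *\<^sub>C X y = y"
    using X(2) w by (intro banach_fix_type[of "cmod w"]) (auto simp: dist_norm mult_left_mono)
  then show ?thesis
    by (simp add: diff_eq_eq) (simp only: eq_commute)
qed

text \<open>This is \<open>(1 - w X)\<inverse>\<close> for a contraction \<open>X\<close> and |w| <
  1.\<close>

definition neumann_inv :: "complex \<Rightarrow> ('a::chilbert_space \<Rightarrow> 'a) \<Rightarrow> 'a \<Rightarrow> 'a" where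
  "neumann_inv w X v = (THE y. y - w *\<^sub>C X y = v)"

context
  fixes X :: "'a::chilbert_space \<Rightarrow> 'a" and w :: complex
  assumes X: "clinear X" "\<And>x. norm (X x) \<le> norm x" and w: "cmod w < 1"
begin

lemma neumann_inv_right: "neumann_inv w X v - w *\<^sub>C X (neumann_inv w X v) = v"
  unfolding neumann_inv_def by (rule theI'[OF neumann[OF X w]])

lemma neumann_inv_eqI: "y - w *\<^sub>C X y = v \<Longrightarrow> neumann_inv w X v = y"
  unfolding neumann_inv_def by (rule the1_equality[OF neumann[OF X w]])

lemma clinear_neumann_inv: "clinear (neumann_inv w X)"
proof -
  note eq = neumann_inv_right
  have "neumann_inv w X (u + v) = neumann_inv w X u + neumann_inv w X v" for u v
    using eq[of u] eq[of v]
    by (intro neumann_inv_eqI) (simp add: clinearD[OF X(1)] scaleC_simps add_diff_add)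
  moreover have "neumann_inv w X (a *\<^sub>C u) = a *\<^sub>C neumann_inv w X u" for a u
    by (rule neumann_inv_eqI, subst (3) eq[symmetric, of u])
       (simp add: clinearD[OF X(1)] scaleC_simps mult.commute)
  ultimately show ?thesis
    by (simp add: clinear_def)
qed

lemma norm_neumann_inv_le: "norm (neumann_inv w X v) \<le> norm v / (1 - cmod w)"
proof -
  let ?y = "neumann_inv w X v"
  have "norm ?y - norm (w *\<^sub>C X ?y) \<le> norm v"
    using norm_triangle_ineq2[of ?y "w *\<^sub>C X ?y"] by (simp only: neumann_inv_right)
  moreover have "norm (w *\<^sub>C X ?y) \<le> cmod w * norm ?y"
    by (simp add: X(2) mult_left_mono)
  ultimately have "norm ?y * (1 - cmod w) \<le> norm v"
    by (simp add: algebra_simps)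
  then show ?thesis
    using w by (simp add: pos_le_divide_eq)
qed

end

section \<open>Graphs of operators\<close>

lemma linear_operatorD:
  assumes "linear_operator T"
  shows linear_operator_unique: "(x, y) \<in> T \<Longrightarrow> (x, y') \<in> T \<Longrightarrow> y = y'"
    and linear_operator_0: "(0, 0) \<in> T"
    and linear_operator_add: "(x, y) \<in> T \<Longrightarrow> (x', y') \<in> T \<Longrightarrow> (x + x', y + y') \<in> T"
    and linear_operator_scaleC: "(x, y) \<in> T \<Longrightarrow> (a *\<^sub>C x, a *\<^sub>C y) \<in> T"
  using assms by (auto simp: linear_operator_def single_valued_def)

lemma linear_operator_diff:
  assumes "linear_operator T" "(x, y) \<in> T" "(x', y') \<in> T"
  shows "(x - x', y - y') \<in> T"
  using linear_operator_add[OF assms(1,2) linear_operator_scaleC[OF assms(1,3), of "- 1"]] by simp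

lemma linear_operatorI:
  assumes "\<And>y. (0, y) \<in> T \<Longrightarrow> y = 0" "(0, 0) \<in> T"
    and "\<And>x y x' y'. (x, y) \<in> T \<Longrightarrow> (x', y') \<in> T \<Longrightarrow> (x + x', y + y') \<in> T"
    and "\<And>a x y. (x, y) \<in> T \<Longrightarrow> (a *\<^sub>C x, a *\<^sub>C y) \<in> T"
  shows "linear_operator T"
proof -
  have "y = y'" if "(x, y) \<in> T" "(x, y') \<in> T" for x y y'
    using assms(1)[of "y - y'"] assms(3)[OF that(1) assms(4)[OF that(2), of "- 1"]] by simp
  then show ?thesis
    using assms(2-4) by (auto simp: linear_operator_def single_valued_def)
qed

lemma csubspace_Domain:
  assumes "linear_operator T"
  shows "csubspace (Domain T)"
  using linear_operatorD(2-4)[OF assms] unfolding csubspace_def by blast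

lemma in_affine_op: "(x, y') \<in> affine_op z c T \<longleftrightarrow> (\<exists>y. (x, y) \<in> T \<and> y' = z *\<^sub>C x + c *\<^sub>C y)"
  by (auto simp: affine_op_def)

lemma in_minus_scalar: "(x, h) \<in> minus_scalar T z \<longleftrightarrow> (x, h + z *\<^sub>C x) \<in> T"
  by (auto simp: in_affine_op)

lemma in_op_resolvent: "(h, x) \<in> op_resolvent T z \<longleftrightarrow> (x, h + z *\<^sub>C x) \<in> T"
  by (simp add: op_resolvent_def in_minus_scalar)

lemma in_range_space: "h \<in> range_space T z \<longleftrightarrow> (\<exists>x. (x, h + z *\<^sub>C x) \<in> T)"
  by (simp add: range_space_def Range_iff in_minus_scalar)

lemma in_cayley_iff:
  "(g, u) \<in> cayley T z \<longleftrightarrow> (\<exists>x. (x, g + z *\<^sub>C x) \<in> T \<and> (x, u + cnj z *\<^sub>C x) \<in> T)"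
  by (auto simp: cayley_def in_op_resolvent in_minus_scalar)

lemma cayleyI: "(x, y) \<in> T \<Longrightarrow> (y - z *\<^sub>C x, y - cnj z *\<^sub>C x) \<in> cayley T z"
  unfolding in_cayley_iff by (rule exI[of _ x]) simp

lemma cayleyE:
  assumes "linear_operator T" "(g, u) \<in> cayley T z"
  obtains x y where "(x, y) \<in> T" "g = y - z *\<^sub>C x" "u = y - cnj z *\<^sub>C x"
proof -
  from assms(2) obtain x where x: "(x, g + z *\<^sub>C x) \<in> T" "(x, u + cnj z *\<^sub>C x) \<in> T"
    by (auto simp: in_cayley_iff)
  have "u = g + z *\<^sub>C x - cnj z *\<^sub>C x"
    using linear_operator_unique[OF assms(1) x] by (simp add: eq_diff_eq)
  then show ?thesis
    using that[OF x(1)] by simp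
qed

lemma Domain_cayley: "Domain (cayley T z) = range_space T z"
proof -
  have "h \<in> Domain (cayley T z)" if "(x, h + z *\<^sub>C x) \<in> T" for h x
    using cayleyI[OF that, of z] by auto
  then show ?thesis
    by (auto simp: in_cayley_iff in_range_space)
qed

lemma cayley_converse: "(cayley T z)\<inverse> = cayley T (cnj z)"
  by (auto simp: in_cayley_iff)

lemma Range_cayley: "Range (cayley T z) = range_space T (cnj z)"
  unfolding Domain_cayley[symmetric] cayley_converse[symmetric] by simp

lemma linear_operator_op_resolvent:
  assumes "linear_operator T" "\<And>x. (x, z *\<^sub>C x) \<in> T \<Longrightarrow> x = 0"
  shows "linear_operator (op_resolvent T z)"
proof (rule linear_operatorI)
  show "(x + x', y + y') \<in> op_resolvent T z"
    if "(x, y) \<in> op_resolvent T z" "(x', y') \<in> op_resolvent T z" for x y x' y'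
    using linear_operator_add[OF assms(1), of y "x + z *\<^sub>C y" y' "x' + z *\<^sub>C y'"] that
    by (simp add: in_op_resolvent scaleC_add_right add_ac)
  show "(a *\<^sub>C x, a *\<^sub>C y) \<in> op_resolvent T z" if "(x, y) \<in> op_resolvent T z" for a x y
    using linear_operator_scaleC[OF assms(1), of y "x + z *\<^sub>C y" a] that
    by (simp add: in_op_resolvent scaleC_add_right scaleC_scaleC mult.commute)
qed (use assms linear_operator_0[OF assms(1)] in \<open>auto simp: in_op_resolvent\<close>)

definition graph_fun :: "('a \<times> 'b) set \<Rightarrow> 'a \<Rightarrow> 'b" where
  "graph_fun T x = (THE y. (x, y) \<in> T)"

lemma graph_fun_eqI: "linear_operator T \<Longrightarrow> (x, y) \<in> T \<Longrightarrow> graph_fun T x = y"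
  unfolding graph_fun_def using linear_operator_unique by blast

lemma graph_fun_in: "linear_operator T \<Longrightarrow> x \<in> Domain T \<Longrightarrow> (x, graph_fun T x) \<in> T"
  using graph_fun_eqI by (metis DomainE)

definition total_graph :: "('a \<Rightarrow> 'b) \<Rightarrow> ('a \<times> 'b) set" where
  "total_graph W = range (\<lambda>x. (x, W x))"

lemma in_total_graph [simp]: "(x, y) \<in> total_graph W \<longleftrightarrow> y = W x"
  by (auto simp: total_graph_def)

lemma total_graphI:
  assumes "linear_operator T" "Domain T = UNIV"
  shows "clinear (graph_fun T)" "T = total_graph (graph_fun T)"
proof -
  have *: "(x, graph_fun T x) \<in> T" for x
    by (rule graph_fun_in) (use assms in auto)
  show "clinear (graph_fun T)"
    unfolding clinear_def
    using linear_operatorD(3,4)[OF assms(1)] graph_fun_eqI[OF assms(1)] * by blast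
  show "T = total_graph (graph_fun T)"
    using * graph_fun_eqI[OF assms(1)] by auto
qed

section \<open>Closed symmetric operators\<close>

lemma not_Reals_iff: "z \<notin> \<real> \<longleftrightarrow> Im z \<noteq> 0"
  by (simp add: complex_is_Real_iff)

lemma diff_cnj_nonzero: "z \<notin> \<real> \<Longrightarrow> z - cnj z \<noteq> 0"
  by (simp add: not_Reals_iff complex_eq_iff)

text \<open>A convergent sequence in the domain has a Cauchy sequence of values, so its limit keeps
  a value in the closed graph. It is applied to resolvents, to close ranges of \<open>A - z\<close>,
  and to closures of isometric relations.\<close>

lemma closed_Domain_lipschitz:
  fixes R :: "('a::complete_space \<times> 'b::complete_space) set"
  assumes cl: "closed R"
    and lip: "\<And>x y x' y'. (x, y) \<in> R \<Longrightarrow> (x', y') \<in> R \<Longrightarrow> dist y y' \<le> c * dist x x'"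
  shows "closed (Domain R)"
  unfolding closed_sequential_limits
proof (intro allI impI, elim conjE)
  fix f l
  assume f: "\<forall>n. f n \<in> Domain R" "f \<longlonglongrightarrow> l"
  then have "\<forall>n. \<exists>y. (f n, y) \<in> R"
    by blast
  then obtain g where g: "\<And>n. (f n, g n) \<in> R"
    by metis
  have "Cauchy g"
  proof (rule metric_CauchyI)
    fix e :: real
    assume "0 < e"
    then have "0 < e / (\<bar>c\<bar> + 1)"
      by simp
    then obtain N where N: "\<And>m n. m \<ge> N \<Longrightarrow> n \<ge> N \<Longrightarrow> dist (f m) (f n) < e / (\<bar>c\<bar> + 1)"
      using metric_CauchyD[OF LIMSEQ_imp_Cauchy[OF f(2)]] by blast
    have "dist (g m) (g n) < e" if "m \<ge> N" "n \<ge> N" for m n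
    proof -
      have "dist (g m) (g n) \<le> c * dist (f m) (f n)"
        by (rule lip[OF g g])
      also have "\<dots> \<le> (\<bar>c\<bar> + 1) * dist (f m) (f n)"
        by (intro mult_right_mono) auto
      also have "\<dots> < e"
        using N[OF that] by (subst mult.commute) (simp add: pos_less_divide_eq)
      finally show ?thesis .
    qed
    then show "\<exists>M. \<forall>m\<ge>M. \<forall>n\<ge>M. dist (g m) (g n) < e"
      by blast
  qed
  then obtain y where y: "g \<longlonglongrightarrow> y"
    using Cauchy_convergent convergent_def by blast
  have "(l, y) \<in> R"
    using closed_sequentially[OF cl, of "\<lambda>n. (f n, g n)"] g tendsto_Pair[OF f(2) y] by blast
  then show "l \<in> Domain R"
    by blast
qed

context
  fixes A :: "'a::chilbert_space operator"
  assumes A: "closed_symmetric A"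
begin

lemma closed_symmetric_linear: "linear_operator A"
  using A by (simp add: closed_symmetric_def)

lemma symmetricD: "(x, y) \<in> A \<Longrightarrow> (x', y') \<in> A \<Longrightarrow> cinner y x' = cinner x y'"
  using A by (auto simp: closed_symmetric_def)

lemma symmetric_real:
  assumes "(x, y) \<in> A"
  shows "Im (cinner y x) = 0"
  using symmetricD[OF assms assms] arg_cong[OF cinner_commute[of x y], of Im] by simp

text \<open>Replacing \<open>z\<close> by \<open>cnj z\<close> exchanges the coefficients of the two
  mixed terms \<open>cinner y x'\<close> and \<open>cinner x y'\<close>, which symmetry makes
  equal.\<close>

lemma cayley_cinner:
  assumes "(g, u) \<in> cayley A z" "(g', u') \<in> cayley A z"
  shows "cinner u u' = cinner g g'"
proof -
  from assms obtain x y x' y' where xy: "(x, y) \<in> A" "(x', y') \<in> A"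
    "g = y - z *\<^sub>C x" "u = y - cnj z *\<^sub>C x" "g' = y' - z *\<^sub>C x'" "u' = y' - cnj z *\<^sub>C x'"
    by (elim cayleyE[OF closed_symmetric_linear])
  show ?thesis
    unfolding xy using symmetricD[OF xy(1,2)] by (simp add: cinner_simps algebra_simps)
qed

lemma cayley_norm: "(g, u) \<in> cayley A z \<Longrightarrow> norm u = norm g"
  using cayley_cinner[of g u z g u] unfolding cinner_self of_real_eq_iff by simp

text \<open>Since \<open>cinner y x\<close> is real, the imaginary part of
  \<open>cinner (y - z *\<^sub>C x) x\<close> is \<open>- Im z * (norm x)\<^sup>2\<close>; the
  Cauchy-Schwarz inequality does the rest.\<close>

lemma symmetric_bounded_below:
  assumes "(x, y) \<in> A"
  shows "\<bar>Im z\<bar> * norm x \<le> norm (y - z *\<^sub>C x)"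
proof (cases "x = 0")
  case False
  have "\<bar>Im z\<bar> * (norm x)\<^sup>2 = \<bar>Im (cinner (y - z *\<^sub>C x) x)\<bar>"
    using symmetric_real[OF assms] by (simp add: cinner_simps cinner_self abs_mult)
  also have "\<dots> \<le> norm (y - z *\<^sub>C x) * norm x"
    using abs_Im_le_cmod norm_cinner_le order_trans by blast
  finally show ?thesis
    using False by (simp add: power2_eq_square flip: mult.assoc)
qed simp

lemma linear_operator_cayley:
  assumes "z \<notin> \<real>"
  shows "linear_operator (cayley A z)"
proof (rule linear_operatorI)
  note lin = closed_symmetric_linear
  show "y = 0" if "(0, y) \<in> cayley A z" for y
    using cayley_norm[OF that] by simp
  show "(0, 0) \<in> cayley A z"
    using cayleyI[OF linear_operator_0[OF lin]] by simp
  show "(x + x', y + y') \<in> cayley A z"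
    if "(x, y) \<in> cayley A z" "(x', y') \<in> cayley A z" for x y x' y'
  proof -
    from that obtain a b a' b' where "(a, b) \<in> A" "(a', b') \<in> A" "x = b - z *\<^sub>C a"
      "y = b - cnj z *\<^sub>C a" "x' = b' - z *\<^sub>C a'" "y' = b' - cnj z *\<^sub>C a'"
      by (elim cayleyE[OF lin])
    then show ?thesis
      using cayleyI[OF linear_operator_add[OF lin, of a b a' b'], of z]
      by (simp add: scaleC_add_right add_diff_add)
  qed
  show "(c *\<^sub>C x, c *\<^sub>C y) \<in> cayley A z" if "(x, y) \<in> cayley A z" for c x y
  proof -
    from that obtain a b where "(a, b) \<in> A" "x = b - z *\<^sub>C a" "y = b - cnj z *\<^sub>C a"
      by (elim cayleyE[OF lin])
    then show ?thesis
      using cayleyI[OF linear_operator_scaleC[OF lin, of a b c], of z]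
      by (simp add: scaleC_simps mult.commute)
  qed
qed

lemma linear_operator_resolvent:
  assumes "z \<notin> \<real>"
  shows "linear_operator (op_resolvent A z)"
proof (rule linear_operator_op_resolvent[OF closed_symmetric_linear])
  fix x
  assume "(x, z *\<^sub>C x) \<in> A"
  from symmetric_bounded_below[OF this, of z] show "x = 0"
    using assms by (auto simp: not_Reals_iff mult_le_0_iff)
qed

lemma csubspace_range_space: "z \<notin> \<real> \<Longrightarrow> csubspace (range_space A z)"
  using csubspace_Domain[OF linear_operator_cayley] by (simp add: Domain_cayley)

lemma closed_range_space:
  assumes "z \<notin> \<real>"
  shows "closed (range_space A z)"
proof -
  have "closed A"
    using A by (simp add: closed_symmetric_def)
  then have "closed ((\<lambda>p. (snd p, fst p + z *\<^sub>C snd p)) -` A)"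
    by (rule closed_vimage) (intro continuous_intros)
  also have "(\<lambda>p. (snd p, fst p + z *\<^sub>C snd p)) -` A = op_resolvent A z"
    by (auto simp: in_op_resolvent)
  finally have "closed (op_resolvent A z)" .
  moreover have "dist x x' \<le> inverse \<bar>Im z\<bar> * dist h h'"
    if hx: "(h, x) \<in> op_resolvent A z" "(h', x') \<in> op_resolvent A z" for h x h' x'
  proof -
    have "(x - x', (h - h') + z *\<^sub>C (x - x')) \<in> A"
      using linear_operator_diff[OF linear_operator_resolvent[OF assms] hx]
      by (simp add: in_op_resolvent)
    from symmetric_bounded_below[OF this, of z] show ?thesis
      using assms by (simp add: dist_norm not_Reals_iff field_simps)
  qed
  ultimately have "closed (Domain (op_resolvent A z))"
    by (rule closed_Domain_lipschitz)
  also have "Domain (op_resolvent A z) = range_space A z"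
    by (auto simp: Domain_iff in_op_resolvent in_range_space)
  finally show ?thesis .
qed

end

section \<open>The inverse Cayley transformation\<close>

text \<open>The formula of \<open>quasi_sa_ext\<close> with an arbitrary \<open>C\<close> in place
  of the direct sum, so that it serves both the extensions of \<open>A\<close> and the self-adjoint
  operators of the larger space.\<close>

definition inv_cayley :: "complex \<Rightarrow> 'a::chilbert_space operator \<Rightarrow> 'a operator" where
  "inv_cayley z C = affine_op z (z - cnj z) ((minus_scalar C 1)\<inverse>)"

lemma quasi_sa_ext_eq: "quasi_sa_ext A F z = inv_cayley z (direct_sum_op (cayley A z) F)"
  by (simp add: quasi_sa_ext_def inv_cayley_def)

text \<open>Parametrizing by the pairs of \<open>C\<close> makes the formula an identity of
  relations, valid even if \<open>C - 1\<close> has a kernel.\<close>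

lemma in_inv_cayley: "(p, q) \<in> inv_cayley z C \<longleftrightarrow>
    (\<exists>g u. (g, u) \<in> C \<and> p = u - g \<and> q = z *\<^sub>C u - cnj z *\<^sub>C g)"
proof -
  have eq: "z *\<^sub>C (u - g) + (z - cnj z) *\<^sub>C g = z *\<^sub>C u - cnj z *\<^sub>C g" for u g :: 'a
    by (simp add: scaleC_simps)
  have "(p, q) \<in> inv_cayley z C \<longleftrightarrow>
      (\<exists>g. (g, p + g) \<in> C \<and> q = z *\<^sub>C p + (z - cnj z) *\<^sub>C g)"
    unfolding inv_cayley_def
    by (subst in_affine_op) (simp only: converse_iff in_minus_scalar scaleC_one)
  also have "\<dots> \<longleftrightarrow> (\<exists>g u. (g, u) \<in> C \<and> p = u - g \<and> q = z *\<^sub>C u - cnj z *\<^sub>C g)"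
    unfolding eq[symmetric] by (metis add_diff_cancel_right' diff_add_cancel)
  finally show ?thesis .
qed

lemma inv_cayley_cayley:
  assumes A: "linear_operator A" and z: "z \<notin> \<real>"
  shows "inv_cayley z (cayley A z) = A"
proof (intro equalityI subrelI)
  define c where "c = z - cnj z"
  have c: "c \<noteq> 0"
    using diff_cnj_nonzero[OF z] by (simp add: c_def)
  have eq: "(y - cnj z *\<^sub>C x) - (y - z *\<^sub>C x) = c *\<^sub>C x"
    "z *\<^sub>C (y - cnj z *\<^sub>C x) - cnj z *\<^sub>C (y - z *\<^sub>C x) = c *\<^sub>C y" for x y :: 'a
    by (simp_all add: c_def scaleC_simps mult.commute)
  show "(p, q) \<in> A" if "(p, q) \<in> inv_cayley z (cayley A z)" for p q
  proof -
    from that obtain g u where *: "(g, u) \<in> cayley A z" "p = u - g" "q = z *\<^sub>C u - cnj z *\<^sub>C g"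
      by (auto simp: in_inv_cayley)
    from A *(1) obtain x y where "(x, y) \<in> A" "g = y - z *\<^sub>C x" "u = y - cnj z *\<^sub>C x"
      by (rule cayleyE)
    then show ?thesis
      unfolding * using linear_operator_scaleC[OF A] by (simp only: eq)
  qed
  show "(p, q) \<in> inv_cayley z (cayley A z)" if "(p, q) \<in> A" for p q
  proof -
    \<comment> \<open>The Cayley pair of \<open>(x, y)\<close> is sent back to
      \<open>(c *\<^sub>C x, c *\<^sub>C y)\<close>; dividing by \<open>c\<close> beforehand
      compensates.\<close>
    let ?x = "inverse c *\<^sub>C p" and ?y = "inverse c *\<^sub>C q"
    have "(?x, ?y) \<in> A"
      using that by (rule linear_operator_scaleC[OF A])
    from cayleyI[OF this, of z] show ?thesis
      unfolding in_inv_cayley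
      by (rule exI[of _ "?y - z *\<^sub>C ?x", OF exI[of _ "?y - cnj z *\<^sub>C ?x", OF conjI]])
        (simp only: eq, simp add: scaleC_scaleC c)
  qed
qed

text \<open>For non-real \<open>z\<close>, the Moebius map of \<open>half_plane z\<close> onto the
  unit disk that sends \<open>z\<close> to 0.\<close>

definition disk_coord :: "complex \<Rightarrow> complex \<Rightarrow> complex" where
  "disk_coord z \<zeta> = (\<zeta> - z) / (\<zeta> - cnj z)"

text \<open>Subtracting \<zeta> times \<open>u - g\<close> from \<open>z u - cnj z g\<close> leaves
  \<open>(\<zeta> - cnj z) g - (\<zeta> - z) u\<close>, and the disk coordinate is the quotient of
  the two coefficients.\<close>

lemma op_resolvent_inv_cayley:
  assumes "\<zeta> \<noteq> cnj z"
  shows "(h, x) \<in> op_resolvent (inv_cayley z C) \<zeta> \<longleftrightarrow>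
    (\<exists>g u. (g, u) \<in> C \<and> h = (\<zeta> - cnj z) *\<^sub>C (g - disk_coord z \<zeta> *\<^sub>C u) \<and> x = u - g)"
proof -
  have w: "(\<zeta> - cnj z) * disk_coord z \<zeta> = \<zeta> - z"
    using assms by (simp add: disk_coord_def)
  have "h + \<zeta> *\<^sub>C (u - g) = z *\<^sub>C u - cnj z *\<^sub>C g \<longleftrightarrow>
      h = (\<zeta> - cnj z) *\<^sub>C (g - disk_coord z \<zeta> *\<^sub>C u)" for u g
    unfolding scaleC_diff_right scaleC_scaleC w
    by (auto simp: scaleC_simps eq_diff_eq algebra_simps)
  then show ?thesis
    unfolding in_op_resolvent in_inv_cayley by metis
qed

text \<open>The parameter \<open>g\<close> stands for \<open>(1 - w W)\<inverse>\<close> applied to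
  the argument divided by \<open>\<zeta> - cnj z\<close>, so that no inverse appears in the
  formula.\<close>

definition cayley_resolvent ::
  "complex \<Rightarrow> complex \<Rightarrow> ('a::chilbert_space \<Rightarrow> 'a) \<Rightarrow> 'a operator" where
  "cayley_resolvent z \<zeta> W =
     range (\<lambda>g. ((\<zeta> - cnj z) *\<^sub>C (g - disk_coord z \<zeta> *\<^sub>C W g), W g - g))"

lemma op_resolvent_total_graph:
  assumes "\<zeta> \<noteq> cnj z"
  shows "op_resolvent (inv_cayley z (total_graph W)) \<zeta> = cayley_resolvent z \<zeta> W"
  by (auto simp: op_resolvent_inv_cayley[OF assms] cayley_resolvent_def)

lemma half_plane_iff: "\<zeta> \<in> half_plane z \<longleftrightarrow> sgn (Im \<zeta>) = sgn (Im z)"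
  by (simp add: half_plane_def)

lemma half_plane_cnj_iff:
  assumes "\<zeta> \<notin> \<real>" "z \<notin> \<real>"
  shows "cnj \<zeta> \<in> half_plane z \<longleftrightarrow> \<zeta> \<notin> half_plane z"
  using assms by (auto simp: half_plane_iff not_Reals_iff sgn_if split: if_splits)

lemma half_plane_not_Reals: "z \<notin> \<real> \<Longrightarrow> \<zeta> \<in> half_plane z \<Longrightarrow> \<zeta> \<notin> \<real>"
  by (auto simp: half_plane_iff not_Reals_iff sgn_if split: if_splits)

lemma half_plane_neq_cnj: "z \<notin> \<real> \<Longrightarrow> \<zeta> \<in> half_plane z \<Longrightarrow> \<zeta> \<noteq> cnj z"
  by (auto simp: half_plane_iff not_Reals_iff sgn_if split: if_splits)

text \<open>The squared distances of \<zeta> to \<open>cnj z\<close> and to \<open>z\<close> differ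
  by \<open>4 * Im \<zeta> * Im z\<close>, which is positive in the half-plane of
  \<open>z\<close>.\<close>

lemma norm_disk_coord_less_1:
  assumes "z \<notin> \<real>" "\<zeta> \<in> half_plane z"
  shows "cmod (disk_coord z \<zeta>) < 1"
proof -
  have "Im \<zeta> * Im z > 0"
    using assms by (auto simp: half_plane_iff not_Reals_iff sgn_if zero_less_mult_iff split: if_splits)
  then have "(cmod (\<zeta> - z))\<^sup>2 < (cmod (\<zeta> - cnj z))\<^sup>2"
    unfolding cmod_power2 by (simp add: power2_eq_square algebra_simps)
  then have "cmod (\<zeta> - z) < cmod (\<zeta> - cnj z)"
    by (rule power2_less_imp_less) auto
  moreover from this have "cmod (\<zeta> - cnj z) > 0"
    by (rule le_less_trans[rotated]) auto
  ultimately show ?thesis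
    by (simp add: disk_coord_def norm_divide)
qed

abbreviation (input) schur_params :: "'a::chilbert_space operator \<Rightarrow> complex \<Rightarrow> (complex \<Rightarrow> 'a operator) set" where
  "schur_params A z \<equiv> schur_class (half_plane z) (defect_space A z) (defect_space A (cnj z))"

abbreviation (input) schur_value :: "'a::chilbert_space operator \<Rightarrow> complex \<Rightarrow> 'a operator \<Rightarrow> bool" where
  "schur_value A z \<equiv> nonexpanding_between (defect_space A z) (defect_space A (cnj z))"

section \<open>Direct sums with the Cayley transformation\<close>

lemma in_direct_sum_op: "(p, q) \<in> direct_sum_op S T \<longleftrightarrow>
    (\<exists>x y x' y'. (x, y) \<in> S \<and> (x', y') \<in> T \<and> p = x + x' \<and> q = y + y')"
  by (auto simp: direct_sum_op_def)

text \<open>Orthogonality of the domains forces the \<open>C\<close>-component of a point of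
  \<open>Domain F\<close> to vanish, and single-valuedness of \<open>C\<close> then kills its
  image.\<close>

lemma direct_sum_op_cancel:
  assumes C: "linear_operator C"
    and F: "Domain F = orth_compl (Domain C)" and G: "Domain G = orth_compl (Domain C)"
    and eq: "direct_sum_op C F = direct_sum_op C G"
  shows "F \<subseteq> G"
proof clarify
  fix x y
  assume xy: "(x, y) \<in> F"
  then have "(x, y) \<in> direct_sum_op C F"
    unfolding in_direct_sum_op using linear_operator_0[OF C] by force
  then obtain a b x' y' where ab: "(a, b) \<in> C" "(x', y') \<in> G" "x = a + x'" "y = b + y'"
    unfolding eq in_direct_sum_op by blast
  have "x - x' \<in> orth_compl (Domain C)"
    using xy ab(2) F G by (intro csubspace_diff csubspace_orth_compl) auto
  then have "cinner a a = 0"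
    using orth_complD[of a "Domain C" a] ab by auto
  then have "a = 0" by simp
  then have "b = 0"
    using ab(1) linear_operator_unique[OF C _ linear_operator_0[OF C]] by auto
  with \<open>a = 0\<close> show "(x, y) \<in> G"
    using ab by simp
qed

lemma affine_op_inject:
  assumes "affine_op z c S = affine_op z c T" "c \<noteq> 0"
  shows "S = T"
proof -
  have "S \<subseteq> T" if "affine_op z c S = affine_op z c T" for S T :: "'a operator"
  proof clarify
    fix x y
    assume "(x, y) \<in> S"
    then have "(x, z *\<^sub>C x + c *\<^sub>C y) \<in> affine_op z c T"
      unfolding that[symmetric] in_affine_op by blast
    then show "(x, y) \<in> T"
      using assms(2) by (auto simp: in_affine_op scaleC_cancel_left)
  qed
  then show ?thesis
    using assms(1) by blast
qed

lemma op_resolvent_inject: "op_resolvent S z = op_resolvent T z \<Longrightarrow> S = T"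
  unfolding op_resolvent_def converse_inject by (rule affine_op_inject) auto

lemma inv_cayley_inject: "z \<notin> \<real> \<Longrightarrow> inv_cayley z C = inv_cayley z C' \<Longrightarrow> C = C'"
  unfolding inv_cayley_def
  by (drule affine_op_inject[OF _ diff_cnj_nonzero], assumption)
     (simp only: converse_inject, drule affine_op_inject, auto)

context
  fixes A :: "'a::chilbert_space operator" and z :: complex
  assumes A: "closed_symmetric A" and z: "z \<notin> \<real>"
begin

lemma cnj_notin_Reals: "cnj z \<notin> \<real>"
  using z by (simp add: not_Reals_iff)

lemma defect_space_eq: "defect_space A z = orth_compl (Domain (cayley A z))"
  by (simp add: defect_space_def Domain_cayley)

lemma defect_decomp:
  obtains m n where "x = m + n" "m \<in> range_space A z" "n \<in> defect_space A z"
proof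
  let ?m = "orth_proj (range_space A z) x"
  show "x = ?m + (x - ?m)" by simp
  show "?m \<in> range_space A z"
    by (intro orth_proj_in csubspace_range_space closed_range_space A z)
  show "x - ?m \<in> defect_space A z"
    unfolding defect_space_def by (intro orth_proj_diff csubspace_range_space closed_range_space A z)
qed

text \<open>The two summands have orthogonal domains and orthogonal ranges, so Pythagoras gives
  contractivity; contractivity at 0 in turn makes the sum single-valued.\<close>

lemma direct_sum_cayley:
  assumes F: "schur_value A z F"
  obtains W where "clinear W" "\<And>x. norm (W x) \<le> norm x"
    "direct_sum_op (cayley A z) F = total_graph W"
proof -
  let ?C = "cayley A z"
  let ?D = "direct_sum_op ?C F"
  have C: "linear_operator ?C"
    by (rule linear_operator_cayley[OF A z])
  have F': "linear_operator F" "Domain F = defect_space A z" "Range F \<subseteq> defect_space A (cnj z)"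
    "\<And>x y. (x, y) \<in> F \<Longrightarrow> norm y \<le> norm x"
    using F by (auto simp: nonexpanding_between_def)
  have le: "norm q \<le> norm p" if "(p, q) \<in> ?D" for p q
  proof -
    from that obtain x y x' y' where *: "(x, y) \<in> ?C" "(x', y') \<in> F" "p = x + x'" "q = y + y'"
      by (auto simp: in_direct_sum_op)
    have x: "x \<in> range_space A z" "x' \<in> defect_space A z"
      using *(1,2) F'(2) Domain_cayley by blast+
    have y: "y \<in> range_space A (cnj z)" "y' \<in> defect_space A (cnj z)"
      using *(1,2) F'(3) Range_cayley by blast+
    have "(norm q)\<^sup>2 = (norm y)\<^sup>2 + (norm y')\<^sup>2"
      unfolding * using orth_complD'[of y' _ y] y by (simp add: norm_sq_add defect_space_def)
    also have "\<dots> \<le> (norm x)\<^sup>2 + (norm x')\<^sup>2"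
      using cayley_norm[OF A *(1)] F'(4)[OF *(2)] by (simp add: power_mono)
    also have "\<dots> = (norm p)\<^sup>2"
      unfolding * using orth_complD'[of x' _ x] x by (simp add: norm_sq_add defect_space_def)
    finally show ?thesis
      by (rule power2_le_imp_le) auto
  qed
  have "linear_operator ?D"
  proof (rule linear_operatorI)
    show "y = 0" if "(0, y) \<in> ?D" for y
      using le[OF that] by simp
    show "(0, 0) \<in> ?D"
      unfolding in_direct_sum_op using linear_operator_0[OF C] linear_operator_0[OF F'(1)] by force
    show "(x + x', y + y') \<in> ?D" if "(x, y) \<in> ?D" "(x', y') \<in> ?D" for x y x' y'
    proof -
      from that obtain a b a' b' c d c' d' where
        "(a, b) \<in> ?C" "(a', b') \<in> F" "x = a + a'" "y = b + b'"
        "(c, d) \<in> ?C" "(c', d') \<in> F" "x' = c + c'" "y' = d + d'"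
        unfolding in_direct_sum_op by blast
      then show ?thesis
        unfolding in_direct_sum_op
        using linear_operator_add[OF C, of a b c d] linear_operator_add[OF F'(1), of a' b' c' d']
        by (intro exI[of _ "a + c"] exI[of _ "b + d"] exI[of _ "a' + c'"] exI[of _ "b' + d'"])
           (auto simp: add_ac)
    qed
    show "(c *\<^sub>C x, c *\<^sub>C y) \<in> ?D" if "(x, y) \<in> ?D" for c x y
      using that unfolding in_direct_sum_op
      by (metis linear_operator_scaleC[OF C] linear_operator_scaleC[OF F'(1)] scaleC_add_right)
  qed
  moreover have "Domain ?D = UNIV"
  proof -
    have "x \<in> Domain ?D" for x
    proof -
      obtain m n where "x = m + n" "m \<in> range_space A z" "n \<in> defect_space A z"
        by (rule defect_decomp)
      then show ?thesis
        unfolding Domain_iff in_direct_sum_op using F'(2) Domain_cayley by (metis DomainE)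
    qed
    then show ?thesis by auto
  qed
  ultimately show ?thesis
    using total_graphI[of ?D] le by (intro that[of "graph_fun ?D"]) (metis in_total_graph)+
qed

text \<open>The converse of \<open>direct_sum_cayley\<close>: together they identify the
  contractions extending the Cayley transformation with the contractions between the defect
  spaces.\<close>

lemma defect_restriction:
  assumes W: "clinear W" "\<And>x. norm (W x) \<le> norm x"
    and ext: "\<And>g u. (g, u) \<in> cayley A z \<Longrightarrow> W g = u"
  defines "F \<equiv> {(x, W x) | x. x \<in> defect_space A z}"
  shows "schur_value A z F"
    and "direct_sum_op (cayley A z) F = total_graph W"
proof -
  note lin = clinearD[OF W(1)]
  have sub: "csubspace (defect_space A z)"
    unfolding defect_space_def by (rule csubspace_orth_compl)
  have "linear_operator F"
    using csubspaceD[OF sub] by (intro linear_operatorI) (auto simp: F_def lin)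
  moreover have "W x \<in> defect_space A (cnj z)" if x: "x \<in> defect_space A z" for x
  proof -
    have "cinner (W x) u = 0" if "u \<in> range_space A (cnj z)" for u
    proof (cases "u = 0")
      case False
      from that obtain g where g: "(g, u) \<in> cayley A z"
        using Range_cayley by blast
      then have "g \<in> range_space A z"
        using Domain_cayley by blast
      then have xg: "cinner x g = 0"
        using x by (simp add: defect_space_def orth_compl_def)
      have ng: "norm g = norm u"
        using cayley_norm[OF A g] by simp
      define c where "c = cinner (W x) u"
      \<comment> \<open>\<open>W\<close> preserves the norm of \<open>g\<close>, which leaves no room for a component of \<open>W x\<close> along \<open>u\<close>\<close>
      have le: "2 * t * (cmod c)\<^sup>2 \<le> (norm x)\<^sup>2" for t :: real
      proof -
        let ?s = "complex_of_real t * c"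
        have "norm (W (x + ?s *\<^sub>C g)) \<le> norm (x + ?s *\<^sub>C g)"
          by (rule W(2))
        then have "(norm (W (x + ?s *\<^sub>C g)))\<^sup>2 \<le> (norm (x + ?s *\<^sub>C g))\<^sup>2"
          by (rule power_mono) auto
        also have "\<dots> = (norm x)\<^sup>2 + (cmod ?s * norm u)\<^sup>2"
          unfolding norm_sq_add cinner_scaleC_right norm_scaleC xg ng by simp
        also have "W (x + ?s *\<^sub>C g) = W x + ?s *\<^sub>C u"
          by (simp add: lin ext[OF g])
        also have "(norm (W x + ?s *\<^sub>C u))\<^sup>2 =
            (norm (W x))\<^sup>2 + 2 * Re (cnj ?s * c) + (cmod ?s * norm u)\<^sup>2"
          by (simp only: norm_sq_add cinner_scaleC_right c_def norm_scaleC)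
        also have "cnj ?s * c = complex_of_real (t * (cmod c)\<^sup>2)"
          unfolding of_real_mult complex_norm_square by simp
        finally have "(norm (W x))\<^sup>2 + 2 * (t * (cmod c)\<^sup>2) \<le> (norm x)\<^sup>2"
          unfolding Re_complex_of_real by linarith
        then show ?thesis
          using zero_le_power2[of "norm (W x)"] by linarith
      qed
      have "c = 0"
      proof (rule ccontr)
        assume "c \<noteq> 0"
        \<comment> \<open>This \<open>t\<close> makes the left side of \<open>le\<close> equal to
          \<open>(norm x)\<^sup>2 + 1\<close>, one more than the bound allows.\<close>
        then have "2 * (((norm x)\<^sup>2 + 1) / (2 * (cmod c)\<^sup>2)) * (cmod c)\<^sup>2 = (norm x)\<^sup>2 + 1"
          by simp
        then show False
          using le[of "((norm x)\<^sup>2 + 1) / (2 * (cmod c)\<^sup>2)"] by linarith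
      qed
      then show ?thesis
        by (simp add: c_def)
    qed simp
    then show ?thesis
      by (simp add: defect_space_def orth_compl_def)
  qed
  ultimately show "schur_value A z F"
    using W(2) by (auto simp: nonexpanding_between_def F_def)
  have "(p, q) \<in> direct_sum_op (cayley A z) F \<longleftrightarrow> q = W p" for p q
  proof
    assume "(p, q) \<in> direct_sum_op (cayley A z) F"
    then show "q = W p"
      by (auto simp: in_direct_sum_op F_def lin ext)
  next
    assume "q = W p"
    obtain m n where mn: "p = m + n" "m \<in> range_space A z" "n \<in> defect_space A z"
      by (rule defect_decomp)
    then obtain u where "(m, u) \<in> cayley A z"
      using Domain_cayley by blast
    moreover have "(n, W n) \<in> F"
      using mn by (auto simp: F_def)
    ultimately show "(p, q) \<in> direct_sum_op (cayley A z) F"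
      unfolding in_direct_sum_op using mn ext \<open>q = W p\<close> lin by blast
  qed
  then show "direct_sum_op (cayley A z) F = total_graph W"
    by auto
qed

end

section \<open>Self-adjoint operators and compressed resolvents\<close>

lemma self_adjoint_closed_symmetric:
  assumes K: "closed K" and T: "self_adjoint_on K T"
  shows "closed_symmetric T"
proof -
  have adj: "adjoint_op K K T = T" and lin: "linear_operator T"
    using T by (auto simp: self_adjoint_on_def)
  have "adjoint_op K K T = (K \<times> K) \<inter> (\<Inter>p\<in>T. {q. cinner (snd p) (fst q) = cinner (fst p) (snd q)})"
    by (fastforce simp: adjoint_op_def)
  also have "closed \<dots>"
    by (intro closed_Int closed_Times K closed_INT ballI closed_Collect_eq continuous_intros)
  finally have "closed T"
    by (simp add: adj)
  moreover have "cinner y x' = cinner x y'" if "(x, y) \<in> T" "(x', y') \<in> T" for x y x' y'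
  proof -
    have "(x', y') \<in> adjoint_op K K T"
      using that(2) by (simp add: adj)
    with that(1) show ?thesis
      by (auto simp: adjoint_op_def)
  qed
  ultimately show ?thesis
    using lin by (auto simp: closed_symmetric_def)
qed

text \<open>A vector of \<open>K\<close> orthogonal to the closed range of \<open>T - z\<close>
  belongs to the domain of the adjoint, which is \<open>T\<close>, with eigenvalue
  \<open>cnj z\<close>; a symmetric operator has no non-real eigenvalue.\<close>

lemma self_adjoint_range_space:
  assumes K: "closed K" "csubspace K" and T: "self_adjoint_on K T" and z: "z \<notin> \<real>"
  shows "range_space T z = K"
proof (rule closed_csubspace_eqI)
  note sym = self_adjoint_closed_symmetric[OF K(1) T]
  show "csubspace (range_space T z)" "closed (range_space T z)"
    by (intro csubspace_range_space closed_range_space sym z)+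
  have TK: "T \<subseteq> K \<times> K" and adj: "adjoint_op K K T = T"
    using T by (auto simp: self_adjoint_on_def)
  show "range_space T z \<subseteq> K"
  proof
    fix h
    assume "h \<in> range_space T z"
    then obtain x where "(x, h + z *\<^sub>C x) \<in> T"
      by (auto simp: in_range_space)
    then have "x \<in> K" "h + z *\<^sub>C x \<in> K"
      using TK by auto
    then have "(h + z *\<^sub>C x) - z *\<^sub>C x \<in> K"
      by (intro csubspace_diff csubspace_scaleC K(2))
    then show "h \<in> K" by simp
  qed
  fix x
  assume x: "x \<in> K" "x \<in> orth_compl (range_space T z)"
  have "cinner b x = cinner a (cnj z *\<^sub>C x)" if "(a, b) \<in> T" for a b
  proof -
    have "b - z *\<^sub>C a \<in> range_space T z"
      using that by (auto simp: in_range_space intro!: exI[of _ a])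
    from orth_complD'[OF x(2) this] show ?thesis
      by (simp add: cinner_simps)
  qed
  then have "(x, cnj z *\<^sub>C x) \<in> adjoint_op K K T"
    using x(1) csubspace_scaleC[OF K(2)] by (auto simp: adjoint_op_def)
  then have "(x, cnj z *\<^sub>C x) \<in> T"
    by (simp add: adj)
  from symmetric_bounded_below[OF sym this, of "cnj z"] show "x = 0"
    using z by (auto simp: not_Reals_iff mult_le_0_iff)
qed (rule K(2))

lemma linear_isometryD:
  assumes "linear_isometry V"
  shows linear_isometry_clinear: "clinear V"
    and linear_isometry_cinner: "cinner (V x) (V y) = cinner x y"
    and linear_isometry_norm: "norm (V x) = norm x"
    and linear_isometry_eq_iff: "V x = V y \<longleftrightarrow> x = y"
proof -
  show lin: "clinear V" and inner: "cinner (V x) (V y) = cinner x y" for x y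
    using assms by (auto simp: linear_isometry_def clinear_def)
  show nrm: "norm (V x) = norm x" for x
    using inner[of x x] unfolding cinner_self of_real_eq_iff by simp
  show "V x = V y \<longleftrightarrow> x = y"
    using nrm[of "x - y"] by (auto simp: clinear_diff[OF lin])
qed

lemma csubspace_range_clinear:
  assumes "clinear V"
  shows "csubspace (range V)"
  unfolding csubspace_def
proof (intro conjI ballI allI)
  show "0 \<in> range V"
    by (rule range_eqI[of _ _ 0]) (rule clinear_0[OF assms, symmetric])
  fix x
  assume "x \<in> range V"
  then obtain u where u: "x = V u"
    by (rule rangeE)
  show "a *\<^sub>C x \<in> range V" for a
    unfolding u by (rule range_eqI[of _ _ "a *\<^sub>C u"]) (rule clinear_scaleC[OF assms, symmetric])
  fix y
  assume "y \<in> range V"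
  then obtain v where v: "y = V v"
    by (rule rangeE)
  show "x + y \<in> range V"
    unfolding u v by (rule range_eqI[of _ _ "u + v"]) (rule clinear_add[OF assms, symmetric])
qed

text \<open>The adjoint \<open>V'\<close> is a left inverse of \<open>V\<close>, and
  \<open>V V'\<close> is the projection onto the range. Compressions to the embedded space can
  therefore be computed with \<open>V'\<close> as a linear map.\<close>

lemma linear_isometry_adjoint:
  assumes V: "linear_isometry V"
  obtains V' where "clinear V'" "\<And>x y. cinner (V x) y = cinner x (V' y)" "\<And>x. V' (V x) = x"
    "\<And>y. V (V' y) = orth_proj (range V) y" "\<And>y. (norm y)\<^sup>2 = (norm (V' y))\<^sup>2 + (norm (y - V (V' y)))\<^sup>2"
    "\<And>y. norm (V' y) \<le> norm y"
proof -
  note V' = linear_isometryD[OF V]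
  obtain V' where lin: "clinear V'" and adj: "\<And>x y. cinner (V x) y = cinner x (V' y)"
    using adjoint_exists[OF V'(1), of 1] by (auto simp: V'(3))
  have adj': "cinner y (V x) = cinner (V' y) x" for x y
    by (subst (1 2) cinner_commute) (simp add: adj)
  have id: "V' (V x) = x" for x
    by (rule cinner_eq_all_imp_eq) (simp add: V'(2) flip: adj')
  have orth: "y - V (V' y) \<in> orth_compl (range V)" for y
    by (auto simp: orth_compl_def adj' id clinear_diff[OF lin])
  have pyth: "(norm y)\<^sup>2 = (norm (V' y))\<^sup>2 + (norm (y - V (V' y)))\<^sup>2" for y
    using norm_sq_add[of "V (V' y)" "y - V (V' y)"] orth_complD'[OF orth[of y], of "V (V' y)"]
    by (simp add: V'(3))
  show thesis
  proof (rule that[OF lin adj id _ pyth])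
    show "V (V' y) = orth_proj (range V) y" for y
      by (rule orth_proj_eqI[symmetric]) (auto intro: orth csubspace_range_clinear V'(1))
    show "norm (V' y) \<le> norm y" for y
      by (rule power2_le_imp_le) (simp_all add: pyth[of y])
  qed
qed

section \<open>Compressed resolvents and their adjoints\<close>

definition compressed_resolvent ::
  "('a::chilbert_space \<Rightarrow> 'b::chilbert_space) \<Rightarrow> 'b operator \<Rightarrow> complex \<Rightarrow> 'a operator" where
  "compressed_resolvent V T \<zeta> =
     {(x, x'). \<exists>y. (V x, y) \<in> op_resolvent T \<zeta> \<and> V x' = orth_proj (range V) y}"

text \<open>Only the adjoint identity, stated for relations: combined with full domains it already
  determines one member of the pair from the other.\<close>

definition adjoint_pair :: "'a::chilbert_space operator \<Rightarrow> 'a operator \<Rightarrow> bool" where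
  "adjoint_pair G H \<longleftrightarrow> (\<forall>x y a b. (x, y) \<in> G \<longrightarrow> (a, b) \<in> H \<longrightarrow> cinner y a = cinner x b)"

lemma adjoint_pair_unique:
  assumes H: "Domain H = UNIV" and "adjoint_pair H G1" "adjoint_pair H G2"
    and "Domain G1 = UNIV" "Domain G2 = UNIV"
  shows "G1 = G2"
proof -
  have "G1 \<subseteq> G2"
    if G: "adjoint_pair H G1" "adjoint_pair H G2" "Domain G2 = UNIV" for G1 G2
  proof clarify
    fix a b
    assume ab: "(a, b) \<in> G1"
    have "a \<in> Domain G2"
      using G(3) by simp
    then obtain b' where b': "(a, b') \<in> G2"
      by blast
    have "cinner b x = cinner b' x" for x
    proof -
      have "x \<in> Domain H"
        using H by simp
      then obtain y where "(x, y) \<in> H"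
        by blast
      then have "cinner x b = cinner x b'"
        using G(1,2) ab b' unfolding adjoint_pair_def by metis
      then show ?thesis
        by (subst (1 2) cinner_commute) simp
    qed
    then have "b = b'"
      by (rule cinner_eq_all_imp_eq)
    with b' show "(a, b) \<in> G2" by simp
  qed
  from this[OF assms(2,3,5)] this[OF assms(3,2,4)] show ?thesis
    by (rule equalityI)
qed

lemma Domain_compressed_resolvent:
  assumes V: "linear_isometry V" "range V \<subseteq> K" and T: "range_space T \<zeta> = K"
  shows "Domain (compressed_resolvent V T \<zeta>) = UNIV"
proof -
  obtain V' where V': "\<And>y. V (V' y) = orth_proj (range V) y"
    using linear_isometry_adjoint[OF V(1)] by metis
  have "x \<in> Domain (compressed_resolvent V T \<zeta>)" for x
  proof -
    have "V x \<in> range_space T \<zeta>"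
      using V T by auto
    then obtain y where "(V x, y) \<in> op_resolvent T \<zeta>"
      by (auto simp: in_range_space in_op_resolvent)
    then show ?thesis
      using V' by (auto simp: compressed_resolvent_def)
  qed
  then show ?thesis by auto
qed

text \<open>Symmetry of \<open>T\<close> is applied to the two resolvent values; the term
  \<open>cnj \<zeta> * cinner y b\<close> occurs on both sides and cancels.\<close>

lemma adjoint_pair_compressed_resolvent:
  assumes V: "linear_isometry V" and T: "closed_symmetric T"
  shows "adjoint_pair (compressed_resolvent V T (cnj \<zeta>)) (compressed_resolvent V T \<zeta>)"
  unfolding adjoint_pair_def compressed_resolvent_def
proof clarify
  fix x x' a a' y b
  obtain V' where V': "\<And>x y. cinner (V x) y = cinner x (V' y)"
    "\<And>y. V (V' y) = orth_proj (range V) y"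
    using linear_isometry_adjoint[OF V] by metis
  have V'': "cinner y (V x) = cinner (V' y) x" for x y
    by (subst (1 2) cinner_commute) (simp add: V'(1))
  assume xy: "(V x, y) \<in> op_resolvent T (cnj \<zeta>)" "V x' = orth_proj (range V) y"
    and ab: "(V a, b) \<in> op_resolvent T \<zeta>" "V a' = orth_proj (range V) b"
  have eqs: "x' = V' y" "a' = V' b"
    using xy(2) ab(2) linear_isometry_eq_iff[OF V] by (metis V'(2))+
  from symmetricD[OF T, of y _ b] xy(1) ab(1)
  have "cinner (V x + cnj \<zeta> *\<^sub>C y) b = cinner y (V a + \<zeta> *\<^sub>C b)"
    by (simp add: in_op_resolvent)
  then have "cinner (V x) b = cinner y (V a)"
    by (simp add: cinner_simps)
  then show "cinner x' a = cinner x a'"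
    by (simp add: eqs V'(1) V'')
qed

lemma Domain_cayley_resolvent:
  assumes W: "clinear W" "\<And>x. norm (W x) \<le> norm x" and z: "z \<notin> \<real>" "\<zeta> \<in> half_plane z"
  shows "Domain (cayley_resolvent z \<zeta> W) = UNIV"
proof -
  have "x \<in> Domain (cayley_resolvent z \<zeta> W)" for x
  proof -
    let ?g = "neumann_inv (disk_coord z \<zeta>) W (inverse (\<zeta> - cnj z) *\<^sub>C x)"
    have "(\<zeta> - cnj z) *\<^sub>C (?g - disk_coord z \<zeta> *\<^sub>C W ?g) = x"
      using half_plane_neq_cnj[OF z]
      by (simp add: neumann_inv_right[OF W norm_disk_coord_less_1[OF z]] scaleC_scaleC)
    then have "(x, W ?g - ?g) \<in> cayley_resolvent z \<zeta> W"
      unfolding cayley_resolvent_def by (intro range_eqI[of _ _ ?g]) simp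
    then show ?thesis
      by blast
  qed
  then show ?thesis by auto
qed

text \<open>Conjugating both the base point and the spectral parameter conjugates the disk
  coordinate, so taking adjoints preserves the shape of the formula.\<close>

lemma adjoint_pair_cayley_resolvent:
  assumes W: "clinear W" "clinear W'" and adj: "\<And>x y. cinner (W x) y = cinner x (W' y)"
  shows "adjoint_pair (cayley_resolvent z \<zeta> W) (cayley_resolvent (cnj z) (cnj \<zeta>) W')"
  unfolding adjoint_pair_def cayley_resolvent_def
proof clarify
  fix g h
  have "disk_coord (cnj z) (cnj \<zeta>) = cnj (disk_coord z \<zeta>)"
    by (simp add: disk_coord_def)
  then show "cinner (W g - g)
      ((cnj \<zeta> - cnj (cnj z)) *\<^sub>C (h - disk_coord (cnj z) (cnj \<zeta>) *\<^sub>C W' h)) =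
    cinner ((\<zeta> - cnj z) *\<^sub>C (g - disk_coord z \<zeta> *\<^sub>C W g)) (W' h - h)"
    by (simp add: cinner_simps clinearD[OF W(1)] algebra_simps flip: adj)
qed

section \<open>The second half-plane\<close>

lemma adjoint_contraction:
  assumes W: "\<And>x. norm (W x) \<le> norm (x :: 'a::chilbert_space)"
    and adj: "\<And>x y. cinner (W x) y = cinner x (W' y)"
  shows "norm (W' y) \<le> norm (y :: 'a)"
proof (cases "W' y = 0")
  case False
  have "(norm (W' y))\<^sup>2 = cmod (cinner (W (W' y)) y)"
    unfolding adj cinner_self by (simp add: norm_power)
  also have "\<dots> \<le> norm (W (W' y)) * norm y"
    by (rule norm_cinner_le)
  also have "\<dots> \<le> norm (W' y) * norm y"
    by (intro mult_right_mono W) auto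
  finally show ?thesis
    using False by (simp add: power2_eq_square)
qed simp

context
  fixes A :: "'a::chilbert_space operator" and z :: complex
  assumes A: "closed_symmetric A" and z: "z \<notin> \<real>"
begin

lemma direct_sum_extends:
  assumes F: "schur_value A z F"
    and sum: "direct_sum_op (cayley A z) F = total_graph W"
  shows "(g, u) \<in> cayley A z \<Longrightarrow> W g = u"
    and "F = {(x, W x) | x. x \<in> defect_space A z}"
proof -
  have F': "linear_operator F" "Domain F = defect_space A z"
    using F by (auto simp: nonexpanding_between_def)
  show "W g = u" if "(g, u) \<in> cayley A z" for g u
  proof -
    have "(g, u) \<in> direct_sum_op (cayley A z) F"
      unfolding in_direct_sum_op using that linear_operator_0[OF F'(1)] by force
    then show ?thesis
      by (simp add: sum)
  qed
  have W: "y = W x" if "(x, y) \<in> F" for x y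
  proof -
    have "(x, y) \<in> direct_sum_op (cayley A z) F"
      unfolding in_direct_sum_op
      using that linear_operator_0[OF linear_operator_cayley[OF A z]] by force
    then show ?thesis
      by (simp add: sum)
  qed
  show "F = {(x, W x) | x. x \<in> defect_space A z}"
  proof (intro equalityI subrelI)
    fix x y
    assume xy: "(x, y) \<in> F"
    then have "x \<in> defect_space A z"
      unfolding F'(2)[symmetric] by (rule DomainI)
    with W[OF xy] show "(x, y) \<in> {(x, W x) | x. x \<in> defect_space A z}"
      by simp
  next
    fix x y
    assume "(x, y) \<in> {(x, W x) | x. x \<in> defect_space A z}"
    then have "x \<in> Domain F" "y = W x"
      by (auto simp: F'(2))
    then show "(x, y) \<in> F"
      using W by (auto simp: Domain_iff)
  qed
qed

text \<open>Where a contraction preserves the norm, its adjoint inverts it: if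
  \<open>W u = g\<close> and \<open>norm g = norm u\<close>, then expanding
  \<open>(norm (W' g - u))\<^sup>2\<close> gives at most 0. So \<open>W'\<close> extends the Cayley
  transformation at \<open>cnj z\<close>, and \<open>defect_restriction\<close> applies to
  it.\<close>

lemma direct_sum_adjoint:
  assumes F: "schur_value A z F"
    and W: "clinear W" "\<And>x. norm (W x) \<le> norm x"
    and sum: "direct_sum_op (cayley A z) F = total_graph W"
    and W': "clinear W'" "\<And>x y. cinner (W x) y = cinner x (W' y)"
  shows "direct_sum_op (cayley A (cnj z))
    (adjoint_op (defect_space A z) (defect_space A (cnj z)) F) = total_graph W'"
proof -
  note z' = cnj_notin_Reals[OF A z]
  have W'_le: "norm (W' x) \<le> norm x" for x
    by (rule adjoint_contraction[OF W(2) W'(2)])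
  have ext: "W' g = u" if "(g, u) \<in> cayley A (cnj z)" for g u
  proof -
    have gu: "(u, g) \<in> cayley A z"
      using that by (simp only: cayley_converse[symmetric] converse_iff)
    have Wu: "W u = g"
      by (rule direct_sum_extends(1)[OF F sum gu])
    have "cinner (W' g) u = cinner g g"
      unfolding cinner_commute[of "W' g"] W'(2)[of u g, symmetric] Wu by (simp add: cinner_self)
    then have "(norm (W' g - u))\<^sup>2 = (norm (W' g))\<^sup>2 - 2 * (norm g)\<^sup>2 + (norm u)\<^sup>2"
      by (simp add: norm_sq_diff cinner_self)
    also have "\<dots> \<le> (norm g)\<^sup>2 - 2 * (norm g)\<^sup>2 + (norm g)\<^sup>2"
      using W'_le[of g] cayley_norm[OF A gu] by (simp add: power_mono)
    finally show ?thesis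
      by simp
  qed
  note res = defect_restriction[OF A z' W'(1) W'_le ext, simplified]
  have F_eq: "F = {(x, W x) | x. x \<in> defect_space A z}"
    by (rule direct_sum_extends(2)[OF F sum])
  have maps: "W' y \<in> defect_space A z" if "y \<in> defect_space A (cnj z)" for y
    using res(1) that unfolding nonexpanding_between_def by blast
  have adj_eq: "adjoint_op (defect_space A z) (defect_space A (cnj z)) F =
      {(x, W' x) | x. x \<in> defect_space A (cnj z)}"
  proof (intro set_eqI, clarify)
    fix y v
    have "v = W' y"
      if "y \<in> defect_space A (cnj z)" "v \<in> defect_space A z"
        "\<And>x. x \<in> defect_space A z \<Longrightarrow> cinner (W x) y = cinner x v"
    proof -
      have "v - W' y \<in> defect_space A z"
        using that maps unfolding defect_space_def by (intro csubspace_diff csubspace_orth_compl)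
      from that(3)[OF this] have "cinner (v - W' y) (v - W' y) = 0"
        by (simp add: W'(2) cinner_diff_right)
      then show ?thesis by simp
    qed
    moreover have "(y, v) \<in> adjoint_op (defect_space A z) (defect_space A (cnj z)) F \<longleftrightarrow>
        y \<in> defect_space A (cnj z) \<and> v \<in> defect_space A z \<and>
        (\<forall>x\<in>defect_space A z. cinner (W x) y = cinner x v)"
      by (auto simp: adjoint_op_def F_eq)
    ultimately show "(y, v) \<in> adjoint_op (defect_space A z) (defect_space A (cnj z)) F \<longleftrightarrow>
        (y, v) \<in> {(x, W' x) | x. x \<in> defect_space A (cnj z)}"
      using maps W'(2) by auto
  qed
  show ?thesis
    unfolding adj_eq by (rule res(2))
qed

lemma resolvent_family_upper:
  assumes sum: "direct_sum_op (cayley A z) (F \<zeta>) = total_graph W" and \<zeta>: "\<zeta> \<in> half_plane z"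
  shows "resolvent_family A z F \<zeta> = cayley_resolvent z \<zeta> W"
proof -
  have "resolvent_family A z F \<zeta> = op_resolvent (quasi_sa_ext A (F \<zeta>) z) \<zeta>"
    unfolding resolvent_family_def by (rule if_P[OF \<zeta>])
  also have "\<dots> = op_resolvent (inv_cayley z (total_graph W)) \<zeta>"
    by (simp only: quasi_sa_ext_eq sum)
  also have "\<dots> = cayley_resolvent z \<zeta> W"
    by (rule op_resolvent_total_graph[OF half_plane_neq_cnj[OF z \<zeta>]])
  finally show ?thesis .
qed

text \<open>At \<zeta> both sides are adjoint to the compressed resolvent at
  \<open>cnj \<zeta>\<close>, and all three are defined everywhere. Both directions of the theorem
  use this step.\<close>

lemma compressed_resolvent_lower:
  fixes V :: "'a \<Rightarrow> 'b::chilbert_space"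
  assumes F: "\<And>\<zeta>. \<zeta> \<in> half_plane z \<Longrightarrow>
      schur_value A z (F \<zeta>)"
    and K: "closed K" "csubspace K" and V: "linear_isometry V" "range V \<subseteq> K"
    and T: "self_adjoint_on K T"
    and upper: "\<And>\<zeta>. \<zeta> \<in> half_plane z \<Longrightarrow> compressed_resolvent V T \<zeta> = resolvent_family A z F \<zeta>"
    and \<zeta>: "\<zeta> \<notin> \<real>"
  shows "compressed_resolvent V T \<zeta> = resolvent_family A z F \<zeta>"
proof (cases "\<zeta> \<in> half_plane z")
  case False
  note z' = cnj_notin_Reals[OF A z]
  have cnj: "cnj \<zeta> \<in> half_plane z"
    using False half_plane_cnj_iff[OF \<zeta> z] by simp
  then have cnj': "\<zeta> \<in> half_plane (cnj z)"
    by (auto simp: half_plane_iff sgn_if split: if_splits)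
  obtain W where W: "clinear W" "\<And>x. norm (W x) \<le> norm x"
    "direct_sum_op (cayley A z) (F (cnj \<zeta>)) = total_graph W"
    by (rule direct_sum_cayley[OF A z F[OF cnj]]) blast
  obtain W' where W': "clinear W'" "\<And>x y. cinner (W x) y = cinner x (W' y)"
    by (rule adjoint_exists[OF W(1), of 1]) (use W(2) in auto)
  have W'_le: "norm (W' x) \<le> norm x" for x
    by (rule adjoint_contraction[OF W(2) W'(2)])
  have lower_eq: "resolvent_family A z F \<zeta> = cayley_resolvent (cnj z) \<zeta> W'"
    unfolding resolvent_family_def quasi_sa_ext_eq if_not_P[OF False]
      direct_sum_adjoint[OF F[OF cnj] W W']
    by (rule op_resolvent_total_graph[OF half_plane_neq_cnj[OF z' cnj']])
  have upper_eq: "compressed_resolvent V T (cnj \<zeta>) = cayley_resolvent z (cnj \<zeta>) W"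
    using upper[OF cnj] resolvent_family_upper[where F = F, OF W(3) cnj] by simp
  show ?thesis
  proof (rule adjoint_pair_unique)
    have ran: "range_space T \<zeta>' = K" if "\<zeta>' \<notin> \<real>" for \<zeta>'
      by (rule self_adjoint_range_space[OF K T that])
    show "Domain (compressed_resolvent V T (cnj \<zeta>)) = UNIV"
      "Domain (compressed_resolvent V T \<zeta>) = UNIV"
      using \<zeta> by (intro Domain_compressed_resolvent[OF V] ran; simp add: not_Reals_iff)+
    show "Domain (resolvent_family A z F \<zeta>) = UNIV"
      unfolding lower_eq by (rule Domain_cayley_resolvent[OF W'(1) W'_le z' cnj'])
    show "adjoint_pair (compressed_resolvent V T (cnj \<zeta>)) (compressed_resolvent V T \<zeta>)"
      by (rule adjoint_pair_compressed_resolvent[OF V(1) self_adjoint_closed_symmetric[OF K(1) T]])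
    show "adjoint_pair (compressed_resolvent V T (cnj \<zeta>)) (resolvent_family A z F \<zeta>)"
      unfolding lower_eq upper_eq
      using adjoint_pair_cayley_resolvent[OF W(1) W'(1,2), of z "cnj \<zeta>"] by simp
  qed
qed (rule upper)

end

section \<open>Analyticity of compressions\<close>

lemma closed_orth_compl: "closed (orth_compl M)"
proof -
  have "orth_compl M = (\<Inter>m\<in>M. {h. cinner h m = 0})"
    by (auto simp: orth_compl_def)
  also have "closed \<dots>"
    by (intro closed_INT ballI closed_Collect_eq continuous_intros)
  finally show ?thesis .
qed

abbreviation (input) diff_quot :: "(complex \<Rightarrow> 'b \<Rightarrow> 'a::chilbert_space) \<Rightarrow> complex \<Rightarrow> complex \<Rightarrow> 'b \<Rightarrow> 'a" where
  "diff_quot W \<zeta> \<mu> x \<equiv> (1 / (\<mu> - \<zeta>)) *\<^sub>C (W \<mu> x - W \<zeta> x)"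

text \<open>The error bound \<open>b \<zeta> \<mu>\<close> is uniform in the vector, which is
  convergence in operator norm. That \<open>G \<zeta>\<close> maps \<open>M\<close> into
  \<open>N\<close> is inherited from the difference quotients, because \<open>N\<close> is
  closed.\<close>

lemma op_analytic_onI:
  fixes W :: "complex \<Rightarrow> 'a::chilbert_space \<Rightarrow> 'a"
  assumes D: "open D" and M: "csubspace M" and N: "csubspace N" "closed N"
    and W: "\<And>\<zeta>. \<zeta> \<in> D \<Longrightarrow> clinear (W \<zeta>)" "\<And>\<zeta> x. \<zeta> \<in> D \<Longrightarrow> norm (W \<zeta> x) \<le> norm x"
      "\<And>\<zeta> x. \<zeta> \<in> D \<Longrightarrow> x \<in> M \<Longrightarrow> W \<zeta> x \<in> N"
    and G: "\<And>\<zeta>. \<zeta> \<in> D \<Longrightarrow> clinear (G \<zeta>)" "\<And>\<zeta> x. \<zeta> \<in> D \<Longrightarrow> norm (G \<zeta> x) \<le> B \<zeta> * norm x"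
    and b: "\<And>\<zeta>. \<zeta> \<in> D \<Longrightarrow> (b \<zeta> \<longlongrightarrow> (0::real)) (at \<zeta>)"
      "\<And>\<zeta> \<mu> x. \<zeta> \<in> D \<Longrightarrow> \<mu> \<in> D \<Longrightarrow> \<mu> \<noteq> \<zeta> \<Longrightarrow>
        norm (diff_quot W \<zeta> \<mu> x - G \<zeta> x) \<le> b \<zeta> \<mu> * norm x"
  shows "op_analytic_on D M N (\<lambda>\<zeta>. {(x, W \<zeta> x) | x. x \<in> M})"
proof -
  have bdd: "bounded_operator_between M N {(x, f x) | x. x \<in> M}"
    if "clinear f" "\<And>x. norm (f x) \<le> c * norm x" "\<And>x. x \<in> M \<Longrightarrow> f x \<in> N" for f c
  proof -
    have "linear_operator {(x, f x) | x. x \<in> M}"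
      by (rule linear_operatorI) (auto simp: clinearD[OF that(1)] csubspaceD[OF M])
    then show ?thesis
      using that by (auto simp: bounded_operator_between_def intro!: exI[of _ c])
  qed
  have ev: "\<forall>\<^sub>F \<mu> in at \<zeta>. \<mu> \<in> D \<and> \<mu> \<noteq> \<zeta>" if "\<zeta> \<in> D" for \<zeta>
    using D that by (auto simp: eventually_at_topological)
  have GN: "G \<zeta> x \<in> N" if \<zeta>: "\<zeta> \<in> D" and x: "x \<in> M" for \<zeta> x
  proof -
    have "((\<lambda>\<mu>. diff_quot W \<zeta> \<mu> x) \<longlongrightarrow> G \<zeta> x) (at \<zeta>)"
    proof (rule Lim_null[THEN iffD2], rule Lim_null_comparison)
      show "\<forall>\<^sub>F \<mu> in at \<zeta>. norm (diff_quot W \<zeta> \<mu> x - G \<zeta> x) \<le> b \<zeta> \<mu> * norm x"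
        using ev[OF \<zeta>] by eventually_elim (use b(2)[OF \<zeta>] in auto)
      show "((\<lambda>\<mu>. b \<zeta> \<mu> * norm x) \<longlongrightarrow> 0) (at \<zeta>)"
        using tendsto_mult_right[OF b(1)[OF \<zeta>], of "norm x"] by simp
    qed
    moreover have "\<forall>\<^sub>F \<mu> in at \<zeta>. diff_quot W \<zeta> \<mu> x \<in> N"
      using ev[OF \<zeta>]
      by eventually_elim (intro csubspace_scaleC csubspace_diff N(1) W(3) \<zeta> x; simp)
    ultimately show ?thesis
      by (intro Lim_in_closed_set[OF N(2)]) auto
  qed
  show ?thesis
    unfolding op_analytic_on_def
  proof (intro conjI ballI)
    fix \<zeta>
    assume \<zeta>: "\<zeta> \<in> D"
    show "bounded_operator_between M N {(x, W \<zeta> x) | x. x \<in> M}"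
      using W \<zeta> by (intro bdd[where c = 1]) auto
    show "\<exists>Gr. bounded_operator_between M N Gr \<and>
        (\<forall>e>0. \<forall>\<^sub>F \<mu> in at \<zeta> within D. \<forall>x y y' w.
           (x, y) \<in> {(x, W \<mu> x) | x. x \<in> M} \<longrightarrow> (x, y') \<in> {(x, W \<zeta> x) | x. x \<in> M} \<longrightarrow>
           (x, w) \<in> Gr \<longrightarrow> norm ((1 / (\<mu> - \<zeta>)) *\<^sub>C (y - y') - w) \<le> e * norm x)"
      (is "\<exists>Gr. _ \<and> (\<forall>e>0. ?P Gr e)")
    proof (intro exI conjI allI impI)
      show "bounded_operator_between M N {(x, G \<zeta> x) | x. x \<in> M}"
        by (rule bdd[OF G(1)[OF \<zeta>] G(2)[OF \<zeta>] GN[OF \<zeta>]])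
      fix e :: real
      assume "e > 0"
      then have "\<forall>\<^sub>F \<mu> in at \<zeta>. b \<zeta> \<mu> < e"
        by (rule order_tendstoD(2)[OF b(1)[OF \<zeta>]])
      then have "\<forall>\<^sub>F \<mu> in at \<zeta>. \<forall>x. norm (diff_quot W \<zeta> \<mu> x - G \<zeta> x) \<le> e * norm x"
        using ev[OF \<zeta>]
      proof eventually_elim
        case (elim \<mu>)
        then show ?case
          using b(2)[OF \<zeta>, of \<mu>] mult_right_mono[of "b \<zeta> \<mu>" e] by (meson less_imp_le norm_ge_zero order_trans)
      qed
      then show "?P {(x, G \<zeta> x) | x. x \<in> M} e"
        unfolding at_within_open[OF \<zeta> D] by eventually_elim auto
    qed
  qed
qed

text \<open>The resolvent identity for \<open>(1 - w X)\<inverse>\<close>; it drives all derivative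
  estimates for the compression.\<close>

lemma neumann_inv_diff:
  fixes X :: "'a::chilbert_space \<Rightarrow> 'a"
  assumes X: "clinear X" "\<And>x. norm (X x) \<le> norm x" and w: "cmod w < 1" "cmod w' < 1"
  shows "neumann_inv w' X v - neumann_inv w X v =
    (w' - w) *\<^sub>C neumann_inv w' X (X (neumann_inv w X v))"
proof -
  let ?y = "neumann_inv w X v"
  note J = clinearD[OF clinear_neumann_inv[OF X w(2)]]
  have "?y - w' *\<^sub>C X ?y = v - (w' - w) *\<^sub>C X ?y"
    by (subst (3) neumann_inv_right[OF X w(1), symmetric, of v]) (simp add: scaleC_simps)
  then have "?y = neumann_inv w' X (v - (w' - w) *\<^sub>C X ?y)"
    by (rule neumann_inv_eqI[OF X w(2), symmetric])
  also have "\<dots> = neumann_inv w' X v - (w' - w) *\<^sub>C neumann_inv w' X (X ?y)"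
    by (simp add: J)
  finally show ?thesis
    by (simp add: algebra_simps)
qed

lemma open_half_plane: "z \<notin> \<real> \<Longrightarrow> open (half_plane z)"
proof -
  assume "z \<notin> \<real>"
  then have "half_plane z = (if Im z > 0 then {\<zeta>. 0 < Im \<zeta>} else {\<zeta>. Im \<zeta> < 0})"
    by (auto simp: half_plane_iff not_Reals_iff sgn_if split: if_splits)
  then show ?thesis
    by (simp add: open_halfspace_Im_gt open_halfspace_Im_lt)
qed

lemma disk_coord_diff:
  assumes "\<mu> \<noteq> cnj z" "\<zeta> \<noteq> cnj z"
  shows "disk_coord z \<mu> - disk_coord z \<zeta> =
    (\<mu> - \<zeta>) * ((z - cnj z) / ((\<mu> - cnj z) * (\<zeta> - cnj z)))"
  using assms by (simp add: disk_coord_def divide_simps) (simp add: algebra_simps)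

lemma tendsto_disk_coord:
  assumes "\<zeta> \<noteq> cnj z"
  shows "(disk_coord z \<longlongrightarrow> disk_coord z \<zeta>) (at \<zeta>)"
  unfolding disk_coord_def[abs_def] using assms by (intro tendsto_intros) auto

text \<open>Precomposing with the projection onto \<open>K\<close> turns an isometry of
  \<open>K\<close> into a contraction of the whole space, the setting of the Neumann
  inverse.\<close>

lemma isometric_extension:
  fixes C :: "'a::chilbert_space operator"
  assumes K: "csubspace K" "closed K" and C: "linear_operator C" "Domain C = K"
    and iso: "\<And>g u. (g, u) \<in> C \<Longrightarrow> norm u = norm g"
  obtains U where "clinear U" "\<And>g. norm (U g) \<le> norm g" "\<And>g. (orth_proj K g, U g) \<in> C"
proof -
  define U where "U g = graph_fun C (orth_proj K g)" for g
  have UC: "(orth_proj K g, U g) \<in> C" for g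
    unfolding U_def by (rule graph_fun_in[OF C(1)]) (simp add: C(2) orth_proj_in[OF K])
  have "clinear U"
    unfolding clinear_def U_def clinearD(1,2)[OF clinear_orth_proj[OF K]]
    by (intro conjI allI graph_fun_eqI[OF C(1)] linear_operator_add[OF C(1)]
        linear_operator_scaleC[OF C(1)] UC[unfolded U_def])
  moreover have "norm (U g) \<le> norm g" for g
    using iso[OF UC[of g]] norm_orth_proj_le[OF K, of g] by simp
  ultimately show ?thesis
    using UC by (rule that)
qed

section \<open>Compressions of self-adjoint extensions\<close>

lemma compressed_resolvent_upper:
  fixes A :: "'a::chilbert_space operator" and V :: "'a \<Rightarrow> 'b::chilbert_space"
  assumes A: "closed_symmetric A" and z: "z \<notin> \<real>"
    and K: "closed K" "csubspace K" and V: "linear_isometry V" "range V \<subseteq> K"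
    and T: "self_adjoint_on K T" and AT: "map_prod V V ` A \<subseteq> T"
  shows "\<exists>F \<in> schur_params A z.
    \<forall>\<zeta>\<in>half_plane z. compressed_resolvent V T \<zeta> = resolvent_family A z F \<zeta>"
proof -
  note sym = self_adjoint_closed_symmetric[OF K(1) T]
  note z' = cnj_notin_Reals[OF A z]
  note Viso = linear_isometryD[OF V(1)]
  obtain V' where V': "clinear V'" "\<And>x y. cinner (V x) y = cinner x (V' y)" "\<And>x. V' (V x) = x"
    "\<And>y. V (V' y) = orth_proj (range V) y" "\<And>y. (norm y)\<^sup>2 = (norm (V' y))\<^sup>2 + (norm (y - V (V' y)))\<^sup>2"
    "\<And>y. norm (V' y) \<le> norm y"
    using linear_isometry_adjoint[OF V(1)] by metis
  define C where "C = cayley T z"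
  have C: "linear_operator C" "Domain C = K" "Range C = K"
    unfolding C_def Domain_cayley Range_cayley
    by (intro linear_operator_cayley[OF sym z] self_adjoint_range_space[OF K T] z z')+
  have normC: "norm u = norm g" if "(g, u) \<in> C" for g u
    using cayley_norm[OF sym] that unfolding C_def .
  obtain U where "clinear U" and U_le: "\<And>g. norm (U g) \<le> norm g"
    and U_proj: "\<And>g. (orth_proj K g, U g) \<in> C"
    using isometric_extension[OF K(2,1) C(1,2) normC] by metis
  have UC: "(g, U g) \<in> C" if "g \<in> K" for g
    using U_proj[of g] orth_proj_id[OF K(2) that] by simp
  have U_eq: "U g = u" if "(g, u) \<in> C" for g u
  proof -
    have "g \<in> K"
      using that C(2) by auto
    with UC that show ?thesis
      using linear_operator_unique[OF C(1)] by blast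
  qed
  have U_norm: "norm (U g) = norm g" if "g \<in> K" for g
    by (rule normC[OF UC[OF that]])
  have proj: "orth_proj K g \<in> K" for g
    by (rule orth_proj_in[OF K(2,1)])
  have UK: "U g \<in> K" if "g \<in> K" for g
    using UC[OF that] C(3) by auto
  note U = clinearD[OF \<open>clinear U\<close>]
  \<comment> \<open>This is \<open>Q U\<close>, with \<open>P\<close> realized as
    \<open>V V'\<close>.\<close>
  define X where "X g = U g - V (V' (U g))" for g
  have X: "clinear X" "norm (X g) \<le> norm g" for g
  proof -
    show "clinear X"
      by (simp add: clinear_def X_def U clinearD[OF V'(1)] clinearD[OF Viso(1)] scaleC_simps)
    have "norm (X g) \<le> norm (U g)"
      unfolding X_def by (rule power2_le_imp_le) (simp_all add: V'(5)[of "U g"])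
    then show "norm (X g) \<le> norm g"
      using U_le[of g] by linarith
  qed
  have XK: "X g \<in> K" if "g \<in> K" for g
    unfolding X_def using V(2) by (intro csubspace_diff K(2) UK that) auto
  have V'X: "V' (X g) = 0" for g
    by (simp add: X_def clinear_diff[OF V'(1)] V'(3))
  define J where "J \<zeta> x = neumann_inv (disk_coord z \<zeta>) X (V x)" for \<zeta> x
  define W where "W \<zeta> x = V' (U (J \<zeta> x))" for \<zeta> x

  have half: "clinear (W \<zeta>) \<and> (\<forall>x. norm (W \<zeta> x) \<le> norm x) \<and>
      (\<forall>g u. (g, u) \<in> cayley A z \<longrightarrow> W \<zeta> g = u) \<and>
      compressed_resolvent V T \<zeta> = cayley_resolvent z \<zeta> (W \<zeta>)"
    if \<zeta>: "\<zeta> \<in> half_plane z" for \<zeta>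
  proof -
    define w where "w = disk_coord z \<zeta>"
    have w: "cmod w < 1"
      unfolding w_def by (rule norm_disk_coord_less_1[OF z \<zeta>])
    note neq = half_plane_neq_cnj[OF z \<zeta>]
    have J: "J \<zeta> x = V x + w *\<^sub>C X (J \<zeta> x)" for x
      using neumann_inv_right[OF X w, of "V x"] by (simp add: J_def w_def diff_eq_eq)
    have J_eqI: "J \<zeta> x = g" if "g - w *\<^sub>C X g = V x" for x g
      unfolding J_def using neumann_inv_eqI[OF X w that] by (simp add: w_def)
    have JK: "J \<zeta> x \<in> K" for x
    proof -
      \<comment> \<open>\<open>U\<close> factors through the projection onto \<open>K\<close>, so
        \<open>X\<close> sees only the part of its argument in \<open>K\<close>.\<close>
      let ?y = "orth_proj K (J \<zeta> x)"
      have "X ?y = X (J \<zeta> x)"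
        by (simp add: X_def U_eq[OF U_proj])
      moreover have "X ?y \<in> K"
        by (rule XK[OF proj])
      ultimately have "V x + w *\<^sub>C X (J \<zeta> x) \<in> K"
        using V(2) by (intro csubspace_add csubspace_scaleC K(2)) auto
      then show ?thesis
        by (simp flip: J)
    qed
    have V'J: "V' (J \<zeta> x) = x" for x
      by (subst J) (simp add: clinearD[OF V'(1)] V'(3) V'X)
    \<comment> \<open>As \<open>U\<close> is the sum of \<open>X\<close> and \<open>V V' U\<close>,
      applying \<open>1 - w U\<close> to \<open>J \<zeta> x\<close> leaves \<open>V x\<close> minus
      the inner part \<open>w V (W \<zeta> x)\<close>.\<close>
    have step: "J \<zeta> x - w *\<^sub>C U (J \<zeta> x) = V (x - w *\<^sub>C W \<zeta> x)" for x
      by (subst (1) J) (simp add: X_def W_def clinearD[OF Viso(1)] scaleC_simps)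
    have "clinear (W \<zeta>)"
      unfolding W_def J_def
      by (intro clinear_compose[OF V'(1)] clinear_compose[OF \<open>clinear U\<close>]
          clinear_compose[OF clinear_neumann_inv[OF X w[unfolded w_def]]] Viso(1))
    \<comment> \<open>With \<open>g = J \<zeta> x\<close>, split both \<open>U g\<close> and
      \<open>g\<close> into inner and outer parts. Their norms agree, and the outer part of
      \<open>g\<close> is \<open>w X g\<close>, no longer than the outer part \<open>X g\<close> of
      \<open>U g\<close>; hence the inner parts satisfy the reverse inequality.\<close>
    moreover have "norm (W \<zeta> x) \<le> norm x" for x
    proof (rule power2_le_imp_le)
      let ?g = "J \<zeta> x"
      have "(norm (W \<zeta> x))\<^sup>2 + (norm (X ?g))\<^sup>2 = (norm ?g)\<^sup>2"
        using V'(5)[of "U ?g"] U_norm[OF JK[of x]] by (simp add: W_def X_def)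
      also have "\<dots> = (norm x)\<^sup>2 + (norm (?g - V x))\<^sup>2"
        using V'(5)[of ?g] by (simp add: V'J)
      also have "?g - V x = w *\<^sub>C X ?g"
        by (subst (1) J) simp
      also have "(norm (w *\<^sub>C X ?g))\<^sup>2 \<le> (norm (X ?g))\<^sup>2"
        using w by (intro power_mono) (auto simp: mult_left_le_one_le)
      finally show "(norm (W \<zeta> x))\<^sup>2 \<le> (norm x)\<^sup>2"
        by simp
    qed simp
    moreover have "W \<zeta> g = u" if gu: "(g, u) \<in> cayley A z" for g u
    proof -
      obtain x y where xy: "(x, y) \<in> A" "g = y - z *\<^sub>C x" "u = y - cnj z *\<^sub>C x"
        using closed_symmetric_linear[OF A] gu by (rule cayleyE)
      then have "(V x, V y) \<in> T"
        using AT by force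
      from cayleyI[OF this, of z] have "(V g, V u) \<in> C"
        by (simp add: C_def xy clinearD[OF Viso(1)])
      then have Ug: "U (V g) = V u"
        by (rule U_eq)
      \<comment> \<open>Here \<open>U (V g)\<close> lies in the range of \<open>V\<close>, so
        \<open>X\<close> annihilates \<open>V g\<close>.\<close>
      have "J \<zeta> g = V g"
        by (rule J_eqI) (simp add: X_def Ug V'(3))
      then show ?thesis
        by (simp add: W_def Ug V'(3))
    qed
    moreover have "compressed_resolvent V T \<zeta> = cayley_resolvent z \<zeta> (W \<zeta>)"
    proof -
      have T_eq: "T = inv_cayley z C"
        unfolding C_def using inv_cayley_cayley[OF closed_symmetric_linear[OF sym] z] by simp
      have "(x, x') \<in> compressed_resolvent V T \<zeta> \<longleftrightarrow> (x, x') \<in> cayley_resolvent z \<zeta> (W \<zeta>)" for x x'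
      proof
        assume "(x, x') \<in> compressed_resolvent V T \<zeta>"
        then obtain y where y: "(V x, y) \<in> op_resolvent (inv_cayley z C) \<zeta>"
          "V x' = orth_proj (range V) y"
          by (auto simp: compressed_resolvent_def T_eq)
        from y(1) obtain g u where gu: "(g, u) \<in> C" "V x = (\<zeta> - cnj z) *\<^sub>C (g - w *\<^sub>C u)" "y = u - g"
          by (auto simp: op_resolvent_inv_cayley[OF neq] w_def)
        have u: "u = U g" and "g \<in> K"
          using U_eq[OF gu(1)] gu(1) C(2) by auto
        \<comment> \<open>The parameter of the compressed formula is the inner part of
          \<open>g\<close>. The outer part of the resolvent equation recovers \<open>g\<close> as
          \<open>J \<zeta> k\<close>, and the inner part is the formula itself.\<close>
        define k where "k = V' g"
        define h where "h = inverse (\<zeta> - cnj z) *\<^sub>C x"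
        have "V h = g - w *\<^sub>C U g"
          using neq by (simp add: h_def clinearD[OF Viso(1)] gu(2) u scaleC_scaleC)
        then have "V (h + w *\<^sub>C V' (U g)) = g - w *\<^sub>C X g"
          by (simp add: X_def clinearD[OF Viso(1)] scaleC_simps)
        moreover from arg_cong[OF this, of V'] have "h + w *\<^sub>C V' (U g) = k"
          by (simp add: V'(3) clinearD[OF V'(1)] V'X k_def)
        ultimately have "J \<zeta> k = g"
          by (intro J_eqI) simp
        then have Wk: "W \<zeta> k = V' (U g)" and "V (k - w *\<^sub>C W \<zeta> k) = g - w *\<^sub>C u"
          using step[of k] by (simp_all add: W_def u)
        then have "V x = V ((\<zeta> - cnj z) *\<^sub>C (k - w *\<^sub>C W \<zeta> k))"
          by (simp only: gu(2) clinear_scaleC[OF Viso(1)])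
        then have "x = (\<zeta> - cnj z) *\<^sub>C (k - w *\<^sub>C W \<zeta> k)"
          by (simp only: Viso(4))
        moreover have "x' = V' y"
          using y(2) unfolding V'(4)[symmetric] Viso(4) .
        then have "x' = W \<zeta> k - k"
          unfolding Wk by (simp add: gu(3) u k_def clinearD[OF V'(1)])
        ultimately show "(x, x') \<in> cayley_resolvent z \<zeta> (W \<zeta>)"
          unfolding cayley_resolvent_def w_def by blast
      next
        assume "(x, x') \<in> cayley_resolvent z \<zeta> (W \<zeta>)"
        then obtain k where k: "x = (\<zeta> - cnj z) *\<^sub>C (k - w *\<^sub>C W \<zeta> k)" "x' = W \<zeta> k - k"
          by (auto simp: cayley_resolvent_def w_def)
        let ?g = "J \<zeta> k"
        have "V x = (\<zeta> - cnj z) *\<^sub>C (?g - w *\<^sub>C U ?g)"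
          unfolding step k(1) clinear_scaleC[OF Viso(1)] ..
        then have "(V x, U ?g - ?g) \<in> op_resolvent T \<zeta>"
          unfolding T_eq op_resolvent_inv_cayley[OF neq] w_def using UC[OF JK] by blast
        moreover have "V x' = orth_proj (range V) (U ?g - ?g)"
          by (simp add: k(2) V'J W_def clinearD[OF V'(1)] flip: V'(4))
        ultimately show "(x, x') \<in> compressed_resolvent V T \<zeta>"
          unfolding compressed_resolvent_def by blast
      qed
      then show ?thesis by auto
    qed
    ultimately show ?thesis by blast
  qed

  let ?M = "defect_space A z" and ?N = "defect_space A (cnj z)"
  define F where "F \<zeta> = {(x, W \<zeta> x) | x. x \<in> ?M}" for \<zeta>
  have F: "nonexpanding_between ?M ?N (F \<zeta>)" "direct_sum_op (cayley A z) (F \<zeta>) = total_graph (W \<zeta>)"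
    if "\<zeta> \<in> half_plane z" for \<zeta>
    using defect_restriction[OF A z, of "W \<zeta>"] half[OF that] by (auto simp: F_def)
  have "op_analytic_on (half_plane z) ?M ?N F"
  proof -
    \<comment> \<open>The exact difference quotient of the disk coordinate between \<zeta> and
      \<mu>; its derivative at \<zeta> is \<open>d \<zeta> \<zeta>\<close>.\<close>
    define d where "d \<zeta> \<mu> = (z - cnj z) / ((\<mu> - cnj z) * (\<zeta> - cnj z))" for \<zeta> \<mu>
    define R where "R \<zeta> = neumann_inv (disk_coord z \<zeta>) X" for \<zeta>
    \<comment> \<open>The derivative of \<open>V' U (1 - w X)\<inverse> V\<close>, with
      \<open>w\<close> the disk coordinate and \<open>R\<close> the Neumann inverse.\<close>
    define G where "G \<zeta> x = d \<zeta> \<zeta> *\<^sub>C V' (U (R \<zeta> (X (J \<zeta> x))))" for \<zeta> x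
    define r where "r \<zeta> = 1 - cmod (disk_coord z \<zeta>)" for \<zeta>
    \<comment> \<open>The first summand is the variation of \<open>d\<close>. The second comes from
      replacing \<open>R \<mu>\<close> by \<open>R \<zeta>\<close> through another use of the
      resolvent identity.\<close>
    define b where "b \<zeta> \<mu> = (cmod (d \<zeta> \<mu> - d \<zeta> \<zeta>) / r \<mu> +
      cmod (d \<zeta> \<zeta>) * cmod (disk_coord z \<mu> - disk_coord z \<zeta>) / (r \<mu> * r \<zeta>)) / r \<zeta>" for \<zeta> \<mu>
    have dc: "cmod (disk_coord z \<zeta>) < 1" and r: "r \<zeta> > 0" if "\<zeta> \<in> half_plane z" for \<zeta>
      using norm_disk_coord_less_1[OF z that] by (auto simp: r_def)
    have R: "clinear (R \<zeta>)" "norm (R \<zeta> v) \<le> norm v / r \<zeta>" if "\<zeta> \<in> half_plane z" for \<zeta> v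
      unfolding R_def r_def using clinear_neumann_inv[OF X dc[OF that]] norm_neumann_inv_le[OF X dc[OF that]]
      by auto
    have VU: "clinear (\<lambda>x. V' (U x))" "norm (V' (U x)) \<le> norm x" for x
      using clinear_compose[OF V'(1) \<open>clinear U\<close>] order_trans[OF V'(6) U_le] by auto
    have JR: "J \<zeta> x = R \<zeta> (V x)" for \<zeta> x
      by (simp add: J_def R_def)
    have XJ: "norm (X (J \<zeta> x)) \<le> norm x / r \<zeta>" if "\<zeta> \<in> half_plane z" for \<zeta> x
      using order_trans[OF X(2) R(2)[OF that, of "V x"]] by (simp add: JR Viso(3))
    show ?thesis
      unfolding F_def[abs_def]
    proof (rule op_analytic_onI)
      show "open (half_plane z)"
        by (rule open_half_plane[OF z])
      show "csubspace ?M" "csubspace ?N" "closed ?N"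
        by (simp_all add: defect_space_def csubspace_orth_compl closed_orth_compl)
      fix \<zeta>
      assume \<zeta>: "\<zeta> \<in> half_plane z"
      note neq = half_plane_neq_cnj[OF z \<zeta>]
      show "clinear (W \<zeta>)" "norm (W \<zeta> x) \<le> norm x" for x
        using half[OF \<zeta>] by auto
      show "W \<zeta> x \<in> ?N" if "x \<in> ?M" for x
        using F(1)[OF \<zeta>] that unfolding nonexpanding_between_def F_def by blast
      have cG: "clinear (\<lambda>x. V' (U (R \<zeta> (X (J \<zeta> x)))))"
        unfolding JR by (intro clinear_compose[OF VU(1)] clinear_compose[OF R(1)[OF \<zeta>]]
            clinear_compose[OF X(1)] Viso(1))
      then show "clinear (G \<zeta>)"
        by (simp add: clinear_def G_def scaleC_simps mult.commute)
      show "norm (G \<zeta> x) \<le> cmod (d \<zeta> \<zeta>) / (r \<zeta>)\<^sup>2 * norm x" for x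
      proof -
        have "norm (V' (U (R \<zeta> (X (J \<zeta> x))))) \<le> norm x / r \<zeta> / r \<zeta>"
          using r[OF \<zeta>] by (intro order_trans[OF VU(2)] order_trans[OF R(2)[OF \<zeta>]] divide_right_mono XJ \<zeta>) auto
        from mult_left_mono[OF this, of "cmod (d \<zeta> \<zeta>)"] show ?thesis
          by (simp add: G_def power2_eq_square)
      qed
      show "(b \<zeta> \<longlongrightarrow> 0) (at \<zeta>)"
      proof -
        have "r \<zeta> \<noteq> 0"
          using r[OF \<zeta>] by simp
        have "(r \<longlongrightarrow> r \<zeta>) (at \<zeta>)"
          unfolding r_def[abs_def] by (intro tendsto_intros tendsto_disk_coord neq)
        moreover have "(d \<zeta> \<longlongrightarrow> d \<zeta> \<zeta>) (at \<zeta>)"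
          unfolding d_def[abs_def] using neq by (intro tendsto_intros) auto
        ultimately have "(b \<zeta> \<longlongrightarrow> (cmod (d \<zeta> \<zeta> - d \<zeta> \<zeta>) / r \<zeta> +
            cmod (d \<zeta> \<zeta>) * cmod (disk_coord z \<zeta> - disk_coord z \<zeta>) / (r \<zeta> * r \<zeta>)) / r \<zeta>) (at \<zeta>)"
          unfolding b_def[abs_def] using \<open>r \<zeta> \<noteq> 0\<close>
          by (intro tendsto_intros tendsto_disk_coord neq) auto
        then show ?thesis by simp
      qed
      fix \<mu> x
      assume \<mu>: "\<mu> \<in> half_plane z" "\<mu> \<noteq> \<zeta>"
      define y where "y = X (J \<zeta> x)"
      define e where "e = disk_coord z \<mu> - disk_coord z \<zeta>"
      have e: "e = (\<mu> - \<zeta>) * d \<zeta> \<mu>"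
        unfolding e_def d_def by (rule disk_coord_diff[OF half_plane_neq_cnj[OF z \<mu>(1)] neq])
      have J_diff: "J \<mu> x - J \<zeta> x = e *\<^sub>C R \<mu> y"
        unfolding JR y_def R_def e_def by (rule neumann_inv_diff[OF X dc[OF \<zeta>] dc[OF \<mu>(1)]])
      have R_diff: "R \<mu> y - R \<zeta> y = e *\<^sub>C R \<mu> (X (R \<zeta> y))"
        unfolding R_def e_def by (rule neumann_inv_diff[OF X dc[OF \<zeta>] dc[OF \<mu>(1)]])
      have "diff_quot W \<zeta> \<mu> x = V' (U (d \<zeta> \<mu> *\<^sub>C R \<mu> y))"
        using \<mu>(2) by (simp add: W_def J_diff clinearD[OF VU(1)] e scaleC_scaleC flip: clinear_diff[OF VU(1)])
      then have "diff_quot W \<zeta> \<mu> x - G \<zeta> x =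
          V' (U (d \<zeta> \<mu> *\<^sub>C R \<mu> y - d \<zeta> \<zeta> *\<^sub>C R \<zeta> y))"
        by (simp add: G_def clinearD[OF VU(1)] y_def)
      also have "d \<zeta> \<mu> *\<^sub>C R \<mu> y - d \<zeta> \<zeta> *\<^sub>C R \<zeta> y =
          (d \<zeta> \<mu> - d \<zeta> \<zeta>) *\<^sub>C R \<mu> y + (d \<zeta> \<zeta> * e) *\<^sub>C R \<mu> (X (R \<zeta> y))"
        by (simp add: scaleC_diff_left scaleC_diff_right flip: R_diff scaleC_scaleC)
      also have "norm (V' (U \<dots>)) \<le> norm \<dots>"
        by (rule VU(2))
      also have "\<dots> \<le> cmod (d \<zeta> \<mu> - d \<zeta> \<zeta>) * norm (R \<mu> y) +
          cmod (d \<zeta> \<zeta>) * cmod e * norm (R \<mu> (X (R \<zeta> y)))"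
        by (rule order_trans[OF norm_triangle_ineq]) (simp add: norm_mult)
      also have "\<dots> \<le> cmod (d \<zeta> \<mu> - d \<zeta> \<zeta>) * (norm x / r \<zeta> / r \<mu>) +
          cmod (d \<zeta> \<zeta>) * cmod e * (norm x / r \<zeta> / r \<zeta> / r \<mu>)"
      proof (intro add_mono mult_left_mono)
        have y: "norm y \<le> norm x / r \<zeta>"
          unfolding y_def by (rule XJ[OF \<zeta>])
        show "norm (R \<mu> y) \<le> norm x / r \<zeta> / r \<mu>"
          using r[OF \<mu>(1)] y by (intro order_trans[OF R(2)[OF \<mu>(1)]] divide_right_mono) auto
        have "norm (X (R \<zeta> y)) \<le> norm x / r \<zeta> / r \<zeta>"
          using r[OF \<zeta>] y by (intro order_trans[OF X(2)] order_trans[OF R(2)[OF \<zeta>]] divide_right_mono) auto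
        then show "norm (R \<mu> (X (R \<zeta> y))) \<le> norm x / r \<zeta> / r \<zeta> / r \<mu>"
          using r[OF \<mu>(1)] by (intro order_trans[OF R(2)[OF \<mu>(1)]] divide_right_mono) auto
      qed auto
      also have "\<dots> = b \<zeta> \<mu> * norm x"
        by (simp add: b_def e_def add_divide_distrib algebra_simps)
      finally show "norm (diff_quot W \<zeta> \<mu> x - G \<zeta> x) \<le> b \<zeta> \<mu> * norm x" .
    qed
  qed
  then have "F \<in> schur_class (half_plane z) ?M ?N"
    using F(1) by (simp add: schur_class_def)
  moreover have "compressed_resolvent V T \<zeta> = resolvent_family A z F \<zeta>" if "\<zeta> \<in> half_plane z" for \<zeta>
    using half[OF that] resolvent_family_upper[OF A z, where F = F, OF F(2)[OF that] that] by simp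
  ultimately show ?thesis
    by blast
qed

lemma generalized_resolvent_form:
  assumes A: "closed_symmetric A" and z: "z \<notin> \<real>"
    and R: "generalized_resolvent TYPE('b::chilbert_space) A R"
  shows "\<exists>F \<in> schur_params A z.
    \<forall>\<zeta>. \<zeta> \<notin> \<real> \<longrightarrow> R \<zeta> = resolvent_family A z F \<zeta>"
proof -
  obtain K :: "'b set" and V T where K: "closed K" "csubspace K"
    and V: "linear_isometry V" "range V \<subseteq> K"
    and T: "self_adjoint_on K T" "map_prod V V ` A \<subseteq> T"
    and R_eq: "\<And>\<zeta>. \<zeta> \<notin> \<real> \<Longrightarrow> R \<zeta> = compressed_resolvent V T \<zeta>"
    using R unfolding generalized_resolvent_def compressed_resolvent_def by blast
  obtain F where F: "F \<in> schur_params A z"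
    "\<And>\<zeta>. \<zeta> \<in> half_plane z \<Longrightarrow> compressed_resolvent V T \<zeta> = resolvent_family A z F \<zeta>"
    using compressed_resolvent_upper[OF A z K V T] by blast
  have "R \<zeta> = resolvent_family A z F \<zeta>" if "\<zeta> \<notin> \<real>" for \<zeta>
    unfolding R_eq[OF that]
    by (rule compressed_resolvent_lower[OF A z _ K V T(1) F(2) that])
       (use F(1) in \<open>auto simp: schur_class_def\<close>)
  with F(1) show ?thesis
    by blast
qed

section \<open>Positive semidefinite kernels\<close>

text \<open>Positivity is required of the real part only; Hermitian symmetry, stated separately,
  makes the form real.\<close>

definition psd_kernel :: "('i \<Rightarrow> 'i \<Rightarrow> complex) \<Rightarrow> bool" where
  "psd_kernel k \<longleftrightarrow> (\<forall>i j. k j i = cnj (k i j)) \<and>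
     (\<forall>S t. finite S \<longrightarrow> 0 \<le> Re (\<Sum>i\<in>S. \<Sum>j\<in>S. t i * cnj (t j) * k i j))"

context
  fixes k :: "'i \<Rightarrow> 'i \<Rightarrow> complex"
  assumes k: "psd_kernel k"
begin

lemma psd_kernel_cnj: "k j i = cnj (k i j)"
  using k unfolding psd_kernel_def by blast

lemma psd_kernel_nonneg:
  "finite S \<Longrightarrow> 0 \<le> Re (\<Sum>i\<in>S. \<Sum>j\<in>S. t i * cnj (t j) * k i j)"
  using k unfolding psd_kernel_def by blast

lemma psd_kernel_diag: "k i i = complex_of_real (Re (k i i))" "0 \<le> Re (k i i)"
proof -
  show "k i i = complex_of_real (Re (k i i))"
    using arg_cong[OF psd_kernel_cnj[of i i], of Im] by (simp add: complex_eq_iff)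
  show "0 \<le> Re (k i i)"
    using psd_kernel_nonneg[of "{i}" "\<lambda>_. 1"] by simp
qed

text \<open>With a zero diagonal entry at \<open>n\<close> the form on \<open>{i, n}\<close> is
  affine in the coefficient of \<open>n\<close>, so a non-zero \<open>k i n\<close> would make it
  unbounded below.\<close>

lemma psd_kernel_zero_diag:
  assumes "k n n = 0"
  shows "k i n = 0"
proof (rule ccontr)
  assume nz: "k i n \<noteq> 0"
  then have "i \<noteq> n"
    using assms by auto
  define c where "c = cmod (k i n)"
  have "c > 0"
    using nz by (simp add: c_def)
  \<comment> \<open>Solves \<open>Re (k i i) - 2 * s * c\<^sup>2 = - 1\<close>.\<close>
  define s where "s = (Re (k i i) + 1) / (2 * c\<^sup>2)"
  define t where "t l = (if l = i then 1 else - complex_of_real s * k i n)" for l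
  have "0 \<le> Re (\<Sum>l\<in>{i, n}. \<Sum>j\<in>{i, n}. t l * cnj (t j) * k l j)"
    by (rule psd_kernel_nonneg) simp
  also have "(\<Sum>l\<in>{i, n}. \<Sum>j\<in>{i, n}. t l * cnj (t j) * k l j) =
      k i i - 2 * complex_of_real s * (k i n * cnj (k i n))"
    using \<open>i \<noteq> n\<close> assms by (simp add: t_def psd_kernel_cnj[of n i] algebra_simps)
  also have "k i n * cnj (k i n) = complex_of_real (c\<^sup>2)"
    unfolding c_def by (rule complex_norm_square[symmetric])
  also have "Re (k i i - 2 * complex_of_real s * complex_of_real (c\<^sup>2)) = - 1"
    using \<open>c > 0\<close> by (simp add: s_def flip: of_real_mult) (simp add: field_simps)
  finally show False by simp
qed

end

section \<open>Schur complements and Cholesky factorization\<close>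

definition schur_complement :: "'i \<Rightarrow> ('i \<Rightarrow> 'i \<Rightarrow> complex) \<Rightarrow> 'i \<Rightarrow> 'i \<Rightarrow> complex" where
  "schur_complement n k i j = k i j - k i n * k n j / k n n"

lemma schur_complement_zero:
  assumes "psd_kernel k"
  shows "schur_complement n k n j = 0" "schur_complement n k i n = 0"
proof -
  have *: "schur_complement n k i n = 0" for i
    using psd_kernel_zero_diag[OF assms, of n i] by (cases "k n n = 0") (auto simp: schur_complement_def)
  then show "schur_complement n k i n = 0" .
  have "schur_complement n k n j = cnj (schur_complement n k j n)"
    unfolding schur_complement_def
    by (simp add: psd_kernel_cnj[OF assms, of n j] psd_kernel_cnj[OF assms, of n n, symmetric])
  then show "schur_complement n k n j = 0"
    using *[of j] by simp
qed

text \<open>Completing the square: for a non-zero pivot, the form of the complement at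
  \<open>t\<close> is the form of \<open>k\<close> at \<open>t\<close> with the \<open>n\<close>-th
  coordinate replaced by the minimizing value \<open>- p / d\<close>. A zero pivot leaves
  \<open>k\<close> unchanged.\<close>

lemma psd_kernel_schur_complement:
  assumes k: "psd_kernel k"
  shows "psd_kernel (schur_complement n k)"
  unfolding psd_kernel_def
proof (intro conjI allI impI)
  note cnj_k = psd_kernel_cnj[OF k]
  show "schur_complement n k j i = cnj (schur_complement n k i j)" for i j
    unfolding schur_complement_def
    by (simp add: cnj_k[of j i] cnj_k[of n j] cnj_k[of n i] cnj_k[of n n, symmetric] mult.commute)
  fix S :: "'a set" and t :: "'a \<Rightarrow> complex"
  assume S: "finite S"
  show "0 \<le> Re (\<Sum>i\<in>S. \<Sum>j\<in>S. t i * cnj (t j) * schur_complement n k i j)"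
  proof (cases "k n n = 0")
    case True
    then show ?thesis
      using psd_kernel_nonneg[OF k S, of t] by (simp add: schur_complement_def)
  next
    case False
    define d where "d = k n n"
    have d: "cnj d = d" "d \<noteq> 0"
      using cnj_k[of n n] False by (simp_all add: d_def)
    define S0 where "S0 = S - {n}"
    have S0: "finite S0" "n \<notin> S0"
      using S by (auto simp: S0_def)
    define p where "p = (\<Sum>i\<in>S0. t i * k i n)"
    define q where "q = (\<Sum>i\<in>S0. \<Sum>j\<in>S0. t i * cnj (t j) * k i j)"
    define u where "u = t(n := - p / d)"
    have u: "u n = - p / d" "\<And>i. i \<in> S0 \<Longrightarrow> u i = t i"
      using S0 by (auto simp: u_def)
    have cnj_p: "cnj p = (\<Sum>j\<in>S0. cnj (t j) * k n j)"
      unfolding p_def cnj_sum by (intro sum.cong) (simp_all add: cnj_k[of n])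
    have "(\<Sum>i\<in>S. \<Sum>j\<in>S. t i * cnj (t j) * schur_complement n k i j) =
        (\<Sum>i\<in>S0. \<Sum>j\<in>S0. t i * cnj (t j) * schur_complement n k i j)"
    proof -
      have "(\<Sum>j\<in>S. t i * cnj (t j) * schur_complement n k i j) =
          (\<Sum>j\<in>S0. t i * cnj (t j) * schur_complement n k i j)" for i
        unfolding S0_def using S
        by (intro sum.mono_neutral_right) (auto simp: schur_complement_zero[OF k])
      moreover have "(\<Sum>i\<in>S. \<Sum>j\<in>S0. t i * cnj (t j) * schur_complement n k i j) =
          (\<Sum>i\<in>S0. \<Sum>j\<in>S0. t i * cnj (t j) * schur_complement n k i j)"
        unfolding S0_def using S
        by (intro sum.mono_neutral_right) (auto simp: schur_complement_zero[OF k])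
      ultimately show ?thesis by simp
    qed
    also have "\<dots> = q - p * cnj p / d"
      unfolding q_def cnj_p unfolding p_def sum_product sum_divide_distrib sum_subtractf[symmetric]
        schur_complement_def d_def
      by (intro sum.cong refl) (simp add: algebra_simps)
    also have "\<dots> = q + u n * cnj p + cnj (u n) * p + u n * cnj (u n) * d"
      unfolding u(1) using d by (simp add: field_simps)
    also have "\<dots> = (\<Sum>i\<in>insert n S0. \<Sum>j\<in>insert n S0. u i * cnj (u j) * k i j)"
      using S0 unfolding cnj_p unfolding p_def q_def d_def sum_distrib_left
      by (simp add: u(2) sum.distrib algebra_simps cong: sum.cong)
    finally show ?thesis
      using psd_kernel_nonneg[OF k, of "insert n S0" u] S0(1) by simp
  qed
qed

primrec schur_iter :: "(nat \<Rightarrow> nat \<Rightarrow> complex) \<Rightarrow> nat \<Rightarrow> nat \<Rightarrow> nat \<Rightarrow> complex" where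
  "schur_iter k 0 = k"
| "schur_iter k (Suc n) = schur_complement n (schur_iter k n)"

text \<open>
  Cholesky factorization, with the \<open>n\<close>-th vector supported on \<open>{..n}\<close>.  A vanishing pivot
  does no harm: division by it gives 0, and its column is 0 as well.
\<close>

theorem kolmogorov_ell2:
  fixes k :: "nat \<Rightarrow> nat \<Rightarrow> complex"
  assumes k: "psd_kernel k"
  obtains v :: "nat \<Rightarrow> ell2" where "\<And>i j. cinner (v i) (v j) = k i j"
proof -
  let ?k = "schur_iter k"
  have psd: "psd_kernel (?k n)" for n
    by (induction n) (auto simp: k psd_kernel_schur_complement)
  note cnj_k = psd_kernel_cnj[OF psd]
  \<comment> \<open>Later eliminations keep the rows cleared earlier at zero.\<close>
  have zero: "?k n i j = 0" if "i < n" for n i j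
    using that
  proof (induction n arbitrary: j)
    case (Suc n)
    then show ?case
      by (cases "i = n") (auto simp: schur_complement_zero[OF psd], simp add: schur_complement_def)
  qed simp
  define s where "s l = complex_of_real (sqrt (Re (?k l l l)))" for l
  have s: "s l * s l = ?k l l l" "cnj (s l) = s l" for l
    using psd_kernel_diag[OF psd[of l], of l] by (simp_all add: s_def flip: of_real_mult)
  define f where "f i l = (if l \<le> i then ?k l i l / s l else 0)" for i l
  have f: "summable (\<lambda>l. (cmod (f i l))\<^sup>2)" for i
    by (rule summable_finite[of "{..i}"]) (auto simp: f_def)
  define v where "v i = Abs_ell2 (f i)" for i
  have Rep: "Rep_ell2 (v i) = f i" for i
    using f by (simp add: v_def Abs_ell2_inverse)
  have "cinner (v i) (v j) = k i j" for i j
  proof -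
    \<comment> \<open>The product of the two column entries over the pivot is exactly what the
      \<open>l\<close>-th elimination subtracts, so the inner product telescopes.\<close>
    have tele: "f i l * cnj (f j l) = ?k l i j - ?k (Suc l) i j" if "l < Suc (min i j)" for l
    proof -
      have "f i l * cnj (f j l) = ?k l i l * cnj (?k l j l) / (s l * s l)"
        using that unfolding less_Suc_eq_le min.bounded_iff by (simp add: f_def s(2))
      then show ?thesis
        unfolding s(1) by (simp add: schur_complement_def cnj_k[of l l j])
    qed
    have "cinner (v i) (v j) = (\<Sum>l. f i l * cnj (f j l))"
      by (simp add: cinner_ell2.rep_eq Rep)
    also have "\<dots> = (\<Sum>l<Suc (min i j). f i l * cnj (f j l))"
      by (rule suminf_finite) (auto simp: f_def not_less)
    also have "\<dots> = (\<Sum>l<Suc (min i j). ?k l i j - ?k (Suc l) i j)"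
      by (rule sum.cong[OF refl]) (use tele in auto)
    also have "\<dots> = ?k 0 i j - ?k (Suc (min i j)) i j"
      by (rule sum_lessThan_telescope')
    \<comment> \<open>By this stage index \<open>min i j\<close> itself has been eliminated, which
      clears its row, and by symmetry its column.\<close>
    also have "?k (Suc (min i j)) i j = 0"
    proof (cases "i \<le> j")
      case True
      then show ?thesis
        by (intro zero) simp
    next
      case False
      then have "?k (Suc (min i j)) j i = 0"
        by (intro zero) simp
      then show ?thesis
        using cnj_k[of "Suc (min i j)" i j] by simp
    qed
    finally show ?thesis by simp
  qed
  then show ?thesis
    by (rule that)
qed

section \<open>Isometries between systems with equal Gram matrices\<close>

lemma in_closureI:
  fixes x :: "'a::first_countable_topology"
  assumes "\<And>n. h n \<in> S" "h \<longlonglongrightarrow> x"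
  shows "x \<in> closure S"
  unfolding closure_sequential by (intro exI[of _ h] conjI allI assms)

text \<open>The relation between finite linear combinations with equal coefficients in the two
  systems. As a relation it is available before single-valuedness is known; the latter comes from
  equality of the Gram matrices.\<close>

inductive_set gram_rel ::
  "('i \<Rightarrow> 'a::chilbert_space) \<Rightarrow> ('i \<Rightarrow> 'b::chilbert_space) \<Rightarrow> ('a \<times> 'b) set"
  for f g where
  zero: "(0, 0) \<in> gram_rel f g"
| add: "(x, y) \<in> gram_rel f g \<Longrightarrow> (x + a *\<^sub>C f i, y + a *\<^sub>C g i) \<in> gram_rel f g"

lemma gram_rel_base: "(f i, g i) \<in> gram_rel f g"
  using gram_rel.add[OF gram_rel.zero, of 1 f i g] by simp

lemma gram_rel_add:
  assumes "(x', y') \<in> gram_rel f g" "(x, y) \<in> gram_rel f g"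
  shows "(x + x', y + y') \<in> gram_rel f g"
  using assms(1)
proof (induction rule: gram_rel.induct)
  case (add x' y' a i)
  then show ?case
    using gram_rel.add[of "x + x'" "y + y'" f g a i] by (simp add: add.assoc)
qed (use assms(2) in simp)

lemma gram_rel_scaleC:
  assumes "(x, y) \<in> gram_rel f g"
  shows "(a *\<^sub>C x, a *\<^sub>C y) \<in> gram_rel f g"
  using assms
proof (induction rule: gram_rel.induct)
  case (add x y b i)
  then show ?case
    using gram_rel.add[of "a *\<^sub>C x" "a *\<^sub>C y" f g "a * b" i] by (simp add: scaleC_simps)
qed (simp add: gram_rel.zero)

lemma gram_rel_sym: "(x, y) \<in> gram_rel f g \<Longrightarrow> (y, x) \<in> gram_rel g f"
  by (induction rule: gram_rel.induct) (auto intro: gram_rel.intros)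

lemma gram_rel_converse: "(gram_rel f g)\<inverse> = gram_rel g f"
  by (intro equalityI subrelI) (simp_all only: converse_iff gram_rel_sym)

locale gram_systems =
  fixes f :: "'i \<Rightarrow> 'a::chilbert_space" and g :: "'i \<Rightarrow> 'b::chilbert_space"
  assumes gram: "cinner (f i) (f j) = cinner (g i) (g j)"
begin

definition isom :: "('a \<times> 'b) set" where
  "isom = closure (gram_rel f g)"

lemma isom_base: "(f i, g i) \<in> isom"
  unfolding isom_def by (rule subsetD[OF closure_subset gram_rel_base])

lemma isom_sequence: "p \<in> isom \<Longrightarrow> \<exists>h. (\<forall>n. h n \<in> gram_rel f g) \<and> h \<longlonglongrightarrow> p"
  by (simp add: isom_def closure_sequential)

lemma isom_0: "(0, 0) \<in> isom"
  unfolding isom_def by (rule subsetD[OF closure_subset gram_rel.zero])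

lemma isom_add:
  assumes "(x, y) \<in> isom" "(x', y') \<in> isom"
  shows "(x + x', y + y') \<in> isom"
proof -
  obtain h h' where h: "\<And>n. h n \<in> gram_rel f g" "h \<longlonglongrightarrow> (x, y)"
    "\<And>n. h' n \<in> gram_rel f g" "h' \<longlonglongrightarrow> (x', y')"
    using isom_sequence[OF assms(1)] isom_sequence[OF assms(2)] by (elim exE conjE) blast
  have "h n + h' n \<in> gram_rel f g" for n
    using gram_rel_add[of "fst (h' n)" "snd (h' n)" f g "fst (h n)" "snd (h n)"] h
    by (simp add: plus_prod_def)
  moreover have "(\<lambda>n. h n + h' n) \<longlonglongrightarrow> (x, y) + (x', y')"
    by (intro tendsto_intros h)
  ultimately have "(x, y) + (x', y') \<in> isom"
    unfolding isom_def by (rule in_closureI)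
  then show ?thesis
    by simp
qed

lemma isom_scaleC:
  assumes "(x, y) \<in> isom"
  shows "(a *\<^sub>C x, a *\<^sub>C y) \<in> isom"
proof -
  obtain h where h: "\<And>n. h n \<in> gram_rel f g" "h \<longlonglongrightarrow> (x, y)"
    using isom_sequence[OF assms] by blast
  have "(a *\<^sub>C fst (h n), a *\<^sub>C snd (h n)) \<in> gram_rel f g" for n
    using h(1)[of n] by (intro gram_rel_scaleC) simp
  moreover have "(\<lambda>n. (a *\<^sub>C fst (h n), a *\<^sub>C snd (h n))) \<longlonglongrightarrow> (a *\<^sub>C x, a *\<^sub>C y)"
    using tendsto_fst[OF h(2)] tendsto_snd[OF h(2)] by (intro tendsto_intros) auto
  ultimately show ?thesis
    unfolding isom_def by (rule in_closureI)
qed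

lemma gram_rel_cinner:
  assumes "(x, y) \<in> gram_rel f g" "(x', y') \<in> gram_rel f g"
  shows "cinner x x' = cinner y y'"
proof -
  have *: "cinner x (f j) = cinner y (g j)" for j
    using assms(1) by (induction rule: gram_rel.induct) (auto simp: cinner_simps gram)
  show ?thesis
    using assms(2) by (induction rule: gram_rel.induct) (auto simp: cinner_simps *)
qed

lemma isom_cinner:
  assumes "(x, y) \<in> isom" "(x', y') \<in> isom"
  shows "cinner x x' = cinner y y'"
proof -
  obtain h h' where h: "\<And>n. h n \<in> gram_rel f g" "h \<longlonglongrightarrow> (x, y)"
    "\<And>n. h' n \<in> gram_rel f g" "h' \<longlonglongrightarrow> (x', y')"
    using isom_sequence[OF assms(1)] isom_sequence[OF assms(2)] by (elim exE conjE) blast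
  have "cinner (fst (h n)) (fst (h' n)) = cinner (snd (h n)) (snd (h' n))" for n
    using h by (intro gram_rel_cinner) simp_all
  moreover have "(\<lambda>n. cinner (fst (h n)) (fst (h' n))) \<longlonglongrightarrow> cinner (fst (x, y)) (fst (x', y'))"
    by (intro tendsto_intros h)
  moreover have "(\<lambda>n. cinner (snd (h n)) (snd (h' n))) \<longlonglongrightarrow> cinner (snd (x, y)) (snd (x', y'))"
    by (intro tendsto_intros h)
  ultimately show ?thesis
    using LIMSEQ_unique[of _ "cinner x x'" "cinner y y'"] by simp
qed

lemma isom_norm: "(x, y) \<in> isom \<Longrightarrow> norm y = norm x"
  using isom_cinner[of x y x y] unfolding cinner_self of_real_eq_iff by simp

lemma isom_diff: "(x, y) \<in> isom \<Longrightarrow> (x', y') \<in> isom \<Longrightarrow> (x - x', y - y') \<in> isom"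
  using isom_add[of x y "- x'" "- y'"] isom_scaleC[of x' y' "- 1"] by simp

text \<open>The closed relation preserves distances, so its domain is closed by
  \<open>closed_Domain_lipschitz\<close>.\<close>

lemma Domain_isom: "Domain isom = closure (Domain (gram_rel f g))"
proof
  show "Domain isom \<subseteq> closure (Domain (gram_rel f g))"
  proof
    fix x
    assume "x \<in> Domain isom"
    then obtain y where "(x, y) \<in> isom" by blast
    then obtain h where h: "\<And>n. h n \<in> gram_rel f g" "h \<longlonglongrightarrow> (x, y)"
      using isom_sequence by blast
    have "fst (h n) \<in> Domain (gram_rel f g)" for n
      using h(1)[of n] by (intro DomainI[of _ "snd (h n)"]) simp
    then show "x \<in> closure (Domain (gram_rel f g))"
      using tendsto_fst[OF h(2)] by (intro in_closureI[of "\<lambda>n. fst (h n)"]) simp_all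
  qed
  have "dist y y' \<le> 1 * dist x x'" if "(x, y) \<in> isom" "(x', y') \<in> isom" for x y x' y'
    using isom_norm[OF isom_diff[OF that]] by (simp add: dist_norm)
  moreover have "closed isom"
    unfolding isom_def by (rule closed_closure)
  ultimately have "closed (Domain isom)"
    by (intro closed_Domain_lipschitz)
  moreover have "Domain (gram_rel f g) \<subseteq> Domain isom"
    unfolding isom_def using closure_subset by (rule Domain_mono)
  ultimately show "closure (Domain (gram_rel f g)) \<subseteq> Domain isom"
    by (rule closure_minimal[rotated])
qed

lemma Range_isom: "Range isom = closure (Range (gram_rel f g))"
proof -
  interpret c: gram_systems g f
    by unfold_locales (simp add: gram)
  have "c.isom = isom\<inverse>"
  proof -
    have "(y, x) \<in> closure (R\<inverse>)" if "(x, y) \<in> closure R"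
      for x y and R :: "('c::metric_space \<times> 'd::metric_space) set"
    proof -
      from that obtain h where h: "\<And>n. h n \<in> R" "h \<longlonglongrightarrow> (x, y)"
        by (auto simp: closure_sequential)
      have "(snd (h n), fst (h n)) \<in> R\<inverse>" for n
        using h(1)[of n] by simp
      then show ?thesis
        unfolding closure_sequential using tendsto_Pair[OF tendsto_snd[OF h(2)] tendsto_fst[OF h(2)]]
        by (intro exI[of _ "\<lambda>n. (snd (h n), fst (h n))"]) auto
    qed
    note cl = this
    show ?thesis
    proof (intro equalityI subrelI)
      show "(y, x) \<in> isom\<inverse>" if "(y, x) \<in> c.isom" for y x
        using cl[OF that[unfolded c.isom_def]] by (simp add: gram_rel_converse isom_def)
      show "(y, x) \<in> c.isom" if "(y, x) \<in> isom\<inverse>" for y x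
        using cl[of x y "gram_rel f g"] that by (simp add: gram_rel_converse isom_def c.isom_def)
    qed
  qed
  then have "Range isom = Domain c.isom"
    by simp
  also have "\<dots> = closure (Range (gram_rel f g))"
    unfolding c.Domain_isom gram_rel_converse[of f g, symmetric] Domain_converse ..
  finally show ?thesis .
qed

end

section \<open>Inverse Cayley transforms of unitary operators\<close>

text \<open>The domain is the range of \<open>C - 1\<close>. A vector orthogonal to it is fixed by
  the unitary \<open>C\<close>, hence zero, which gives density. For the adjoint, each of its pairs
  is shown to arise from a pair of \<open>C\<close>.\<close>

lemma self_adjoint_inv_cayley:
  fixes C :: "'a::chilbert_space operator"
  assumes z: "z \<notin> \<real>" and K: "csubspace K" "closed K"
    and C: "linear_operator C" "Domain C = K" "Range C = K"
    and iso: "\<And>g u g' u'. (g, u) \<in> C \<Longrightarrow> (g', u') \<in> C \<Longrightarrow> cinner u u' = cinner g g'"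
    and nofix: "\<And>x. (x, x) \<in> C \<Longrightarrow> x = 0"
  shows "self_adjoint_on K (inv_cayley z C)"
proof -
  let ?T = "inv_cayley z C"
  have CK: "g \<in> K" "u \<in> K" if "(g, u) \<in> C" for g u
    using that C(2,3) by auto
  have dom: "\<exists>u. (g, u) \<in> C" if "g \<in> K" for g
    using that unfolding C(2)[symmetric] by (simp add: Domain_iff)
  have ran: "\<exists>g. (g, u) \<in> C" if "u \<in> K" for u
    using that unfolding C(3)[symmetric] by (simp add: Range_iff)
  have norm_C: "norm u = norm g" if "(g, u) \<in> C" for g u
    using iso[OF that that] unfolding cinner_self of_real_eq_iff by simp
  have lin: "linear_operator ?T"
  proof (rule linear_operatorI)
    show "y = 0" if "(0, y) \<in> ?T" for y
    proof -
      from that obtain g where "(g, g) \<in> C" "y = z *\<^sub>C g - cnj z *\<^sub>C g"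
        by (auto simp: in_inv_cayley)
      moreover from this(1) have "g = 0"
        by (rule nofix)
      ultimately show ?thesis
        by simp
    qed
    show "(0, 0) \<in> ?T"
      unfolding in_inv_cayley using linear_operator_0[OF C(1)] by (intro exI[of _ 0]) simp
    show "(x + x', y + y') \<in> ?T" if "(x, y) \<in> ?T" "(x', y') \<in> ?T" for x y x' y'
    proof -
      from that obtain g u g' u' where *: "(g, u) \<in> C" "(g', u') \<in> C" "x = u - g" "x' = u' - g'"
        "y = z *\<^sub>C u - cnj z *\<^sub>C g" "y' = z *\<^sub>C u' - cnj z *\<^sub>C g'"
        by (auto simp: in_inv_cayley)
      show ?thesis
        unfolding in_inv_cayley
        by (rule exI[of _ "g + g'", OF exI[of _ "u + u'"]])
           (simp add: * linear_operator_add[OF C(1)] scaleC_simps)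
    qed
    show "(a *\<^sub>C x, a *\<^sub>C y) \<in> ?T" if "(x, y) \<in> ?T" for a x y
    proof -
      from that obtain g u where *: "(g, u) \<in> C" "x = u - g" "y = z *\<^sub>C u - cnj z *\<^sub>C g"
        by (auto simp: in_inv_cayley)
      show ?thesis
        unfolding in_inv_cayley
        by (rule exI[of _ "a *\<^sub>C g", OF exI[of _ "a *\<^sub>C u"]])
           (simp add: * linear_operator_scaleC[OF C(1)] scaleC_simps mult.commute)
    qed
  qed
  have TK: "?T \<subseteq> K \<times> K"
    using CK by (auto simp: in_inv_cayley intro!: csubspace_diff csubspace_scaleC K(1))
  have dense: "closure (Domain ?T) = K"
  proof (rule closed_csubspace_eqI)
    show "csubspace (closure (Domain ?T))"
      by (intro csubspace_closure csubspace_Domain lin)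
    show "closure (Domain ?T) \<subseteq> K"
      using TK by (intro closure_minimal K(2)) auto
    fix x
    assume x: "x \<in> K" "x \<in> orth_compl (closure (Domain ?T))"
    obtain y where y: "(y, x) \<in> C"
      using ran[OF x(1)] by blast
    \<comment> \<open>Isometry turns \<open>cinner x u\<close> into \<open>cinner y g\<close>, while
      orthogonality to \<open>u - g\<close> makes it \<open>cinner x g\<close>.\<close>
    have "cinner (y - x) g = 0" if g: "g \<in> K" for g
    proof -
      obtain u where u: "(g, u) \<in> C"
        using dom[OF g] by blast
      then have "(u - g, z *\<^sub>C u - cnj z *\<^sub>C g) \<in> ?T"
        unfolding in_inv_cayley by blast
      then have "u - g \<in> Domain ?T"
        by (rule DomainI)
      then have "u - g \<in> closure (Domain ?T)"
        by (rule subsetD[OF closure_subset])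
      from orth_complD[OF x(2) this] iso[OF y u] show ?thesis
        by (simp add: cinner_simps)
    qed
    from this[of "y - x"] have "y = x"
      using CK[OF y] by (simp add: csubspace_diff[OF K(1)])
    with y have "(x, x) \<in> C"
      by simp
    then show "x = 0"
      by (rule nofix)
  qed (use K in auto)
  have "adjoint_op K K ?T = ?T"
  proof (intro equalityI subrelI)
    fix a b
    assume ab: "(a, b) \<in> ?T"
    then obtain g' u' where *: "(g', u') \<in> C" "a = u' - g'" "b = z *\<^sub>C u' - cnj z *\<^sub>C g'"
      by (auto simp: in_inv_cayley)
    have "cinner w a = cinner x b" if "(x, w) \<in> ?T" for x w
    proof -
      from that obtain g u where gu: "(g, u) \<in> C" "x = u - g" "w = z *\<^sub>C u - cnj z *\<^sub>C g"
        by (auto simp: in_inv_cayley)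
      show ?thesis
        unfolding gu(2,3) *(2,3) using iso[OF gu(1) *(1)] by (simp add: cinner_simps algebra_simps)
    qed
    then show "(a, b) \<in> adjoint_op K K ?T"
      using subsetD[OF TK ab] by (simp add: adjoint_op_def split_beta)
  next
    fix a b
    assume ab: "(a, b) \<in> adjoint_op K K ?T"
    then have K_ab: "a \<in> K" "b \<in> K"
      and adj: "\<And>x w. (x, w) \<in> ?T \<Longrightarrow> cinner w a = cinner x b"
      by (auto simp: adjoint_op_def)
    define c where "c = cnj z - z"
    have c: "c \<noteq> 0"
      using diff_cnj_nonzero[OF z] by (simp add: c_def)
    \<comment> \<open>Up to the factor \<open>c\<close>, these solve \<open>u - g = a\<close> and
      \<open>z u - cnj z g = b\<close>. The adjoint identity then says precisely that
      \<open>C\<close> maps \<open>?g\<close> to \<open>?u\<close>.\<close>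
    let ?u = "cnj z *\<^sub>C a - b" and ?g = "z *\<^sub>C a - b"
    have "?u \<in> K"
      using K_ab by (intro csubspace_diff csubspace_scaleC K(1))
    then obtain p where p: "(p, ?u) \<in> C"
      using ran by blast
    have "cinner g (p - ?g) = 0" if g: "g \<in> K" for g
    proof -
      obtain u where u: "(g, u) \<in> C"
        using dom[OF g] by blast
      then have "(u - g, z *\<^sub>C u - cnj z *\<^sub>C g) \<in> ?T"
        unfolding in_inv_cayley by blast
      from adj[OF this] iso[OF u p] show ?thesis
        by (simp add: cinner_simps algebra_simps)
    qed
    from this[of "p - ?g"] have "p = ?g"
      using CK[OF p] K_ab by (simp add: csubspace_diff[OF K(1)] csubspace_scaleC[OF K(1)])
    then have "(inverse c *\<^sub>C ?g, inverse c *\<^sub>C ?u) \<in> C"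
      using linear_operator_scaleC[OF C(1) p] by simp
    moreover have "inverse c *\<^sub>C ?u - inverse c *\<^sub>C ?g = a"
    proof -
      have "?u - ?g = c *\<^sub>C a"
        by (simp add: c_def scaleC_simps)
      then show ?thesis
        using c by (simp add: scaleC_scaleC flip: scaleC_diff_right)
    qed
    moreover have "z *\<^sub>C (inverse c *\<^sub>C ?u) - cnj z *\<^sub>C (inverse c *\<^sub>C ?g) = b"
    proof -
      have "z *\<^sub>C (inverse c *\<^sub>C ?u) - cnj z *\<^sub>C (inverse c *\<^sub>C ?g) =
          inverse c *\<^sub>C (z *\<^sub>C ?u - cnj z *\<^sub>C ?g)"
        by (simp add: scaleC_diff_right scaleC_scaleC mult_ac)
      also have "z *\<^sub>C ?u - cnj z *\<^sub>C ?g = c *\<^sub>C b"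
        by (simp add: c_def scaleC_simps mult.commute)
      finally show ?thesis
        using c by (simp add: scaleC_scaleC)
    qed
    ultimately show "(a, b) \<in> ?T"
      unfolding in_inv_cayley by metis
  qed
  with lin TK dense show ?thesis
    by (simp add: self_adjoint_on_def)
qed

section \<open>Means over circles\<close>

text \<open>The character of integer frequency \<open>n\<close>, parametrized over the unit interval
  to match \<open>circlepath\<close>; negative frequencies supply the conjugates.\<close>

definition unit_circle :: "int \<Rightarrow> real \<Rightarrow> complex" where
  "unit_circle n t = cis (2 * pi * of_int n * t)"

lemma unit_circle_mult: "unit_circle m t * unit_circle n t = unit_circle (m + n) t"
  by (simp add: unit_circle_def cis_mult algebra_simps)

lemma unit_circle_0 [simp]: "unit_circle 0 t = 1"
  by (simp add: unit_circle_def)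

lemma cnj_unit_circle: "cnj (unit_circle n t) = unit_circle (- n) t"
  by (simp add: unit_circle_def cis_cnj)

lemma norm_unit_circle [simp]: "cmod (unit_circle n t) = 1"
  by (simp add: unit_circle_def)

lemma unit_circle_power: "unit_circle 1 t ^ n = unit_circle (int n) t"
proof (induction n)
  case (Suc n)
  have "unit_circle 1 t ^ Suc n = unit_circle 1 t * unit_circle (int n) t"
    by (simp add: Suc)
  also have "\<dots> = unit_circle (int (Suc n)) t"
    by (simp only: unit_circle_mult of_nat_Suc)
  finally show ?case .
qed simp

definition taylor_coeff :: "(complex \<Rightarrow> complex) \<Rightarrow> nat \<Rightarrow> complex" where
  "taylor_coeff f n = (deriv ^^ n) f 0 / fact n"

text \<open>Cauchy's formula for the \<open>n\<close>-th derivative on the circle of radius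
  \<open>r\<close>; the factor \<open>r ^ n / (2 * pi * \<i>)\<close> turns the contour integral
  into a mean.\<close>

lemma circle_mean:
  assumes f: "f holomorphic_on ball 0 1" and r: "0 < r" "r < 1"
  shows "((\<lambda>t. f (of_real r * unit_circle 1 t) * unit_circle (- int n) t) has_integral
    of_real r ^ n * taylor_coeff f n) {0..1}"
proof -
  let ?e = "\<lambda>t. of_real r * unit_circle 1 t"
  have e: "circlepath 0 r t = ?e t" for t
    by (simp add: circlepath unit_circle_def cis_conv_exp mult_ac)
  have sub: "cball 0 r \<subseteq> ball (0 :: complex) 1" "ball 0 r \<subseteq> ball (0 :: complex) 1"
    using r by auto
  have "((\<lambda>u. f u / (u - 0) ^ Suc n) has_contour_integral
      (2 * pi * \<i>) / fact n * (deriv ^^ n) f 0) (circlepath 0 r)"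
    using r sub holomorphic_on_subset[OF f]
    by (intro Cauchy_has_contour_integral_higher_derivative_circlepath
        holomorphic_on_imp_continuous_on) auto
  then have int: "((\<lambda>t. f (?e t) / ?e t ^ Suc n * (2 * pi * \<i> * ?e t)) has_integral
      (2 * pi * \<i>) / fact n * (deriv ^^ n) f 0) {0..1}"
    unfolding has_contour_integral_def
    by (rule has_integral_eq[rotated])
       (simp add: e vector_derivative_circlepath01, simp add: unit_circle_def cis_conv_exp mult_ac)
  have const: "of_real r ^ n / (2 * pi * \<i>) * ((2 * pi * \<i>) / fact n * (deriv ^^ n) f 0) =
      of_real r ^ n * taylor_coeff f n"
    unfolding taylor_coeff_def times_divide_times_eq by (simp add: mult_ac)
  have "((\<lambda>t. of_real r ^ n / (2 * pi * \<i>) * (f (?e t) / ?e t ^ Suc n * (2 * pi * \<i> * ?e t)))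
      has_integral of_real r ^ n * taylor_coeff f n) {0..1}"
    using has_integral_mult_right[OF int, of "of_real r ^ n / (2 * pi * \<i>)"] unfolding const .
  then show ?thesis
  proof (rule has_integral_eq[rotated])
    fix t
    have "unit_circle (- int n) t * unit_circle 1 t ^ n = 1"
      by (simp add: unit_circle_power unit_circle_mult)
    then have "unit_circle (- int n) t = inverse (unit_circle 1 t ^ n)"
      using inverse_unique[of "unit_circle 1 t ^ n" "unit_circle (- int n) t"]
      by (simp add: mult.commute)
    moreover have "unit_circle 1 t \<noteq> 0"
      using norm_unit_circle[of 1 t] by (metis norm_zero zero_neq_one)
    ultimately show "of_real r ^ n / (2 * pi * \<i>) *
        (f (?e t) / ?e t ^ Suc n * (2 * pi * \<i> * ?e t)) =
        f (of_real r * unit_circle 1 t) * unit_circle (- int n) t"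
      using r by (simp add: field_simps power_mult_distrib)
  qed
qed

text \<open>Up to a power of \<open>r\<close>, this is the mean of \<open>f u * u ^ p\<close>, that
  is, its value at 0.\<close>

lemma circle_mean_zero:
  assumes f: "f holomorphic_on ball 0 1" and r: "0 < r" "r < 1" and p: "p \<noteq> 0"
  shows "((\<lambda>t. f (of_real r * unit_circle 1 t) * unit_circle (int p) t) has_integral 0) {0..1}"
proof -
  have "((\<lambda>t. (f (of_real r * unit_circle 1 t) * (of_real r * unit_circle 1 t) ^ p) *
      unit_circle (- int 0) t) has_integral
      of_real r ^ 0 * taylor_coeff (\<lambda>u. f u * u ^ p) 0) {0..1}"
    by (intro circle_mean[where f = "\<lambda>u. f u * u ^ p"] holomorphic_intros f r)
  then have "((\<lambda>t. f (of_real r * unit_circle 1 t) * (of_real r * unit_circle 1 t) ^ p)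
      has_integral 0) {0..1}"
    using p by (simp add: taylor_coeff_def zero_power)
  from has_integral_mult_right[OF this, of "inverse (of_real r ^ p)"] show ?thesis
    unfolding mult_zero_right
    by (rule has_integral_eq[rotated]) (use r in \<open>simp add: power_mult_distrib unit_circle_power\<close>)
qed

lemma taylor_coeff_const: "taylor_coeff (\<lambda>_. c) n = (if n = 0 then c else 0)"
  by (simp add: taylor_coeff_def)

section \<open>Toeplitz kernels\<close>

lemma clinear_sum: "clinear f \<Longrightarrow> f (\<Sum>i\<in>S. x i) = (\<Sum>i\<in>S. f (x i))"
  by (induction S rule: infinite_finite_induct) (auto simp: clinear_0 clinear_add)

text \<open>
  The intended instance is \<open>\<Phi> w = (1 - w W(w))\<inverse>\<close> for a contractive analytic function \<open>W\<close> on the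
  disk, with \<open>B = W(0)\<close>.
\<close>

locale caratheodory =
  fixes \<Phi> :: "complex \<Rightarrow> 'a::chilbert_space \<Rightarrow> 'a" and B :: "'a \<Rightarrow> 'a"
  assumes clinear_Phi: "cmod w < 1 \<Longrightarrow> clinear (\<Phi> w)"
    and norm_Phi: "cmod w < 1 \<Longrightarrow> norm (\<Phi> w x) \<le> norm x / (1 - cmod w)"
    and holomorphic_Phi: "(\<lambda>w. cinner (\<Phi> w x) y) holomorphic_on ball 0 1"
    and Phi_0: "\<Phi> 0 x = x"
    and positive_Phi: "cmod w < 1 \<Longrightarrow> (norm x)\<^sup>2 \<le> 2 * Re (cinner (\<Phi> w x) x)"
    and clinear_B: "clinear B"
    and norm_B: "norm (B x) \<le> norm x"
    and deriv_Phi: "deriv (\<lambda>w. cinner (\<Phi> w x) y) 0 = cinner (B x) y"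
begin

definition coeff :: "nat \<Rightarrow> 'a \<Rightarrow> 'a \<Rightarrow> complex" where
  "coeff n x y = taylor_coeff (\<lambda>w. cinner (\<Phi> w x) y) n"

text \<open>The value that the inner product of \<open>U\<^sup>m V x\<close> and
  \<open>U\<^sup>n V y\<close> is to have in the dilation. For \<open>n \<le> m\<close> it is a
  compressed power of \<open>U\<close>; otherwise Hermitian symmetry dictates it.\<close>

definition toeplitz :: "int \<Rightarrow> 'a \<Rightarrow> int \<Rightarrow> 'a \<Rightarrow> complex" where
  "toeplitz m x n y = (if n \<le> m then coeff (nat (m - n)) x y else cnj (coeff (nat (n - m)) y x))"

lemma coeff_0: "coeff 0 x y = cinner x y"
  by (simp add: coeff_def taylor_coeff_def Phi_0)

lemma coeff_1: "coeff 1 x y = cinner (B x) y"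
  by (simp add: coeff_def taylor_coeff_def deriv_Phi)

lemma toeplitz_cnj: "toeplitz n y m x = cnj (toeplitz m x n y)"
  by (cases "m = n") (auto simp: toeplitz_def coeff_0 intro: cinner_commute)

text \<open>The damped form is the mean of
  \<open>2 * Re (cinner (\<Phi> w X) X) - (norm X)\<^sup>2\<close> over the circle of radius
  \<open>r\<close>, where \<open>X\<close> is the trigonometric polynomial with coefficients
  \<open>c i *\<^sub>C x i\<close>. The integrand is non-negative by
  \<open>positive_Phi\<close>.\<close>

lemma toeplitz_quadratic_form_nonneg:
  fixes m :: "'i \<Rightarrow> int" and x :: "'i \<Rightarrow> 'a"
  assumes r: "0 < r" "r < 1"
  shows "0 \<le> Re (\<Sum>i\<in>S. \<Sum>j\<in>S. c i * cnj (c j) *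
    (of_real r ^ nat \<bar>m i - m j\<bar> * toeplitz (m i) (x i) (m j) (x j)))"
proof -
  define X where "X t = (\<Sum>i\<in>S. (c i * unit_circle (- m i) t) *\<^sub>C x i)" for t
  define \<phi> where "\<phi> i j w = cinner (\<Phi> w (x i)) (x j)" for i j w
  let ?e = "\<lambda>t. of_real r * unit_circle 1 t"
  \<comment> \<open>\<open>a\<close> holds the means coming from \<Phi> and \<open>b\<close> those
    of the identity. Adding \<open>a\<close> to its adjoint counts equal indices twice, and
    subtracting \<open>b\<close> corrects this.\<close>
  define a where "a i j = (if m j \<le> m i then of_real r ^ nat (m i - m j) *
    coeff (nat (m i - m j)) (x i) (x j) else 0)" for i j
  define b where "b i j = (if m i = m j then cinner (x i) (x j) else 0)" for i j
  have ab: "a i j + cnj (a j i) - b i j =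
      of_real r ^ nat \<bar>m i - m j\<bar> * toeplitz (m i) (x i) (m j) (x j)" for i j
  proof (cases "m i" "m j" rule: linorder_cases)
    case equal
    then show ?thesis
      using cinner_commute[of "x i" "x j"] by (simp add: a_def b_def toeplitz_def coeff_0)
  qed (auto simp: a_def b_def toeplitz_def)
  have u: "unit_circle (m j - m i) t = unit_circle (- m i) t * cnj (unit_circle (- m j) t)" for i j t
    by (simp add: cnj_unit_circle unit_circle_mult)
  have e: "cmod (?e t) < 1" for t
    using r by (simp add: norm_mult)
  have "((\<lambda>t. \<phi> i j (?e t) * unit_circle (m j - m i) t) has_integral a i j) {0..1}" for i j
  proof (cases "m j \<le> m i")
    case True
    then have "unit_circle (m j - m i) = unit_circle (- int (nat (m i - m j)))"
      by simp
    with True show ?thesis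
      using circle_mean[OF holomorphic_Phi r, of "x i" "x j" "nat (m i - m j)"]
      by (simp add: a_def \<phi>_def coeff_def)
  next
    case False
    then have "unit_circle (m j - m i) = unit_circle (int (nat (m j - m i)))"
      by simp
    with False show ?thesis
      using circle_mean_zero[OF holomorphic_Phi r, of "nat (m j - m i)" "x i" "x j"]
      by (simp add: a_def \<phi>_def)
  qed
  then have "((\<lambda>t. \<Sum>i\<in>S. \<Sum>j\<in>S. c i * cnj (c j) * (\<phi> i j (?e t) * unit_circle (m j - m i) t))
      has_integral (\<Sum>i\<in>S. \<Sum>j\<in>S. c i * cnj (c j) * a i j)) {0..1}"
    by (cases "finite S") (auto intro!: has_integral_sum has_integral_mult_right)
  moreover have "(\<Sum>i\<in>S. \<Sum>j\<in>S. c i * cnj (c j) * (\<phi> i j (?e t) * unit_circle (m j - m i) t)) =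
      cinner (\<Phi> (?e t) (X t)) (X t)" for t
    unfolding X_def clinear_sum[OF clinear_Phi[OF e]] cinner_sum_left cinner_sum_right
      clinear_scaleC[OF clinear_Phi[OF e]] cinner_scaleC_left cinner_scaleC_right u \<phi>_def
    by (subst sum.swap) (simp add: sum_distrib_left mult_ac)
  ultimately have int1: "((\<lambda>t. cinner (\<Phi> (?e t) (X t)) (X t)) has_integral
      (\<Sum>i\<in>S. \<Sum>j\<in>S. c i * cnj (c j) * a i j)) {0..1}"
    by simp
  have "((\<lambda>t. cinner (x i) (x j) * unit_circle (m j - m i) t) has_integral b i j) {0..1}" for i j
  proof (cases "m j \<le> m i")
    case True
    then have "unit_circle (m j - m i) = unit_circle (- int (nat (m i - m j)))"
      by simp
    with True show ?thesis
      using circle_mean[OF holomorphic_on_const r, of "cinner (x i) (x j)" "nat (m i - m j)"]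
      by (simp add: b_def taylor_coeff_const split: if_splits)
  next
    case False
    then have "unit_circle (m j - m i) = unit_circle (int (nat (m j - m i)))"
      by simp
    with False show ?thesis
      using circle_mean_zero[OF holomorphic_on_const r, of "nat (m j - m i)" "cinner (x i) (x j)"]
      by (simp add: b_def)
  qed
  then have "((\<lambda>t. \<Sum>i\<in>S. \<Sum>j\<in>S. c i * cnj (c j) * (cinner (x i) (x j) * unit_circle (m j - m i) t))
      has_integral (\<Sum>i\<in>S. \<Sum>j\<in>S. c i * cnj (c j) * b i j)) {0..1}"
    by (cases "finite S") (auto intro!: has_integral_sum has_integral_mult_right)
  moreover have "(\<Sum>i\<in>S. \<Sum>j\<in>S. c i * cnj (c j) *
      (cinner (x i) (x j) * unit_circle (m j - m i) t)) = cinner (X t) (X t)" for t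
    unfolding X_def cinner_sum_left cinner_sum_right cinner_scaleC_left cinner_scaleC_right u
    by (subst sum.swap) (simp add: sum_distrib_left mult_ac)
  ultimately have int2: "((\<lambda>t. cinner (X t) (X t)) has_integral
      (\<Sum>i\<in>S. \<Sum>j\<in>S. c i * cnj (c j) * b i j)) {0..1}"
    by simp
  let ?A = "\<Sum>i\<in>S. \<Sum>j\<in>S. c i * cnj (c j) * a i j" and ?B = "\<Sum>i\<in>S. \<Sum>j\<in>S. c i * cnj (c j) * b i j"
  have "((\<lambda>t. 2 * cinner (\<Phi> (?e t) (X t)) (X t) - cinner (X t) (X t)) has_integral 2 * ?A - ?B) {0..1}"
    by (intro has_integral_diff has_integral_mult_right int1 int2)
  from has_integral_linear[OF this bounded_linear_Re]
  have "((\<lambda>t. 2 * Re (cinner (\<Phi> (?e t) (X t)) (X t)) - (norm (X t))\<^sup>2) has_integral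
      Re (2 * ?A - ?B)) {0..1}"
    by (simp add: o_def cinner_self)
  then have "0 \<le> Re (2 * ?A - ?B)"
    by (rule has_integral_nonneg) (use positive_Phi[OF e] in simp)
  also have "Re (2 * ?A - ?B) = Re (?A + cnj ?A - ?B)"
  proof -
    have "Re (2 * p - q) = Re (p + cnj p - q)" for p q
      by simp
    then show ?thesis .
  qed
  also have "cnj ?A = (\<Sum>i\<in>S. \<Sum>j\<in>S. c i * cnj (c j) * cnj (a j i))"
    by (subst sum.swap) (simp add: mult_ac)
  also have "?A + \<dots> - ?B = (\<Sum>i\<in>S. \<Sum>j\<in>S. c i * cnj (c j) * (a i j + cnj (a j i) - b i j))"
    by (simp add: sum.distrib sum_subtractf algebra_simps)
  finally show ?thesis
    by (simp only: ab)
qed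

text \<open>For a finite index set the damped form is a polynomial in \<open>r\<close>, so
  non-negativity passes to \<open>r = 1\<close> although \<Phi> is controlled only inside the
  disk.\<close>

lemma psd_kernel_toeplitz:
  fixes m :: "'i \<Rightarrow> int" and x :: "'i \<Rightarrow> 'a"
  shows "psd_kernel (\<lambda>i j. toeplitz (m i) (x i) (m j) (x j))"
  unfolding psd_kernel_def
proof (intro conjI allI impI toeplitz_cnj)
  fix S :: "'i set" and c :: "'i \<Rightarrow> complex"
  define q where "q r = Re (\<Sum>i\<in>S. \<Sum>j\<in>S. c i * cnj (c j) *
    (of_real r ^ nat \<bar>m i - m j\<bar> * toeplitz (m i) (x i) (m j) (x j)))" for r :: real
  have "((\<lambda>r. q r) \<longlongrightarrow> q 1) (at_left 1)"
    unfolding q_def by (intro tendsto_intros)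
  moreover have "\<forall>\<^sub>F r in at_left 1. 0 \<le> q r"
  proof -
    have "\<forall>\<^sub>F r in at_left 1. (0::real) < r \<and> r < 1"
      using eventually_at_left_real[of 0 1] by (auto elim: eventually_mono)
    then show ?thesis
      by eventually_elim (use toeplitz_quadratic_form_nonneg in \<open>auto simp: q_def\<close>)
  qed
  ultimately have "0 \<le> q 1"
    by (rule tendsto_lowerbound) simp
  then show "0 \<le> Re (\<Sum>i\<in>S. \<Sum>j\<in>S. c i * cnj (c j) * toeplitz (m i) (x i) (m j) (x j))"
    by (simp add: q_def)
qed

end

section \<open>The unitary dilation\<close>

lemma isometric_neumann_bound:
  assumes "norm u = norm (g :: 'a::chilbert_space)" "cmod w < 1"
  shows "norm g \<le> norm (g - w *\<^sub>C u) / (1 - cmod w)"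
proof -
  have "norm g - cmod w * norm g \<le> norm (g - w *\<^sub>C u)"
    using norm_triangle_ineq2[of g "w *\<^sub>C u"] assms(1) by simp
  then show ?thesis
    using assms(2) by (simp add: pos_le_divide_eq algebra_simps)
qed

text \<open>The equation is solved for the total extension of \<open>C\<close>; the solution lies in
  \<open>K\<close> because both \<open>v\<close> and the values of the extension do.\<close>

lemma isometric_neumann:
  fixes C :: "'a::chilbert_space operator"
  assumes K: "csubspace K" "closed K" and C: "linear_operator C" "Domain C = K" "Range C \<subseteq> K"
    and iso: "\<And>g u. (g, u) \<in> C \<Longrightarrow> norm u = norm g" and w: "cmod w < 1" and v: "v \<in> K"
  shows "\<exists>g u. (g, u) \<in> C \<and> g - w *\<^sub>C u = v"
proof -
  obtain U where "clinear U" "\<And>g. norm (U g) \<le> norm g" and UC: "\<And>g. (orth_proj K g, U g) \<in> C"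
    using isometric_extension[OF K C(1,2) iso] by metis
  then obtain y where y: "y - w *\<^sub>C U y = v"
    using neumann[OF _ _ w, of U v] by blast
  have "U y \<in> K"
    using UC[of y] C(3) by auto
  then have "v + w *\<^sub>C U y \<in> K"
    using v by (intro csubspace_add csubspace_scaleC K(1))
  also have "v + w *\<^sub>C U y = y"
    using y by (simp add: diff_eq_eq)
  finally have "(y, U y) \<in> C"
    using UC[of y] by (simp add: orth_proj_id[OF K(1)])
  with y show ?thesis by blast
qed

lemma dense_sequence:
  obtains d :: "nat \<Rightarrow> 'a::chilbert_space" where "closure (range d) = UNIV"
proof -
  obtain D :: "'a set" where D: "countable D" "\<And>x e. e > 0 \<Longrightarrow> \<exists>y\<in>D. dist y x < e"
    using separable by blast
  have "D \<noteq> {}"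
    using D(2)[of 1] by auto
  then have "range (from_nat_into D) = D"
    by (rule range_from_nat_into[OF _ D(1)])
  moreover have "closure D = UNIV"
    using D(2) by (auto simp: closure_approachable)
  ultimately show ?thesis
    using that by metis
qed

lemma gram_rel_orth:
  assumes "(x, y) \<in> gram_rel f g" "\<And>i. cinner h (f i) = 0"
  shows "cinner h x = 0"
  using assms(1) by (induction rule: gram_rel.induct) (auto simp: cinner_simps assms(2))

context caratheodory
begin

text \<open>The clause on fixed vectors expresses minimality: the shifts of the range of
  \<open>V\<close> span \<open>K\<close>. The clause on \<open>B\<close> is the first-order part of
  the last clause, recorded separately because the last one says nothing about \<open>u\<close> when
  \<open>w = 0\<close>.\<close>

theorem unitary_dilation:
  "\<exists>(K :: ell2 set) (V :: 'a \<Rightarrow> ell2) C. closed K \<and> csubspace K \<and>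
    linear_isometry V \<and> range V \<subseteq> K \<and> linear_operator C \<and> Domain C = K \<and> Range C = K \<and>
    (\<forall>g u g' u'. (g, u) \<in> C \<longrightarrow> (g', u') \<in> C \<longrightarrow> cinner u u' = cinner g g') \<and>
    (\<forall>h. (h, h) \<in> C \<longrightarrow> (\<forall>x. cinner h (V x) = 0) \<longrightarrow> h = 0) \<and>
    (\<forall>x u. (V x, u) \<in> C \<longrightarrow> (\<forall>y. cinner u (V y) = cinner (B x) y)) \<and>
    (\<forall>w x g u. cmod w < 1 \<longrightarrow> (g, u) \<in> C \<longrightarrow> g - w *\<^sub>C u = V x \<longrightarrow>
      (\<forall>y. cinner g (V y) = cinner (\<Phi> w x) y))"
proof -
  obtain d :: "nat \<Rightarrow> 'a" where d: "closure (range d) = UNIV"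
    by (rule dense_sequence)
  \<comment> \<open>Numbers the pairs of a shift exponent and a position in the dense sequence, as
    the factorization takes natural indices.\<close>
  define e :: "nat \<Rightarrow> int \<times> nat" where "e = from_nat"
  obtain v :: "nat \<Rightarrow> ell2" where v: "\<And>i j. cinner (v i) (v j) =
      toeplitz (fst (e i)) (d (snd (e i))) (fst (e j)) (d (snd (e j)))"
    by (rule kolmogorov_ell2[OF psd_kernel_toeplitz[of "\<lambda>i. fst (e i)" "\<lambda>i. d (snd (e i))"]]) blast
  define vec where "vec m i = v (to_nat (m :: int, i :: nat))" for m i
  have vec: "cinner (vec m i) (vec n j) = toeplitz m (d i) n (d j)" for m i n j
    by (simp add: vec_def v e_def)
  have vec': "cinner (vec (int m) i) (vec 0 j) = coeff m (d i) (d j)" for m i j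
    by (simp add: vec toeplitz_def)
  have vec_norm: "norm (vec m i) = norm (d i)" for m i
  proof -
    have "cinner (vec m i) (vec m i) = cinner (d i) (d i)"
      by (simp add: vec toeplitz_def coeff_0)
    then show ?thesis
      unfolding cinner_self of_real_eq_iff by simp
  qed

  \<comment> \<open>The same family before and after raising the exponent by 1. The kernel depends
    on exponents only through their difference, so the Gram matrices agree.\<close>
  define p q where "p = (\<lambda>(m, i). vec m i)" and "q = (\<lambda>(m, i). vec (m + 1) i)"
  have p: "p (m, i) = vec m i" and q: "q (m, i) = vec (m + 1) i" for m i
    by (simp_all add: p_def q_def)
  interpret U: gram_systems p q
    by unfold_locales (auto simp: p_def q_def vec toeplitz_def)
  interpret I: gram_systems d "vec 0"
    by unfold_locales (simp add: vec toeplitz_def coeff_0)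

  let ?L = "Domain (gram_rel p q)"
  define C where "C = U.isom"
  have C: "linear_operator C"
    unfolding C_def
    by (rule linear_operatorI) (auto dest: U.isom_norm intro: U.isom_0 U.isom_add U.isom_scaleC)
  have Cvec: "(vec m i, vec (m + 1) i) \<in> C" for m i
    using U.isom_base[of "(m, i)"] by (simp add: C_def p q)
  \<comment> \<open>Exponents run over all integers, so the span is invariant under the shift in
    both directions; this makes the isometry unitary.\<close>
  have shift: "y \<in> Domain (gram_rel p q)" if "(x, y) \<in> gram_rel p q" for x y
    using that
  proof (induction rule: gram_rel.induct)
    case zero
    show ?case
      by (rule DomainI[OF gram_rel.zero])
  next
    case (add x y a i)
    obtain m j where i: "i = (m, j)"
      by (cases i)
    obtain y' where "(y, y') \<in> gram_rel p q"
      using add.IH by blast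
    from gram_rel.add[OF this, of a "(m + 1, j)"] show ?case
      by (simp add: i p q Domain_iff) blast
  qed
  have shift': "x \<in> Range (gram_rel p q)" if "(x, y) \<in> gram_rel p q" for x y
    using that
  proof (induction rule: gram_rel.induct)
    case zero
    show ?case
      by (rule RangeI[OF gram_rel.zero])
  next
    case (add x y a i)
    obtain m j where i: "i = (m, j)"
      by (cases i)
    obtain x' where "(x', x) \<in> gram_rel p q"
      using add.IH by blast
    from gram_rel.add[OF this, of a "(m - 1, j)"] show ?case
      by (simp add: i p q Range_iff) blast
  qed
  have "Range (gram_rel p q) = ?L"
    using shift shift' by (intro equalityI subsetI) (auto elim!: RangeE DomainE)
  define K where "K = closure ?L"
  have DC: "Domain C = K" and RC: "Range C = K"
    unfolding C_def K_def U.Domain_isom U.Range_isom \<open>Range (gram_rel p q) = ?L\<close> by simp_all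
  have K: "closed K" "csubspace K"
    using csubspace_Domain[OF C] by (simp_all add: K_def flip: DC) (simp add: DC K_def)
  have isoC: "cinner u u' = cinner g g'" if "(g, u) \<in> C" "(g', u') \<in> C" for g u g' u'
    using U.isom_cinner[of g u g' u'] that by (simp add: C_def)
  have normC: "norm u = norm g" if "(g, u) \<in> C" for g u
    using U.isom_norm[of g u] that by (simp add: C_def)

  define V where "V = graph_fun I.isom"
  have "Domain I.isom = UNIV"
  proof -
    have "range d \<subseteq> Domain (gram_rel d (vec 0))"
      by (rule image_subsetI) (rule DomainI[OF gram_rel_base])
    then have "closure (range d) \<subseteq> Domain I.isom"
      unfolding I.Domain_isom by (rule closure_mono)
    then show ?thesis
      unfolding d by (rule top.extremum_uniqueI)
  qed
  have V_eq: "V x = y" if "(x, y) \<in> I.isom" for x y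
    unfolding V_def graph_fun_def
  proof (rule the_equality)
    show "(x, y) \<in> I.isom"
      by (rule that)
    fix y'
    assume "(x, y') \<in> I.isom"
    from I.isom_norm[OF I.isom_diff[OF this that]] show "y' = y"
      by simp
  qed
  have V_in: "(x, V x) \<in> I.isom" for x
  proof -
    have "x \<in> Domain I.isom"
      using \<open>Domain I.isom = UNIV\<close> by simp
    then obtain y where "(x, y) \<in> I.isom"
      by (rule DomainE)
    then show ?thesis
      using V_eq by simp
  qed
  have Vd: "V (d i) = vec 0 i" for i
    by (rule V_eq[OF I.isom_base])
  have V: "linear_isometry V"
    unfolding linear_isometry_def
    by (intro conjI allI V_eq I.isom_add I.isom_scaleC V_in I.isom_cinner[OF V_in V_in, symmetric])
  note V_clinear = linear_isometry_clinear[OF V]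
  have VK: "range V \<subseteq> K"
  proof -
    have "y \<in> ?L" if "(x, y) \<in> gram_rel d (vec 0)" for x y
      using that
    proof (induction rule: gram_rel.induct)
      case zero
      show ?case
        by (rule DomainI[OF gram_rel.zero])
    next
      case (add x y a i)
      obtain y' where "(y, y') \<in> gram_rel p q"
        using add.IH by blast
      from gram_rel.add[OF this, of a "(0, i)"] show ?case
        by (simp add: p q Domain_iff) blast
    qed
    then have "Range (gram_rel d (vec 0)) \<subseteq> ?L"
      by (auto elim!: RangeE)
    then have "Range I.isom \<subseteq> K"
      unfolding I.Range_isom K_def by (rule closure_mono)
    then show ?thesis
      using V_in by blast
  qed
  have approx: "\<exists>f i. f \<longlonglongrightarrow> x \<and> (\<forall>n. f n = d (i n))" for x
  proof -
    have "x \<in> closure (range d)"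
      using d by simp
    then obtain f where f: "\<forall>n. f n \<in> range d" "f \<longlonglongrightarrow> x"
      unfolding closure_sequential by blast
    then have "\<forall>n. \<exists>i. f n = d i"
      by blast
    then show ?thesis
      using f(2) by metis
  qed
  have contV: "continuous_on UNIV V"
    by (intro linear_continuous_on clinear_bounded_linear[OF V_clinear, of 1])
       (simp add: linear_isometry_norm[OF V])
  have dense: "P y" if "closed {y. P y}" "\<And>j. P (d j)" for P :: "'a \<Rightarrow> bool" and y
    using closure_minimal[of "range d" "{y. P y}"] that d by auto

  \<comment> \<open>For a fixed vector \<open>h\<close> the inner product with
    \<open>vec m i\<close> is the same for every \<open>m\<close>. Orthogonality at exponent 0
    therefore spreads upwards and downwards.\<close>
  have minimal: "h = 0" if h: "(h, h) \<in> C" and orth: "\<And>x. cinner h (V x) = 0" for h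
  proof -
    have "cinner h (vec m i) = 0" for m i
    proof (induction m rule: int_induct[of _ 0])
      case base
      show ?case
        using orth[of "d i"] by (simp add: Vd)
    next
      case (step1 m)
      then show ?case
        using isoC[OF h Cvec[of m i]] by simp
    next
      case (step2 m)
      then show ?case
        using isoC[OF h Cvec[of "m - 1" i]] by simp
    qed
    then have *: "cinner h (p i) = 0" for i
      by (cases i) (simp add: p)
    have "h \<in> orth_compl ?L"
      unfolding orth_compl_def by (auto elim!: DomainE intro: gram_rel_orth[OF _ *])
    then have "h \<in> orth_compl K"
      unfolding K_def by (rule orth_compl_closure)
    moreover have "h \<in> K"
      using h by (auto simp flip: DC)
    ultimately have "cinner h h = 0"
      by (rule orth_complD)
    then show ?thesis by simp
  qed

  \<comment> \<open>On the dense sequence this is \<open>coeff_1\<close>; both arguments are then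
    extended by continuity.\<close>
  have first: "cinner u (V y) = cinner (B x) y" if u: "(V x, u) \<in> C" for x y u
  proof (rule dense[of "\<lambda>y. cinner u (V y) = cinner (B x) y"])
    show "closed {y. cinner u (V y) = cinner (B x) y}"
      by (intro closed_Collect_eq continuous_intros contV)
    fix j
    obtain f i where f: "f \<longlonglongrightarrow> x" and i: "\<And>n. f n = d (i n)"
      using approx by blast
    have "norm (vec 1 (i n) - u) = norm (f n - x)" for n
      using normC[OF linear_operator_diff[OF C Cvec[of 0 "i n"] u]]
      by (simp add: i linear_isometry_norm[OF V] flip: Vd clinear_diff[OF V_clinear])
    then have "(\<lambda>n. vec 1 (i n)) \<longlonglongrightarrow> u"
      using f by (simp add: tendsto_iff dist_norm)
    then have "(\<lambda>n. cinner (vec 1 (i n)) (V (d j))) \<longlonglongrightarrow> cinner u (V (d j))"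
      by (intro tendsto_intros)
    moreover have "(\<lambda>n. cinner (B (f n)) (d j)) \<longlonglongrightarrow> cinner (B x) (d j)"
      using norm_B by (intro tendsto_intros f
          bounded_linear.tendsto[OF clinear_bounded_linear[OF clinear_B, of 1]]) auto
    moreover have "cinner (vec 1 (i n)) (V (d j)) = cinner (B (f n)) (d j)" for n
      using vec'[of 1 "i n" j] by (simp add: Vd i coeff_1[unfolded One_nat_def])
    ultimately show "cinner u (V (d j)) = cinner (B x) (d j)"
      using LIMSEQ_unique by simp
  qed

  have resolvent_d: "cinner g (V (d j)) = cinner (\<Phi> w (d i)) (d j)"
    if w: "cmod w < 1" and gu: "(g, u) \<in> C" "g - w *\<^sub>C u = V (d i)" for w g u i j
  proof -
    \<comment> \<open>Partial sums of the Neumann series for \<open>g\<close>, with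
      \<open>s'\<close> the image of \<open>s\<close> under \<open>C\<close>. They solve the
      equation up to the last power of \<open>w\<close>, so they converge to \<open>g\<close>, while
      their inner products are Taylor sums of \<Phi>.\<close>
    define s where "s N = (\<Sum>m<N. w ^ m *\<^sub>C vec (int m) i)" for N
    define s' where "s' N = (\<Sum>m<N. w ^ m *\<^sub>C vec (int m + 1) i)" for N
    have sC: "(s N, s' N) \<in> C" for N
    proof (induction N)
      case 0
      then show ?case
        using linear_operator_0[OF C] by (simp add: s_def s'_def)
    next
      case (Suc N)
      then show ?case
        using linear_operator_add[OF C Suc linear_operator_scaleC[OF C Cvec[of "int N" i], of "w ^ N"]]
        by (simp add: s_def s'_def)
    qed
    have s_diff: "s N - w *\<^sub>C s' N = V (d i) - w ^ N *\<^sub>C vec (int N) i" for N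
    proof (induction N)
      case (Suc N)
      have "s (Suc N) - w *\<^sub>C s' (Suc N) =
          (s N - w *\<^sub>C s' N) + (w ^ N *\<^sub>C vec (int N) i - w *\<^sub>C (w ^ N *\<^sub>C vec (int N + 1) i))"
        by (simp add: s_def s'_def scaleC_add_right)
      then show ?case
        unfolding Suc by (simp add: scaleC_scaleC add.commute)
    qed (simp add: s_def s'_def Vd)
    have bound: "norm (s N - g) \<le> norm (d i) / (1 - cmod w) * cmod w ^ N" for N
    proof -
      have "(s N - g) - w *\<^sub>C (s' N - u) = - (w ^ N *\<^sub>C vec (int N) i)"
        using s_diff[of N] gu(2) by (simp add: scaleC_diff_right algebra_simps)
      with isometric_neumann_bound[OF normC[OF linear_operator_diff[OF C sC[of N] gu(1)]] w]
      show ?thesis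
        by (simp add: vec_norm norm_power mult.commute)
    qed
    have "(\<lambda>N. norm (d i) / (1 - cmod w) * cmod w ^ N) \<longlonglongrightarrow> 0"
      using w by (intro tendsto_mult_right_zero LIMSEQ_power_zero) simp
    with bound have "(\<lambda>N. s N - g) \<longlonglongrightarrow> 0"
      by (rule Lim_null_comparison[OF always_eventually[OF allI]])
    then have "s \<longlonglongrightarrow> g"
      by (rule LIM_zero_cancel)
    then have "(\<lambda>N. cinner (s N) (V (d j))) \<longlonglongrightarrow> cinner g (V (d j))"
      by (intro tendsto_intros)
    moreover have "(\<lambda>N. cinner (s N) (V (d j))) \<longlonglongrightarrow> cinner (\<Phi> w (d i)) (d j)"
    proof -
      have "(\<lambda>n. (deriv ^^ n) (\<lambda>w. cinner (\<Phi> w (d i)) (d j)) 0 / fact n * (w - 0) ^ n) sums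
          cinner (\<Phi> w (d i)) (d j)"
        using w by (intro holomorphic_power_series[OF holomorphic_Phi]) simp
      then show ?thesis
        by (simp add: sums_def s_def cinner_sum_left cinner_scaleC_left Vd vec' coeff_def
            taylor_coeff_def mult.commute)
    qed
    ultimately show ?thesis
      by (rule LIMSEQ_unique)
  qed

  have resolvent: "cinner g (V y) = cinner (\<Phi> w x) y"
    if w: "cmod w < 1" and gu: "(g, u) \<in> C" "g - w *\<^sub>C u = V x" for w x y g u
  proof (rule dense[of "\<lambda>y. cinner g (V y) = cinner (\<Phi> w x) y"])
    show "closed {y. cinner g (V y) = cinner (\<Phi> w x) y}"
      by (intro closed_Collect_eq continuous_intros contV)
    fix j
    obtain f i where f: "f \<longlonglongrightarrow> x" and i: "\<And>n. f n = d (i n)"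
      using approx by blast
    have "\<exists>g u. (g, u) \<in> C \<and> g - w *\<^sub>C u = V (f n)" for n
      using VK RC by (intro isometric_neumann[OF K(2,1) C DC _ normC w]) auto
    then obtain g' u' where g': "\<And>n. (g' n, u' n) \<in> C" "\<And>n. g' n - w *\<^sub>C u' n = V (f n)"
      by metis
    have bound: "norm (g' n - g) \<le> norm (f n - x) / (1 - cmod w)" for n
    proof -
      have "(g' n - g) - w *\<^sub>C (u' n - u) = V (f n - x)"
        unfolding clinear_diff[OF V_clinear] g'(2)[symmetric] gu(2)[symmetric]
        by (simp add: scaleC_diff_right)
      with isometric_neumann_bound[OF normC[OF linear_operator_diff[OF C g'(1)[of n] gu(1)]] w]
      show ?thesis
        by (simp add: linear_isometry_norm[OF V])
    qed
    have "(\<lambda>n. norm (f n - x) / (1 - cmod w)) \<longlonglongrightarrow> 0"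
    proof -
      have "(\<lambda>n. norm (f n - x) / (1 - cmod w)) \<longlonglongrightarrow> norm (x - x) / (1 - cmod w)"
        using w by (intro tendsto_intros f) auto
      then show ?thesis by simp
    qed
    with bound have "(\<lambda>n. g' n - g) \<longlonglongrightarrow> 0"
      by (rule Lim_null_comparison[OF always_eventually[OF allI]])
    then have "g' \<longlonglongrightarrow> g"
      by (rule LIM_zero_cancel)
    then have "(\<lambda>n. cinner (g' n) (V (d j))) \<longlonglongrightarrow> cinner g (V (d j))"
      by (intro tendsto_intros)
    moreover have "(\<lambda>n. cinner (\<Phi> w (f n)) (d j)) \<longlonglongrightarrow> cinner (\<Phi> w x) (d j)"
      using norm_Phi[OF w] by (intro tendsto_intros f
          bounded_linear.tendsto[OF clinear_bounded_linear[OF clinear_Phi[OF w], of "1 / (1 - cmod w)"]]) simp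
    moreover have "cinner (g' n) (V (d j)) = cinner (\<Phi> w (f n)) (d j)" for n
      using resolvent_d[OF w g'(1)[of n]] g'(2)[of n] by (simp add: i)
    ultimately show "cinner g (V (d j)) = cinner (\<Phi> w x) (d j)"
      using LIMSEQ_unique by simp
  qed

  show ?thesis
  proof (intro exI[of _ K] exI[of _ V] exI[of _ C] conjI allI impI)
    show "h = 0" if "(h, h) \<in> C" "\<forall>x. cinner h (V x) = 0" for h
      using minimal that by blast
  qed (fact K V VK C DC RC isoC first resolvent)+
qed

end

section \<open>Schur functions as parameters\<close>

text \<open>The inverse Moebius map of \<open>disk_coord z\<close>.\<close>

definition half_plane_coord :: "complex \<Rightarrow> complex \<Rightarrow> complex" where
  "half_plane_coord z w = (z - cnj z * w) / (1 - w)"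

lemma
  assumes z: "z \<notin> \<real>" and w: "cmod w < 1"
  shows half_plane_coord_in: "half_plane_coord z w \<in> half_plane z"
    and disk_coord_half_plane_coord: "disk_coord z (half_plane_coord z w) = w"
proof -
  have w1: "1 - w \<noteq> 0"
    using w by auto
  let ?h = "half_plane_coord z w"
  have c: "z - cnj z \<noteq> 0"
    by (rule diff_cnj_nonzero[OF z])
  have diff: "?h - z = w * (z - cnj z) / (1 - w)" "?h - cnj z = (z - cnj z) / (1 - w)"
    using w1 by (simp_all add: half_plane_coord_def field_simps)
  show eq: "disk_coord z ?h = w"
    unfolding disk_coord_def diff using w1 c by simp
  have "?h - cnj z \<noteq> 0"
    unfolding diff using w1 c by simp
  moreover have "cmod (?h - z) / cmod (?h - cnj z) < 1"
    using w arg_cong[OF eq, of cmod] by (simp add: disk_coord_def norm_divide)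
  ultimately have "cmod (?h - z) < cmod (?h - cnj z)"
    by (simp add: pos_divide_less_eq)
  then have "(cmod (?h - z))\<^sup>2 < (cmod (?h - cnj z))\<^sup>2"
    by (rule power_strict_mono) auto
  then have "Im ?h * Im z > 0"
    unfolding cmod_power2 by (simp add: power2_eq_square algebra_simps)
  then show "?h \<in> half_plane z"
    by (auto simp: half_plane_iff sgn_if zero_less_mult_iff)
qed

text \<open>On \<open>range_space A z\<close> the operator \<open>W \<mu>\<close> is the Cayley
  transformation, independent of \<mu>. Only the defect component varies, and there analyticity of
  \<open>F\<close> in operator norm is evaluated at one vector.\<close>

lemma schur_class_strong_derivative:
  assumes A: "closed_symmetric A" and z: "z \<notin> \<real>"
    and F: "F \<in> schur_params A z"
    and W: "\<And>\<zeta>. \<zeta> \<in> half_plane z \<Longrightarrow> clinear (W \<zeta>)"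
      "\<And>\<zeta>. \<zeta> \<in> half_plane z \<Longrightarrow> direct_sum_op (cayley A z) (F \<zeta>) = total_graph (W \<zeta>)"
    and \<zeta>: "\<zeta> \<in> half_plane z"
  shows "\<exists>G. ((\<lambda>\<mu>. diff_quot W \<zeta> \<mu> x) \<longlongrightarrow> G) (at \<zeta>)"
proof -
  let ?M = "defect_space A z" and ?N = "defect_space A (cnj z)"
  have ne: "nonexpanding_between ?M ?N (F \<mu>)" if "\<mu> \<in> half_plane z" for \<mu>
    using F that by (simp add: schur_class_def)
  note ext = direct_sum_extends[OF A z ne W(2)]
  obtain m n where mn: "x = m + n" "m \<in> range_space A z" "n \<in> ?M"
    by (rule defect_decomp[OF A z])
  have "m \<in> Domain (cayley A z)"
    using mn(2) by (simp add: Domain_cayley)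
  then obtain u where u: "(m, u) \<in> cayley A z"
    by (rule DomainE)
  have Wx: "W \<mu> x = u + W \<mu> n" if "\<mu> \<in> half_plane z" for \<mu>
    using ext(1)[OF that that u] by (simp add: mn(1) clinear_add[OF W(1)[OF that]])
  have Fn: "(n, W \<mu> n) \<in> F \<mu>" if "\<mu> \<in> half_plane z" for \<mu>
    unfolding ext(2)[OF that that] using mn(3) by blast
  have "op_analytic_on (half_plane z) ?M ?N F"
    using F by (simp add: schur_class_def)
  then obtain G where G: "bounded_operator_between ?M ?N G"
    "\<And>e. e > 0 \<Longrightarrow> \<forall>\<^sub>F \<mu> in at \<zeta> within half_plane z. \<forall>x y y' w.
       (x, y) \<in> F \<mu> \<longrightarrow> (x, y') \<in> F \<zeta> \<longrightarrow> (x, w) \<in> G \<longrightarrow>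
       norm ((1 / (\<mu> - \<zeta>)) *\<^sub>C (y - y') - w) \<le> e * norm x"
    using \<zeta> unfolding op_analytic_on_def by blast
  have "n \<in> Domain G"
    using G(1) mn(3) by (simp add: bounded_operator_between_def)
  then obtain v where v: "(n, v) \<in> G"
    by (rule DomainE)
  have ev: "\<forall>\<^sub>F \<mu> in at \<zeta>. \<mu> \<in> half_plane z"
    using open_half_plane[OF z] \<zeta> by (rule eventually_at_in_open')
  have "((\<lambda>\<mu>. diff_quot W \<zeta> \<mu> x) \<longlongrightarrow> v) (at \<zeta>)"
  proof (rule tendstoI)
    fix e :: real
    assume "e > 0"
    define e' where "e' = e / (norm n + 1)"
    have e': "e' > 0" "e' * norm n < e"
      using \<open>e > 0\<close> by (simp_all add: e'_def divide_simps add_nonneg_pos)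
    from G(2)[OF e'(1)] have "\<forall>\<^sub>F \<mu> in at \<zeta>. \<forall>x y y' w.
       (x, y) \<in> F \<mu> \<longrightarrow> (x, y') \<in> F \<zeta> \<longrightarrow> (x, w) \<in> G \<longrightarrow>
       norm ((1 / (\<mu> - \<zeta>)) *\<^sub>C (y - y') - w) \<le> e' * norm x"
      unfolding at_within_open[OF \<zeta> open_half_plane[OF z]] .
    with ev show "\<forall>\<^sub>F \<mu> in at \<zeta>. dist (diff_quot W \<zeta> \<mu> x) v < e"
    proof eventually_elim
      case (elim \<mu>)
      then have "norm (diff_quot W \<zeta> \<mu> n - v) \<le> e' * norm n"
        using Fn[of \<mu>] Fn[OF \<zeta>] v by blast
      then show ?case
        using e'(2) elim(1) by (simp add: dist_norm Wx \<zeta>)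
    qed
  qed
  then show ?thesis
    by blast
qed

text \<open>The resolvent identity reduces the difference of \<open>\<Phi>\<close> to the difference
  of \<open>c W\<close>, which obeys the product rule. Pointwise limits suffice because
  \<open>\<Phi> \<mu>\<close> is bounded uniformly for \<mu> near \<zeta>.\<close>

lemma neumann_inv_weak_derivative:
  fixes W :: "complex \<Rightarrow> 'a::chilbert_space \<Rightarrow> 'a"
  assumes z: "z \<notin> \<real>"
    and W: "\<And>\<zeta>. \<zeta> \<in> half_plane z \<Longrightarrow> clinear (W \<zeta>)"
      "\<And>\<zeta> x. \<zeta> \<in> half_plane z \<Longrightarrow> norm (W \<zeta> x) \<le> norm x"
    and \<zeta>: "\<zeta> \<in> half_plane z"
    and diff: "\<And>x. ((\<lambda>\<mu>. diff_quot W \<zeta> \<mu> x) \<longlongrightarrow> G x) (at \<zeta>)"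
  defines "\<Phi> \<equiv> \<lambda>\<zeta>. neumann_inv (disk_coord z \<zeta>) (W \<zeta>)"
  shows "((\<lambda>\<mu>. cinner (\<Phi> \<mu> x) y) has_field_derivative
    cinner (\<Phi> \<zeta> (((z - cnj z) / (\<zeta> - cnj z)\<^sup>2) *\<^sub>C W \<zeta> (\<Phi> \<zeta> x) +
      disk_coord z \<zeta> *\<^sub>C G (\<Phi> \<zeta> x))) y) (at \<zeta>)"
proof -
  define c where "c = disk_coord z"
  define d where "d \<mu> = (z - cnj z) / ((\<mu> - cnj z) * (\<zeta> - cnj z))" for \<mu>
  note neq = half_plane_neq_cnj[OF z \<zeta>]
  have c: "cmod (c \<mu>) < 1" if "\<mu> \<in> half_plane z" for \<mu>
    using norm_disk_coord_less_1[OF z that] by (simp add: c_def)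
  have \<Phi>: "\<Phi> \<mu> v - c \<mu> *\<^sub>C W \<mu> (\<Phi> \<mu> v) = v" "y - c \<mu> *\<^sub>C W \<mu> y = v \<Longrightarrow> \<Phi> \<mu> v = y"
    "norm (\<Phi> \<mu> v) \<le> norm v / (1 - cmod (c \<mu>))" "clinear (\<Phi> \<mu>)" if "\<mu> \<in> half_plane z" for \<mu> v y
    unfolding \<Phi>_def c_def using c[OF that, unfolded c_def] W(1,2)[OF that]
    by (blast intro: neumann_inv_right neumann_inv_eqI norm_neumann_inv_le clinear_neumann_inv)+
  have ev: "\<forall>\<^sub>F \<mu> in at \<zeta>. \<mu> \<in> half_plane z \<and> \<mu> \<noteq> \<zeta>"
    using eventually_at_in_open'[OF open_half_plane[OF z] \<zeta>] eventually_neq_at_within[of \<zeta> \<zeta> UNIV]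
    by eventually_elim simp
  have c_lim: "(c \<longlongrightarrow> c \<zeta>) (at \<zeta>)"
    unfolding c_def by (rule tendsto_disk_coord[OF neq])
  have d_lim: "(d \<longlongrightarrow> d \<zeta>) (at \<zeta>)"
    unfolding d_def[abs_def] using neq by (intro tendsto_intros) auto
  have W_lim: "((\<lambda>\<mu>. W \<mu> v) \<longlongrightarrow> W \<zeta> v) (at \<zeta>)" for v
  proof -
    have "((\<lambda>\<mu>. W \<zeta> v + (\<mu> - \<zeta>) *\<^sub>C (diff_quot W \<zeta> \<mu> v)) \<longlongrightarrow>
        W \<zeta> v + (\<zeta> - \<zeta>) *\<^sub>C G v) (at \<zeta>)"
      by (intro tendsto_intros diff)
    then have "((\<lambda>\<mu>. W \<zeta> v + (\<mu> - \<zeta>) *\<^sub>C (diff_quot W \<zeta> \<mu> v)) \<longlongrightarrow> W \<zeta> v) (at \<zeta>)"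
      by simp
    then show ?thesis
    proof (rule Lim_transform_eventually)
      show "\<forall>\<^sub>F \<mu> in at \<zeta>. W \<zeta> v + (\<mu> - \<zeta>) *\<^sub>C (diff_quot W \<zeta> \<mu> v) = W \<mu> v"
        using ev by eventually_elim (simp add: scaleC_scaleC)
    qed
  qed
  have \<Phi>_diff: "\<Phi> \<mu> v - \<Phi> \<zeta> v = \<Phi> \<mu> (c \<mu> *\<^sub>C W \<mu> (\<Phi> \<zeta> v) - c \<zeta> *\<^sub>C W \<zeta> (\<Phi> \<zeta> v))"
    if \<mu>: "\<mu> \<in> half_plane z" for \<mu> v
  proof -
    let ?y = "\<Phi> \<zeta> v"
    have "?y - c \<mu> *\<^sub>C W \<mu> ?y = v - (c \<mu> *\<^sub>C W \<mu> ?y - c \<zeta> *\<^sub>C W \<zeta> ?y)"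
      using \<Phi>(1)[OF \<zeta>, of v] by (simp add: algebra_simps)
    then have "?y = \<Phi> \<mu> (v - (c \<mu> *\<^sub>C W \<mu> ?y - c \<zeta> *\<^sub>C W \<zeta> ?y))"
      by (rule \<Phi>(2)[OF \<mu>, symmetric])
    also have "\<dots> = \<Phi> \<mu> v - \<Phi> \<mu> (c \<mu> *\<^sub>C W \<mu> ?y - c \<zeta> *\<^sub>C W \<zeta> ?y)"
      by (rule clinear_diff[OF \<Phi>(4)[OF \<mu>]])
    finally show ?thesis
      by (simp add: algebra_simps)
  qed
  have \<Phi>_null: "((\<lambda>\<mu>. \<Phi> \<mu> (v \<mu>)) \<longlongrightarrow> 0) (at \<zeta>)" if v: "(v \<longlongrightarrow> 0) (at \<zeta>)" for v
  proof (rule Lim_null_comparison)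
    show "\<forall>\<^sub>F \<mu> in at \<zeta>. norm (\<Phi> \<mu> (v \<mu>)) \<le> norm (v \<mu>) / (1 - cmod (c \<mu>))"
      using ev by eventually_elim (use \<Phi>(3) in blast)
    have "((\<lambda>\<mu>. norm (v \<mu>) / (1 - cmod (c \<mu>))) \<longlongrightarrow> norm (0 :: 'a) / (1 - cmod (c \<zeta>))) (at \<zeta>)"
      using c[OF \<zeta>] by (intro tendsto_intros v c_lim) auto
    then show "((\<lambda>\<mu>. norm (v \<mu>) / (1 - cmod (c \<mu>))) \<longlongrightarrow> 0) (at \<zeta>)"
      by simp
  qed
  have \<Phi>_lim: "((\<lambda>\<mu>. \<Phi> \<mu> v) \<longlongrightarrow> \<Phi> \<zeta> v) (at \<zeta>)" for v
  proof -
    have "((\<lambda>\<mu>. c \<mu> *\<^sub>C W \<mu> (\<Phi> \<zeta> v) - c \<zeta> *\<^sub>C W \<zeta> (\<Phi> \<zeta> v)) \<longlongrightarrow>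
        c \<zeta> *\<^sub>C W \<zeta> (\<Phi> \<zeta> v) - c \<zeta> *\<^sub>C W \<zeta> (\<Phi> \<zeta> v)) (at \<zeta>)"
      by (intro tendsto_intros c_lim W_lim)
    then have "((\<lambda>\<mu>. \<Phi> \<mu> (c \<mu> *\<^sub>C W \<mu> (\<Phi> \<zeta> v) - c \<zeta> *\<^sub>C W \<zeta> (\<Phi> \<zeta> v))) \<longlongrightarrow> 0) (at \<zeta>)"
      by (intro \<Phi>_null) simp
    then have "((\<lambda>\<mu>. \<Phi> \<mu> v - \<Phi> \<zeta> v) \<longlongrightarrow> 0) (at \<zeta>)"
    proof (rule Lim_transform_eventually)
      show "\<forall>\<^sub>F \<mu> in at \<zeta>. \<Phi> \<mu> (c \<mu> *\<^sub>C W \<mu> (\<Phi> \<zeta> v) - c \<zeta> *\<^sub>C W \<zeta> (\<Phi> \<zeta> v)) = \<Phi> \<mu> v - \<Phi> \<zeta> v"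
        using ev by eventually_elim (simp add: \<Phi>_diff)
    qed
    then show ?thesis
      by (rule LIM_zero_cancel)
  qed
  define Y where "Y = \<Phi> \<zeta> x"
  define v where "v = d \<zeta> *\<^sub>C W \<zeta> Y + c \<zeta> *\<^sub>C G Y"
  \<comment> \<open>The difference quotient of \<open>c W\<close> at \<open>Y\<close>, with limit
    \<open>v\<close>. Splitting \<open>\<Phi> \<mu> (q \<mu>)\<close> at \<open>v\<close> separates
    a null term, handled by boundedness, from the pointwise limit of
    \<open>\<Phi> \<mu> v\<close>.\<close>
  define q where "q \<mu> = d \<mu> *\<^sub>C W \<mu> Y + c \<zeta> *\<^sub>C (diff_quot W \<zeta> \<mu> Y)" for \<mu>
  have "(q \<longlongrightarrow> v) (at \<zeta>)"
    unfolding q_def[abs_def] v_def by (intro tendsto_intros d_lim W_lim diff)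
  then have "((\<lambda>\<mu>. \<Phi> \<mu> (q \<mu> - v)) \<longlongrightarrow> 0) (at \<zeta>)"
    by (intro \<Phi>_null LIM_zero)
  from tendsto_add[OF this \<Phi>_lim[of v]]
  have "((\<lambda>\<mu>. \<Phi> \<mu> (q \<mu> - v) + \<Phi> \<mu> v) \<longlongrightarrow> \<Phi> \<zeta> v) (at \<zeta>)"
    by simp
  then have "((\<lambda>\<mu>. cinner (\<Phi> \<mu> (q \<mu> - v) + \<Phi> \<mu> v) y) \<longlongrightarrow> cinner (\<Phi> \<zeta> v) y) (at \<zeta>)"
    by (intro tendsto_intros)
  then have "((\<lambda>\<mu>. (cinner (\<Phi> \<mu> x) y - cinner (\<Phi> \<zeta> x) y) / (\<mu> - \<zeta>)) \<longlongrightarrow> cinner (\<Phi> \<zeta> v) y) (at \<zeta>)"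
  proof (rule Lim_transform_eventually)
    show "\<forall>\<^sub>F \<mu> in at \<zeta>. cinner (\<Phi> \<mu> (q \<mu> - v) + \<Phi> \<mu> v) y =
        (cinner (\<Phi> \<mu> x) y - cinner (\<Phi> \<zeta> x) y) / (\<mu> - \<zeta>)"
      using ev
    proof eventually_elim
      case (elim \<mu>)
      then have \<mu>: "\<mu> \<in> half_plane z" and ne: "\<mu> - \<zeta> \<noteq> 0"
        by auto
      have cd: "c \<mu> = c \<zeta> + (\<mu> - \<zeta>) * d \<mu>"
        using disk_coord_diff[OF half_plane_neq_cnj[OF z \<mu>] neq]
        by (simp add: c_def d_def algebra_simps)
      have "(\<mu> - \<zeta>) *\<^sub>C q \<mu> = c \<mu> *\<^sub>C W \<mu> Y - c \<zeta> *\<^sub>C W \<zeta> Y"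
        unfolding cd q_def using ne by (simp add: scaleC_simps)
      then have "(\<mu> - \<zeta>) *\<^sub>C \<Phi> \<mu> (q \<mu>) = \<Phi> \<mu> x - \<Phi> \<zeta> x"
        by (simp add: \<Phi>_diff[OF \<mu>] Y_def flip: clinear_scaleC[OF \<Phi>(4)[OF \<mu>]])
      then have "cinner (\<Phi> \<mu> x) y - cinner (\<Phi> \<zeta> x) y = (\<mu> - \<zeta>) * cinner (\<Phi> \<mu> (q \<mu>)) y"
        by (simp flip: cinner_diff_left cinner_scaleC_left)
      then show ?case
        using ne by (simp add: clinear_diff[OF \<Phi>(4)[OF \<mu>]])
    qed
  qed
  moreover have "d \<zeta> = (z - cnj z) / (\<zeta> - cnj z)\<^sup>2"
    by (simp add: d_def power2_eq_square)
  ultimately show ?thesis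
    by (simp add: has_field_derivative_iff v_def Y_def c_def)
qed

lemma caratheodory_schur:
  assumes A: "closed_symmetric A" and z: "z \<notin> \<real>"
    and F: "F \<in> schur_params A z"
    and W: "\<And>\<zeta>. \<zeta> \<in> half_plane z \<Longrightarrow> clinear (W \<zeta>)"
      "\<And>\<zeta> x. \<zeta> \<in> half_plane z \<Longrightarrow> norm (W \<zeta> x) \<le> norm x"
      "\<And>\<zeta>. \<zeta> \<in> half_plane z \<Longrightarrow> direct_sum_op (cayley A z) (F \<zeta>) = total_graph (W \<zeta>)"
  shows "caratheodory (\<lambda>w. neumann_inv w (W (half_plane_coord z w))) (W z)"
proof -
  let ?h = "half_plane_coord z"
  define \<Psi> where "\<Psi> \<zeta> = neumann_inv (disk_coord z \<zeta>) (W \<zeta>)" for \<zeta>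
  have z_in: "z \<in> half_plane z"
    by (simp add: half_plane_iff)
  have h0: "?h 0 = z"
    by (simp add: half_plane_coord_def)
  note h_in = half_plane_coord_in[OF z]
  have eq: "neumann_inv w (W (?h w)) = \<Psi> (?h w)" if "cmod w < 1" for w
    by (simp add: \<Psi>_def disk_coord_half_plane_coord[OF z that])
  have h_deriv: "(?h has_field_derivative (z - cnj z) / (1 - w)\<^sup>2) (at w)" if "cmod w < 1" for w
  proof -
    have "1 - w \<noteq> 0"
      using that by auto
    then show ?thesis
      unfolding half_plane_coord_def[abs_def]
      by (auto intro!: derivative_eq_intros simp: power2_eq_square field_simps)
  qed
  have deriv: "\<exists>G. ((\<lambda>\<mu>. cinner (\<Psi> \<mu> x) y) has_field_derivative
      cinner (\<Psi> \<zeta> (((z - cnj z) / (\<zeta> - cnj z)\<^sup>2) *\<^sub>C W \<zeta> (\<Psi> \<zeta> x) +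
        disk_coord z \<zeta> *\<^sub>C G)) y) (at \<zeta>)" if \<zeta>: "\<zeta> \<in> half_plane z" for \<zeta> x y
  proof -
    from choice[OF allI, OF schur_class_strong_derivative[OF A z F W(1,3) \<zeta>]]
    obtain G where "\<forall>x. ((\<lambda>\<mu>. diff_quot W \<zeta> \<mu> x) \<longlongrightarrow> G x) (at \<zeta>)"
      by (rule exE)
    then have G: "((\<lambda>\<mu>. diff_quot W \<zeta> \<mu> x) \<longlongrightarrow> G x) (at \<zeta>)" for x
      by (rule spec)
    from neumann_inv_weak_derivative[OF z W(1,2) \<zeta> G] show ?thesis
      unfolding \<Psi>_def by (rule exI[where x = "G (neumann_inv (disk_coord z \<zeta>) (W \<zeta>) x)"])
  qed
  have transform: "((\<lambda>w. cinner (neumann_inv w (W (?h w)) x) y) has_field_derivative D) (at w)"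
    if "((\<lambda>w. cinner (\<Psi> (?h w) x) y) has_field_derivative D) (at w)" "cmod w < 1" for D x y w
    using that(1)
  proof (rule has_field_derivative_transform_within_open)
    show "open (ball 0 1 :: complex set)" "w \<in> ball 0 1"
      using that(2) by simp_all
  qed (simp add: eq)
  show ?thesis
  proof
    fix w :: complex and x y
    assume w: "cmod w < 1"
    note Wh = W(1,2)[OF h_in[OF w]]
    show "clinear (neumann_inv w (W (?h w)))"
      by (rule clinear_neumann_inv[OF Wh w])
    show "norm (neumann_inv w (W (?h w)) x) \<le> norm x / (1 - cmod w)"
      by (rule norm_neumann_inv_le[OF Wh w])
    let ?g = "neumann_inv w (W (?h w)) x"
    \<comment> \<open>As \<open>W\<close> is a contraction and |w| < 1, \<open>?g - x\<close> is no
      longer than \<open>?g\<close>; expanding the square is the required positivity.\<close>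
    have "?g - x = w *\<^sub>C W (?h w) ?g"
      using neumann_inv_right[OF Wh w, of x] by (simp add: algebra_simps)
    then have "norm (?g - x) = cmod w * norm (W (?h w) ?g)"
      by simp
    also have "\<dots> \<le> 1 * norm ?g"
      using w by (intro mult_mono Wh(2)) auto
    finally have "(norm (?g - x))\<^sup>2 \<le> (norm ?g)\<^sup>2"
      by (simp add: power_mono)
    then show "(norm x)\<^sup>2 \<le> 2 * Re (cinner ?g x)"
      by (simp add: norm_sq_diff)
  next
    fix x y
    have "\<exists>D. ((\<lambda>w. cinner (neumann_inv w (W (?h w)) x) y) has_field_derivative D) (at w)"
      if w: "cmod w < 1" for w
    proof -
      obtain D where "((\<lambda>\<mu>. cinner (\<Psi> \<mu> x) y) has_field_derivative D) (at (?h w))"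
        using deriv[OF h_in[OF w]] by blast
      from transform[OF DERIV_chain2[OF this h_deriv[OF w]] w] show ?thesis
        by (rule exI)
    qed
    then show "(\<lambda>w. cinner (neumann_inv w (W (?h w)) x) y) holomorphic_on ball 0 1"
      by (subst holomorphic_on_open) auto
    have \<Psi>z: "\<Psi> z v = v" for v
      unfolding \<Psi>_def using W(1,2)[OF z_in] by (intro neumann_inv_eqI) (simp_all add: disk_coord_def)
    show "neumann_inv 0 (W (?h 0)) x = x"
      using \<Psi>z[of x] eq[of 0] by (simp add: h0)
    \<comment> \<open>At \<open>z\<close> the disk coordinate vanishes, which removes
      \<open>G\<close>. The remaining factor \<open>1 / (z - cnj z)\<close> cancels against the
      derivative \<open>z - cnj z\<close> of \<open>half_plane_coord z\<close> at 0.\<close>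
    obtain G where "((\<lambda>\<mu>. cinner (\<Psi> \<mu> x) y) has_field_derivative
        cinner (((z - cnj z) / (z - cnj z)\<^sup>2) *\<^sub>C W z x + disk_coord z z *\<^sub>C G) y) (at z)"
      using deriv[OF z_in, of x y] by (auto simp: \<Psi>z)
    then have "((\<lambda>\<mu>. cinner (\<Psi> \<mu> x) y) has_field_derivative
        (1 / (z - cnj z)) * cinner (W z x) y) (at (?h 0))"
      using diff_cnj_nonzero[OF z]
      by (simp add: h0 disk_coord_def cinner_scaleC_left power2_eq_square)
    from DERIV_chain2[OF this h_deriv[of 0]]
    have "((\<lambda>w. cinner (\<Psi> (?h w) x) y) has_field_derivative cinner (W z x) y) (at 0)"
      using diff_cnj_nonzero[OF z] by simp
    from transform[OF this] show "deriv (\<lambda>w. cinner (neumann_inv w (W (?h w)) x) y) 0 = cinner (W z x) y"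
      by (intro DERIV_imp_deriv) simp
  qed (use W(1,2)[OF z_in] in auto)
qed

section \<open>The converse and uniqueness\<close>

lemma schur_class_generalized_resolvent:
  fixes A :: "'a::chilbert_space operator"
  assumes A: "closed_symmetric A" and dense: "closure (Domain A) = UNIV" and z: "z \<notin> \<real>"
    and F: "F \<in> schur_params A z"
  shows "generalized_resolvent TYPE(ell2) A (resolvent_family A z F)"
proof -
  have ne: "schur_value A z (F \<zeta>)"
    if "\<zeta> \<in> half_plane z" for \<zeta>
    using F that by (simp add: schur_class_def)
  have "\<forall>\<zeta>\<in>half_plane z. \<exists>W. clinear W \<and> (\<forall>x. norm (W x) \<le> norm x) \<and>
      direct_sum_op (cayley A z) (F \<zeta>) = total_graph W"
  proof
    fix \<zeta>
    assume "\<zeta> \<in> half_plane z"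
    from direct_sum_cayley[OF A z ne[OF this]]
    show "\<exists>W. clinear W \<and> (\<forall>x. norm (W x) \<le> norm x) \<and>
        direct_sum_op (cayley A z) (F \<zeta>) = total_graph W"
      by metis
  qed
  then obtain W where "\<forall>\<zeta>\<in>half_plane z. clinear (W \<zeta>) \<and> (\<forall>x. norm (W \<zeta> x) \<le> norm x) \<and>
      direct_sum_op (cayley A z) (F \<zeta>) = total_graph (W \<zeta>)"
    by (auto dest!: bchoice)
  then have W: "clinear (W \<zeta>)" "norm (W \<zeta> x) \<le> norm x"
    "direct_sum_op (cayley A z) (F \<zeta>) = total_graph (W \<zeta>)" if "\<zeta> \<in> half_plane z" for \<zeta> x
    using that by auto
  have z_in: "z \<in> half_plane z"
    by (simp add: half_plane_iff)
  interpret caratheodory "\<lambda>w. neumann_inv w (W (half_plane_coord z w))" "W z"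
    by (rule caratheodory_schur[OF A z F W])
  obtain K :: "ell2 set" and V :: "'a \<Rightarrow> ell2" and C :: "ell2 operator" where
    K: "closed K" "csubspace K" and V: "linear_isometry V" "range V \<subseteq> K"
    and C: "linear_operator C" "Domain C = K" "Range C = K"
    and dilation: "\<forall>g u g' u'. (g, u) \<in> C \<longrightarrow> (g', u') \<in> C \<longrightarrow> cinner u u' = cinner g g'"
      "\<forall>h. (h, h) \<in> C \<longrightarrow> (\<forall>x. cinner h (V x) = 0) \<longrightarrow> h = 0"
      "\<forall>x u. (V x, u) \<in> C \<longrightarrow> (\<forall>y. cinner u (V y) = cinner (W z x) y)"
      "\<forall>w x g u. cmod w < 1 \<longrightarrow> (g, u) \<in> C \<longrightarrow> g - w *\<^sub>C u = V x \<longrightarrow>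
        (\<forall>y. cinner g (V y) = cinner (neumann_inv w (W (half_plane_coord z w)) x) y)"
    using unitary_dilation by (elim exE conjE) (rule that)
  note iso = dilation(1)[rule_format] and minimal = dilation(2)[rule_format]
    and first = dilation(3)[rule_format] and resolvent = dilation(4)[rule_format]
  note Viso = linear_isometryD[OF V(1)]
  obtain V' where V': "clinear V'" "\<And>x y. cinner (V x) y = cinner x (V' y)" "\<And>x. V' (V x) = x"
    "\<And>y. V (V' y) = orth_proj (range V) y"
    using linear_isometry_adjoint[OF V(1)] by metis
  have V'_eqI: "V' g = k" if "\<And>y. cinner g (V y) = cinner k y" for g k
  proof (rule cinner_eq_all_imp_eq)
    fix y
    have "cinner (V' g) y = cnj (cinner (V y) g)"
      unfolding V'(2) by (rule cinner_commute)
    also have "\<dots> = cinner k y"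
      unfolding that[symmetric] by (rule cinner_commute[symmetric])
    finally show "cinner (V' g) y = cinner k y" .
  qed
  \<comment> \<open>The first-order clause gives \<open>cinner u' (V u) = cinner u u\<close>, and
    \<open>u'\<close> has the same norm as \<open>u\<close>; equality in the Cauchy-Schwarz
    inequality forces \<open>u' = V u\<close>.\<close>
  have cayley_C: "(V g, V u) \<in> C" if gu: "(g, u) \<in> cayley A z" for g u
  proof -
    have "V g \<in> Domain C"
      using V(2) C(2) by auto
    then obtain u' where u': "(V g, u') \<in> C"
      by (rule DomainE)
    have "cinner u' (V u) = cinner u u"
      using first[OF u'] direct_sum_extends(1)[OF A z ne[OF z_in] W(3)[OF z_in] gu] by simp
    moreover have "(norm u')\<^sup>2 = (norm u)\<^sup>2"
      using iso[OF u' u'] cayley_norm[OF A gu]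
      unfolding cinner_self of_real_eq_iff by (simp add: Viso(3))
    ultimately have "(norm (u' - V u))\<^sup>2 = 0"
      by (simp add: norm_sq_diff Viso(3) cinner_self)
    then show ?thesis
      using u' by simp
  qed
  define T where "T = inv_cayley z C"
  have T: "self_adjoint_on K T"
    unfolding T_def
  proof (rule self_adjoint_inv_cayley[OF z K(2,1) C iso])
    fix h
    assume h: "(h, h) \<in> C"
    \<comment> \<open>A fixed vector is orthogonal to the range of \<open>C - 1\<close>, which
      contains \<open>V x\<close> times \<open>z - cnj z\<close> for every \<open>x\<close> in the
      dense domain of \<open>A\<close>.\<close>
    have "cinner h (V x) = 0" for x
    proof -
      have "cinner h (V x) = 0" if "x \<in> Domain A" for x
      proof -
        obtain y where "(x, y) \<in> A"
          using \<open>x \<in> Domain A\<close> by (rule DomainE)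
        from iso[OF h cayley_C[OF cayleyI[OF this, of z]]]
        have "cnj (z - cnj z) * cinner h (V x) = 0"
          by (simp add: clinearD[OF Viso(1)] cinner_simps algebra_simps)
        then show ?thesis
          using diff_cnj_nonzero[OF z] by (simp del: complex_cnj_diff)
      qed
      then have "Domain A \<subseteq> {x. cinner h (V x) = 0}"
        by auto
      moreover have "closed {x. cinner h (V x) = 0}"
        by (intro closed_Collect_eq continuous_intros linear_continuous_on
            clinear_bounded_linear[OF Viso(1), of 1]) (simp add: Viso(3))
      ultimately have "closure (Domain A) \<subseteq> {x. cinner h (V x) = 0}"
        by (rule closure_minimal)
      then show ?thesis
        unfolding dense by auto
    qed
    with h show "h = 0"
      by (rule minimal)
  qed
  have AT: "map_prod V V ` A \<subseteq> T"
  proof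
    fix p
    assume "p \<in> map_prod V V ` A"
    then obtain x y where "(x, y) \<in> A" and p: "p = (V x, V y)"
      by auto
    then have "(x, y) \<in> inv_cayley z (cayley A z)"
      by (simp add: inv_cayley_cayley[OF closed_symmetric_linear[OF A] z])
    then obtain g u where gu: "(g, u) \<in> cayley A z" "x = u - g" "y = z *\<^sub>C u - cnj z *\<^sub>C g"
      by (auto simp: in_inv_cayley)
    then show "p \<in> T"
      unfolding T_def p in_inv_cayley using cayley_C[OF gu(1)]
      by (intro exI[of _ "V g"] exI[of _ "V u"]) (simp add: clinearD[OF Viso(1)])
  qed
  have upper: "compressed_resolvent V T \<zeta> = resolvent_family A z F \<zeta>"
    if \<zeta>: "\<zeta> \<in> half_plane z" for \<zeta>
  proof -
    note neq = half_plane_neq_cnj[OF z \<zeta>]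
    define w where "w = disk_coord z \<zeta>"
    have w: "cmod w < 1"
      unfolding w_def by (rule norm_disk_coord_less_1[OF z \<zeta>])
    have "1 - w = (z - cnj z) / (\<zeta> - cnj z)" "z - cnj z * w = \<zeta> * ((z - cnj z) / (\<zeta> - cnj z))"
      using neq by (simp_all add: w_def disk_coord_def field_simps)
    then have h: "half_plane_coord z w = \<zeta>"
      using diff_cnj_nonzero[OF z] neq by (simp add: half_plane_coord_def)
    note N = neumann_inv_right[OF W(1,2)[OF \<zeta>] w] neumann_inv_eqI[OF W(1,2)[OF \<zeta>] w]
    have sub: "(x, x') \<in> cayley_resolvent z \<zeta> (W \<zeta>)"
      if xx': "(x, x') \<in> compressed_resolvent V T \<zeta>" for x x'
    proof -
      obtain y where y: "(V x, y) \<in> op_resolvent T \<zeta>" "V x' = orth_proj (range V) y"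
        using xx' by (auto simp: compressed_resolvent_def)
      obtain g u where gu: "(g, u) \<in> C" "V x = (\<zeta> - cnj z) *\<^sub>C (g - w *\<^sub>C u)" "y = u - g"
        using y(1) unfolding T_def op_resolvent_inv_cayley[OF neq] w_def by blast
      define h where "h = inverse (\<zeta> - cnj z) *\<^sub>C x"
      have Vh: "g - w *\<^sub>C u = V h"
        using neq by (simp add: h_def clinearD[OF Viso(1)] gu(2) scaleC_scaleC)
      define k where "k = neumann_inv w (W \<zeta>) h"
      have k: "k - w *\<^sub>C W \<zeta> k = h"
        unfolding k_def by (rule N(1))
      have V'g: "V' g = k"
        by (rule V'_eqI) (simp add: resolvent[OF w gu(1) Vh] \<open>half_plane_coord z w = \<zeta>\<close> k_def)
      \<comment> \<open>For \<open>w \<noteq> 0\<close> the inner part of \<open>u\<close> follows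
        from that of \<open>g\<close> on dividing by \<open>w\<close>. At \<open>w = 0\<close>,
        where \<open>\<zeta> = z\<close>, it comes from the first-order clause.\<close>
      have V'u: "V' u = W \<zeta> k"
      proof (cases "w = 0")
        case True
        then have "\<zeta> = z"
          using neq by (simp add: w_def disk_coord_def)
        moreover have "k = h" "g = V h"
          using k Vh True by simp_all
        ultimately show ?thesis
          using first[of h u] gu(1) by (intro V'_eqI) simp
      next
        case False
        have "w *\<^sub>C V' u = V' (g - V h)"
          by (simp flip: Vh clinear_scaleC[OF V'(1)])
        also have "\<dots> = w *\<^sub>C W \<zeta> k"
          by (simp add: clinear_diff[OF V'(1)] V'g V'(3) flip: k)
        finally show ?thesis
          using False by (simp add: scaleC_cancel_left)
      qed
      have "x' = V' y"
        using y(2) unfolding V'(4)[symmetric] Viso(4) .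
      then have "x' = W \<zeta> k - k"
        by (simp add: gu(3) clinear_diff[OF V'(1)] V'g V'u)
      moreover have "x = (\<zeta> - cnj z) *\<^sub>C (k - w *\<^sub>C W \<zeta> k)"
        unfolding k h_def using neq by (simp add: scaleC_scaleC)
      ultimately show ?thesis
        unfolding cayley_resolvent_def w_def by blast
    qed
    \<comment> \<open>The reverse inclusion follows from the first one: the compressed resolvent is
      defined everywhere and the right-hand side is single-valued.\<close>
    have unique: "x' = x''" if "(x, x') \<in> cayley_resolvent z \<zeta> (W \<zeta>)" "(x, x'') \<in> cayley_resolvent z \<zeta> (W \<zeta>)"
      for x x' x''
    proof -
      from that obtain k k' where k: "x = (\<zeta> - cnj z) *\<^sub>C (k - w *\<^sub>C W \<zeta> k)" "x' = W \<zeta> k - k"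
        "x = (\<zeta> - cnj z) *\<^sub>C (k' - w *\<^sub>C W \<zeta> k')" "x'' = W \<zeta> k' - k'"
        unfolding cayley_resolvent_def w_def by blast
      then have "k - w *\<^sub>C W \<zeta> k = k' - w *\<^sub>C W \<zeta> k'"
        using neq by (simp add: scaleC_cancel_left)
      from N(2)[OF this] N(2)[OF refl, of k'] have "k = k'"
        by simp
      then show ?thesis
        using k by simp
    qed
    have ran: "range_space T \<zeta> = K"
      by (rule self_adjoint_range_space[OF K T half_plane_not_Reals[OF z \<zeta>]])
    have "(x, x') \<in> compressed_resolvent V T \<zeta>" if "(x, x') \<in> cayley_resolvent z \<zeta> (W \<zeta>)" for x x'
    proof -
      have "x \<in> Domain (compressed_resolvent V T \<zeta>)"
        by (simp add: Domain_compressed_resolvent[OF V ran])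
      then obtain x'' where x'': "(x, x'') \<in> compressed_resolvent V T \<zeta>"
        by (rule DomainE)
      with unique[OF that sub[OF x'']] show ?thesis
        by simp
    qed
    with sub have "compressed_resolvent V T \<zeta> = cayley_resolvent z \<zeta> (W \<zeta>)"
      by auto
    then show ?thesis
      using resolvent_family_upper[where F = F, OF A z W(3)[OF \<zeta>] \<zeta>] by simp
  qed
  have "resolvent_family A z F \<zeta> = compressed_resolvent V T \<zeta>" if "\<zeta> \<notin> \<real>" for \<zeta>
    using compressed_resolvent_lower[OF A z ne K V T upper that] by simp
  then show ?thesis
    unfolding generalized_resolvent_def using K V T AT
    by (intro exI[of _ K] exI[of _ V] exI[of _ T]) (simp add: compressed_resolvent_def)
qed

text \<open>Injectivity is pointwise in \<zeta>: the resolvent returns the direct sum, and its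
  summand on the defect space is \<open>F \<zeta>\<close>.\<close>

lemma resolvent_family_inject:
  assumes A: "closed_symmetric A" and z: "z \<notin> \<real>" and \<zeta>: "\<zeta> \<in> half_plane z"
    and F: "F \<in> schur_params A z"
    and G: "G \<in> schur_params A z"
    and eq: "resolvent_family A z F \<zeta> = resolvent_family A z G \<zeta>"
  shows "F \<zeta> = G \<zeta>"
proof -
  have dom: "Domain (H \<zeta>) = orth_compl (Domain (cayley A z))"
    if "H \<in> schur_params A z" for H
    using that \<zeta> unfolding defect_space_eq[OF A z, symmetric]
    by (simp add: schur_class_def nonexpanding_between_def)
  have res: "op_resolvent (inv_cayley z (direct_sum_op (cayley A z) (F \<zeta>))) \<zeta> =
      op_resolvent (inv_cayley z (direct_sum_op (cayley A z) (G \<zeta>))) \<zeta>"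
    using eq \<zeta> by (simp add: resolvent_family_def quasi_sa_ext_eq)
  have sum: "direct_sum_op (cayley A z) (F \<zeta>) = direct_sum_op (cayley A z) (G \<zeta>)"
    by (rule inv_cayley_inject[OF z op_resolvent_inject[OF res]])
  note C = linear_operator_cayley[OF A z]
  show ?thesis
    by (rule equalityI[OF direct_sum_op_cancel[OF C dom[OF F] dom[OF G] sum]
        direct_sum_op_cancel[OF C dom[OF G] dom[OF F] sum[symmetric]]])
qed

theorem theorem2p7:
  fixes A :: "'a::chilbert_space operator" and \<zeta>\<^sub>0 :: complex
  assumes "closed_symmetric A"
    and "closure (Domain A) = UNIV"
    and "\<zeta>\<^sub>0 \<notin> \<real>"
  defines "S \<equiv> schur_class (half_plane \<zeta>\<^sub>0) (defect_space A \<zeta>\<^sub>0) (defect_space A (cnj \<zeta>\<^sub>0))"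
  shows "(\<forall>R. generalized_resolvent TYPE('b::chilbert_space) A R \<longrightarrow>
            (\<exists>F\<in>S. \<forall>\<zeta>. \<zeta> \<notin> \<real> \<longrightarrow> R \<zeta> = resolvent_family A \<zeta>\<^sub>0 F \<zeta>)) \<and>
         (\<forall>F\<in>S. generalized_resolvent TYPE(ell2) A (resolvent_family A \<zeta>\<^sub>0 F)) \<and>
         (\<forall>F\<in>S. \<forall>G\<in>S. (\<exists>\<zeta>\<in>half_plane \<zeta>\<^sub>0. F \<zeta> \<noteq> G \<zeta>) \<longrightarrow>
            (\<exists>\<zeta>. \<zeta> \<notin> \<real> \<and> resolvent_family A \<zeta>\<^sub>0 F \<zeta> \<noteq> resolvent_family A \<zeta>\<^sub>0 G \<zeta>))"
proof (intro conjI allI ballI impI)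
  show "\<exists>F\<in>S. \<forall>\<zeta>. \<zeta> \<notin> \<real> \<longrightarrow> R \<zeta> = resolvent_family A \<zeta>\<^sub>0 F \<zeta>"
    if "generalized_resolvent TYPE('b) A R" for R
    unfolding S_def by (rule generalized_resolvent_form[OF assms(1,3) that])
  show "generalized_resolvent TYPE(ell2) A (resolvent_family A \<zeta>\<^sub>0 F)" if "F \<in> S" for F
    using that unfolding S_def by (rule schur_class_generalized_resolvent[OF assms(1-3)])
  fix F G
  assume FG: "F \<in> S" "G \<in> S" and "\<exists>\<zeta>\<in>half_plane \<zeta>\<^sub>0. F \<zeta> \<noteq> G \<zeta>"
  then obtain \<zeta> where \<zeta>: "\<zeta> \<in> half_plane \<zeta>\<^sub>0" "F \<zeta> \<noteq> G \<zeta>"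
    by blast
  have "resolvent_family A \<zeta>\<^sub>0 F \<zeta> \<noteq> resolvent_family A \<zeta>\<^sub>0 G \<zeta>"
    using resolvent_family_inject[OF assms(1,3) \<zeta>(1) FG[unfolded S_def]] \<zeta>(2) by blast
  with half_plane_not_Reals[OF assms(3) \<zeta>(1)]
  show "\<exists>\<zeta>. \<zeta> \<notin> \<real> \<and> resolvent_family A \<zeta>\<^sub>0 F \<zeta> \<noteq> resolvent_family A \<zeta>\<^sub>0 G \<zeta>"
    by blast
qed

end
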